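(* Let $n\geq 3$. The dual symmetric inverse monoid $\mathscr{I}_n^*$ has monoid presentation $\langle \mathscr{X}_n \mid \mathscr{R}_n\rangle$ via $\Phi_n$. That is, the monoid homomorphism $\mathscr{X}_n^*\to\mathscr{I}_n^*$ extending $\Phi_n:\mathscr{X}_n\to\mathscr{I}_n^*$ (where $\mathscr{X}_n^*$ is the free monoid on $\mathscr{X}_n$) is surjective and its kernel is the congruence $\mathscr{R}_n^\sharp$ on $\mathscr{X}_n^*$ generated by $\mathscr{R}_n$; hence it induces an isomorphism $\langle \mathscr{X}_n\mid\mathscr{R}_n\rangle=\mathscr{X}_n^*/\mathscr{R}_n^\sharp\to\mathscr{I}_n^*$.
   Context: **The monoid $\mathscr{I}_n^*$.** Its elements (block bijections) are the set partitions of $\{1,\dots,n\}\cup\{1',\dots,n'\}$ in which every block contains at least one undashed and at least one dashed element. Equivalently, an element is a bijection from the set of blocks of a partition of $\{1,\dots,n\}$ (domain) to the set of blocks of a partition of $\{1,\dots,n\}$ (range); write $\big({A_1\atop B_1}\big|\cdots\big|{A_k\atop B_k}\big)$ for the element with blocks $A_i\cup B_i'$. Product $\theta_1\theta_2$: place $\theta_1$ above $\theta_2$, identifying the dashed (bottom) vertices of $\theta_1$ with the undashed (top) vertices of $\theta_2$ to form a middle row; take the connected components of the resulting graph (i.e. the join of the two equivalence relations on three rows) and delete the middle row. The identity is $\big({1\atop 1}\big|\cdots\big|{n\atop n}\big)$. **Generators and relations.** $\mathscr{X}_n=\{x,s_1,\ldots,s_{n-1}\}$. For $1\le i,j\le n-1$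 let $m_{ij}=1$ if $i=j$, $m_{ij}=3$ if $|i-j|=1$, $m_{ij}=2$ if $|i-j|>1$. Put $\sigma=s_2s_3s_1s_2$ and define words $l_2=xs_2s_1$, $l_{i+1}=s_{i+1}l_is_{i+1}s_i$ for $2\le i\le n-2$; $y_3=x$, $y_{i+1}=l_iy_is_i$ for $3\le i\le n-1$. $\mathscr{R}_n$ is the set of relations: (R1) $(s_is_j)^{m_{ij}}=1$ for $1\le i\le j\le n-1$; (R2) $x^3=x$; (R3) $xs_1=s_1x=x$; (R4) $xs_2x=xs_2xs_2=s_2xs_2x=xs_2x^2=x^2s_2x$; (R5) $x^2\sigma x^2\sigma=\sigma x^2\sigma x^2=xs_2s_3s_2x$; (R6) $y_is_iy_i=s_iy_is_i$ for $3\le i\le n-1$; (R7) $xs_i=s_ix$ for $4\le i\le n-1$. Relations involving a generator $s_i$ not in $\mathscr{X}_n$ are omitted (so $\mathscr{R}_3$ consists of (R1)–(R4) and $\mathscr{R}_4$ of (R1)–(R6)). **The map $\Phi_n:\mathscr{X}_n\to\mathscr{I}_n^*$.** $x\Phi_n=\big({1,2\atop 3}\big|{3\atop 1,2}\big|{4\atop 4}\big|\cdots\big|{n\atop n}\big)$, and for $1\le i\le n-1$, $s_i\Phi_n=\big({1\atop 1}\big|\cdots\big|{i-1\atop i-1}\big|{i\atop i+1}\big|{i+1\atop i}\big|{i+2\atop i+2}\big|\cdots\big|{n\atop n}\big)$. *)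

theory Defs
  imports "HOL-Algebra.Group" "HOL-Library.Disjoint_Sets" "HOL.Hull"
begin

section \<open>Monoid presentations\<close>

definition free_monoid :: "'a set \<Rightarrow> 'a list monoid" where
  "free_monoid A = \<lparr>carrier = lists A, mult = (@), one = []\<rparr>"

definition free_extension :: "('m, 'r) monoid_scheme \<Rightarrow> ('a \<Rightarrow> 'm) \<Rightarrow> 'a list \<Rightarrow> 'm" where
  "free_extension M \<phi> w = foldr (\<lambda>a m. \<phi> a \<otimes>\<^bsub>M\<^esub> m) w \<one>\<^bsub>M\<^esub>"

definition monoid_congruence :: "('m, 'r) monoid_scheme \<Rightarrow> ('m \<times> 'm) set \<Rightarrow> bool" where
  "monoid_congruence M r \<longleftrightarrow>
     equiv (carrier M) r \<and>
     (\<forall>(a, b) \<in> r. \<forall>c \<in> carrier M.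
        (c \<otimes>\<^bsub>M\<^esub> a, c \<otimes>\<^bsub>M\<^esub> b) \<in> r \<and> (a \<otimes>\<^bsub>M\<^esub> c, b \<otimes>\<^bsub>M\<^esub> c) \<in> r)"

definition congruence_generated ::
    "('m, 'r) monoid_scheme \<Rightarrow> ('m \<times> 'm) set \<Rightarrow> ('m \<times> 'm) set" where
  "congruence_generated M R = monoid_congruence M hull R"

definition quotient_monoid :: "('m, 'r) monoid_scheme \<Rightarrow> ('m \<times> 'm) set \<Rightarrow> 'm set monoid" where
  "quotient_monoid M r =
     \<lparr>carrier = carrier M // r,
      mult = (\<lambda>A B. \<Union>a\<in>A. \<Union>b\<in>B. r `` {a \<otimes>\<^bsub>M\<^esub> b}),
      one = r `` {\<one>\<^bsub>M\<^esub>}\<rparr>"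

definition kernel_congruence :: "('m, 'r) monoid_scheme \<Rightarrow> ('m \<Rightarrow> 'k) \<Rightarrow> ('m \<times> 'm) set" where
  "kernel_congruence M h = {(u, v). u \<in> carrier M \<and> v \<in> carrier M \<and> h u = h v}"


section \<open>The dual symmetric inverse monoid\<close>

text \<open>The undashed point \<open>i\<close> is \<open>Inl i\<close>, and the dashed point \<open>i'\<close> is \<open>Inr i\<close>.\<close>

definition block :: "nat set \<Rightarrow> nat set \<Rightarrow> (nat + nat) set" where
  "block A B = Inl ` A \<union> Inr ` B"

definition block_bijections :: "nat \<Rightarrow> (nat + nat) set set set" where
  "block_bijections n =
     {P. partition_on (block {1..n} {1..n}) P \<and>
         (\<forall>B \<in> P. (\<exists>i. Inl i \<in> B) \<and> (\<exists>j. Inr j \<in> B))}"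

datatype row_point = Upper nat | Middle nat | Lower nat

definition three_rows :: "nat \<Rightarrow> row_point set" where
  "three_rows n = Upper ` {1..n} \<union> Middle ` {1..n} \<union> Lower ` {1..n}"

definition same_block :: "'a set set \<Rightarrow> ('a \<times> 'a) set" where
  "same_block P = (\<Union>B\<in>P. B \<times> B)"

definition stacked :: "(nat + nat) set set \<Rightarrow> (nat + nat) set set \<Rightarrow> (row_point \<times> row_point) set" where
  "stacked P Q =
     same_block ((`) (case_sum Upper Middle) ` P) \<union> same_block ((`) (case_sum Middle Lower) ` Q)"

text \<open>
  The transitive closure of \<open>stacked P Q\<close> is already an equivalence relation on the three rows,
  as the two relations united there are symmetric and reflexive on the two rows they involve.
  No component consists of middle points only, because the blocks of a block bijection
  contain points of both kinds; hence deleting the middle row never yields an empty block.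
\<close>

definition block_product ::
    "nat \<Rightarrow> (nat + nat) set set \<Rightarrow> (nat + nat) set set \<Rightarrow> (nat + nat) set set" where
  "block_product n P Q =
     (\<lambda>C. case_sum Upper Lower -` C) ` (three_rows n // (stacked P Q)\<^sup>+)"

definition dual_symmetric_inverse_monoid :: "nat \<Rightarrow> (nat + nat) set set monoid" where
  "dual_symmetric_inverse_monoid n =
     \<lparr>carrier = block_bijections n,
      mult = block_product n,
      one = (\<lambda>i. block {i} {i}) ` {1..n}\<rparr>"


section \<open>Generators and relations\<close>

datatype generator = X | S nat

definition generators :: "nat \<Rightarrow> generator set" where
  "generators n = insert X (S ` {1..n - 1})"

definition coxeter_exponent :: "nat \<Rightarrow> nat \<Rightarrow> nat" where
  "coxeter_exponent i j = (if i = j then 1 else if j = i + 1 \<or> i = j + 1 then 3 else 2)"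

definition sigma_word :: "generator list" where
  "sigma_word = [S 2, S 3, S 1, S 2]"

text \<open>Only \<open>l_word i\<close> for \<open>i \<ge> 2\<close> and \<open>y_word i\<close> for \<open>i \<ge> 3\<close> are meaningful.\<close>

primrec l_word :: "nat \<Rightarrow> generator list" where
  "l_word 0 = []"
| "l_word (Suc i) =
     (if i = 1 then [X, S 2, S 1] else [S (i + 1)] @ l_word i @ [S (i + 1), S i])"

primrec y_word :: "nat \<Rightarrow> generator list" where
  "y_word 0 = []"
| "y_word (Suc i) = (if i = 2 then [X] else l_word i @ y_word i @ [S i])"

text \<open>
  A chain \<open>u\<^sub>1 = u\<^sub>2 = \<dots>\<close> of relations is represented by consecutive pairs. The condition
  \<open>4 \<le> n\<close> in the \<open>x_sigma\<close> rules expresses that these relations are omitted when \<open>S 3\<close> is not a generator.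
\<close>

inductive_set relations :: "nat \<Rightarrow> (generator list \<times> generator list) set" for n :: nat where
  coxeter: "1 \<le> i \<Longrightarrow> i \<le> j \<Longrightarrow> j \<le> n - 1 \<Longrightarrow>
    (concat (replicate (coxeter_exponent i j) [S i, S j]), []) \<in> relations n"
| x_cubed: "([X, X, X], [X]) \<in> relations n"
| x_s1_1: "([X, S 1], [S 1, X]) \<in> relations n"
| x_s1_2: "([S 1, X], [X]) \<in> relations n"
| x_s2_1: "([X, S 2, X], [X, S 2, X, S 2]) \<in> relations n"
| x_s2_2: "([X, S 2, X, S 2], [S 2, X, S 2, X]) \<in> relations n"
| x_s2_3: "([S 2, X, S 2, X], [X, S 2, X, X]) \<in> relations n"
| x_s2_4: "([X, S 2, X, X], [X, X, S 2, X]) \<in> relations n"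
| x_sigma_1: "4 \<le> n \<Longrightarrow>
    ([X, X] @ sigma_word @ [X, X] @ sigma_word,
     sigma_word @ [X, X] @ sigma_word @ [X, X]) \<in> relations n"
| x_sigma_2: "4 \<le> n \<Longrightarrow>
    (sigma_word @ [X, X] @ sigma_word @ [X, X], [X, S 2, S 3, S 2, X]) \<in> relations n"
| y_braid: "3 \<le> i \<Longrightarrow> i \<le> n - 1 \<Longrightarrow>
    (y_word i @ [S i] @ y_word i, [S i] @ y_word i @ [S i]) \<in> relations n"
| x_commute: "4 \<le> i \<Longrightarrow> i \<le> n - 1 \<Longrightarrow> ([X, S i], [S i, X]) \<in> relations n"

primrec \<Phi> :: "nat \<Rightarrow> generator \<Rightarrow> (nat + nat) set set" where
  "\<Phi> n X = {block {1, 2} {3}, block {3} {1, 2}} \<union> (\<lambda>j. block {j} {j}) ` {4..n}"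
| "\<Phi> n (S i) =
     {block {i} {i + 1}, block {i + 1} {i}} \<union> (\<lambda>j. block {j} {j}) ` ({1..n} - {i, i + 1})"

end

theory Submission
  imports Defs "HOL-Combinatorics.Permutations"
begin

text \<open>
  A word acts on functions on the row of points: \<open>S i\<close> composes with a transposition, and \<open>X\<close> is
  the partial map exchanging the value at 3 with the common value at 1 and 2. A block bijection is
  determined by the pairs of functions \<open>(u, l)\<close> that are constant on its blocks, and products
  become relational compositions, so the defining relations can be verified on functions.

  Conversely, in any monoid satisfying the relations, the conjugates of \<open>x\<close> under permutations yield
  idempotents \<open>join a b\<close>, which merge two blocks, and elements \<open>move p j q\<close>, which move the point
  \<open>j\<close> from the block of \<open>p\<close> to the block of \<open>q\<close>. Moves compose as matrix units do, and moves of
  different points commute; for three distinct blocks this last fact is the instance \<open>i = 4\<close> of the relation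
  \<open>y\<^sub>i s\<^sub>i y\<^sub>i = s\<^sub>i y\<^sub>i s\<^sub>i\<close>. Hence, once representatives are
  chosen for the blocks, there is a well-defined transfer between any two retractions onto
  them. Every word equals a transfer times a permutation, and this
  expression depends on the represented block bijection only, since
  changing the representatives conjugates a transfer by transpositions that it absorbs.
\<close>

text \<open>Joins and permutations alone give only block bijections whose blocks have equally many
  upper and lower points; moves supply the rest. A block bijection with k blocks has n - k
  non-representatives in either row, so a permutation of the lower row makes the representatives of
  the two rows agree. What remains sends each non-representative from its upper to its lower block,
  independently of the others: this is why moves of different points must commute, and why a
  transfer has one factor per point. The resulting expression is not a normal form, since the
  representatives are arbitrary; uniqueness is obtained by passing step by step from one set of
  representatives to another. Relations on functions replace partitions because their composition is
  visibly associative; the components of the three-row diagram are studied only once, to identify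
  the product. Surjectivity comes from carrying out the same two operations, merging two labels and
  relabelling one point, directly on pairs of functions.\<close>

datatype 'a endo = Endo (apply_endo: "'a \<Rightarrow> 'a")

text \<open>A wrapper type lets composition be the product of a type class. It hosts two models:
  adjacent transpositions, and left multiplication on congruence classes.\<close>

instantiation endo :: (type) monoid_mult
begin
definition "1 = Endo id"
definition "a * b = Endo (apply_endo a \<circ> apply_endo b)"
instance by standard (auto simp: one_endo_def times_endo_def comp_assoc)
end

lemma apply_endo_one [simp]: "apply_endo 1 = id"
  by (simp add: one_endo_def)

lemma apply_endo_times [simp]: "apply_endo (a * b) = apply_endo a \<circ> apply_endo b"
  by (simp add: times_endo_def)

declare upt_Suc [simp del]

section \<open>The Coxeter presentation of the symmetric group\<close>

locale coxeter_elements =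
  fixes m :: nat and s :: "nat \<Rightarrow> 'm::monoid_mult"
  assumes s_square: "1 \<le> i \<Longrightarrow> i \<le> m \<Longrightarrow> s i * s i = 1"
    and s_braid: "1 \<le> i \<Longrightarrow> Suc i \<le> m \<Longrightarrow> s i * s (Suc i) * s i = s (Suc i) * s i * s (Suc i)"
    and s_comm: "1 \<le> i \<Longrightarrow> i + 2 \<le> j \<Longrightarrow> j \<le> m \<Longrightarrow> s i * s j = s j * s i"
begin

abbreviation word_prod :: "nat list \<Rightarrow> 'm" where
  "word_prod w \<equiv> prod_list (map s w)"

lemma s_square_left: "1 \<le> i \<Longrightarrow> i \<le> m \<Longrightarrow> s i * (s i * z) = z"
  by (metis mult.assoc mult_1 s_square)

lemma s_comm_word_prod:
  assumes "1 \<le> i" "i \<le> m" "\<And>j. j \<in> set w \<Longrightarrow> 1 \<le> j \<and> j \<le> m \<and> (i + 2 \<le> j \<or> j + 2 \<le> i)"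
  shows "s i * word_prod w = word_prod w * s i"
  using assms(3)
proof (induction w)
  case (Cons j w)
  have "s i * s j = s j * s i"
    using Cons.prems[of j] assms s_comm[of i j] s_comm[of j i] by auto
  moreover have "s i * word_prod w = word_prod w * s i"
    using Cons by auto
  ultimately show ?case
    by simp (metis mult.assoc)
qed simp

text \<open>The words \<open>[a..<Suc k]\<close> are coset representatives for the subgroup
  generated by the letters below \<open>k\<close>; left multiplication by \<open>s i\<close> sends
  one to another, up to a letter below \<open>k\<close> on the right.\<close>

lemma s_mult_descending:
  assumes "1 \<le> i" "i \<le> k" "1 \<le> a" "a \<le> Suc k" "k \<le> m"
  shows "s i * word_prod [a..<Suc k] =
    word_prod [(if i = a then Suc a else if Suc i = a then i else a)..<Suc k] *
    word_prod (if Suc i < a then [i] else if a < i then [i - 1] else [])"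
proof -
  consider "i = a" | "Suc i = a" | "Suc i < a" | "a < i" by linarith
  then show ?thesis
  proof cases
    case 1
    then have "[a..<Suc k] = a # [Suc a..<Suc k]"
      using assms by (simp add: upt_rec)
    then show ?thesis
      using 1 assms by (simp add: s_square_left)
  next
    case 2
    then have "[i..<Suc k] = i # [a..<Suc k]"
      using assms by (simp add: upt_rec)
    then show ?thesis
      using 2 assms by (simp)
  next
    case 3
    then show ?thesis
      using assms s_comm_word_prod[of i "[a..<Suc k]"] by (simp)
  next
    case 4
    define j where "j = i - 1"
    have i: "i = Suc j" and aj: "a \<le> j" using 4 by (auto simp: j_def)
    \<comment> \<open>\<open>s i\<close> passes the letters below \<open>j\<close>, the braid
      relation turns \<open>s i * s j * s i\<close> into \<open>s j * s i * s j\<close>, and the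
      surplus \<open>s j\<close> passes the letters above \<open>i\<close>.\<close>
    have split: "[a..<Suc k] = [a..<j] @ [j, i] @ [Suc i..<Suc k]"
    proof -
      have "[a..<Suc k] = [a..<j] @ [j..<Suc k]"
        using upt_add_eq_append[of a j "Suc k - j"] aj i assms by simp
      moreover have "[j..<Suc k] = j # i # [Suc i..<Suc k]"
        using i assms by (simp add: upt_rec)
      ultimately show ?thesis by simp
    qed
    have c1: "s i * word_prod [a..<j] = word_prod [a..<j] * s i"
      by (rule s_comm_word_prod) (use assms i in auto)
    have c2: "s j * word_prod [Suc i..<Suc k] = word_prod [Suc i..<Suc k] * s j"
      by (rule s_comm_word_prod) (use assms i aj in auto)
    have b: "s i * (s j * s i) = s j * (s i * s j)"
      using s_braid[of j] i aj assms by (simp add: mult.assoc)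
    have "s i * word_prod [a..<Suc k] = s i * word_prod [a..<j] * (s j * s i) * word_prod [Suc i..<Suc k]"
      by (simp add: split mult.assoc)
    also have "\<dots> = word_prod [a..<j] * (s i * (s j * s i)) * word_prod [Suc i..<Suc k]"
      by (simp only: c1 mult.assoc)
    also have "\<dots> = word_prod [a..<j] * (s j * s i) * (s j * word_prod [Suc i..<Suc k])"
      by (simp only: b mult.assoc)
    also have "\<dots> = word_prod [a..<Suc k] * s j"
      by (simp add: c2 split mult.assoc)
    finally show ?thesis
      using 4 by (simp add: j_def)
  qed
qed

end

section \<open>Permutations spelled by words in adjacent transpositions\<close>

definition adjacent_perm :: "nat list \<Rightarrow> nat \<Rightarrow> nat" where
  "adjacent_perm w = foldr (\<lambda>i p. transpose i (Suc i) \<circ> p) w id"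

lemma adjacent_perm_simps [simp]:
  "adjacent_perm [] = id"
  "adjacent_perm (i # w) = transpose i (Suc i) \<circ> adjacent_perm w"
  by (simp_all add: adjacent_perm_def)

lemma adjacent_perm_append: "adjacent_perm (v @ w) = adjacent_perm v \<circ> adjacent_perm w"
  by (induction v) (auto simp: comp_assoc)

text \<open>Rewriting rules proved from the Coxeter relations thereby hold for permutations too, so
  that a word and its permutation can be rewritten in parallel.\<close>

interpretation adjacent: coxeter_elements m "\<lambda>i. Endo (transpose i (Suc i))" for m
  by unfold_locales
    (auto simp: times_endo_def one_endo_def fun_eq_iff transpose_def)

lemma adjacent_word_prod: "adjacent.word_prod w = Endo (adjacent_perm w)"
  by (induction w) (auto simp: times_endo_def one_endo_def)

lemma adjacent_perm_permutes: "set w \<subseteq> {a..<b} \<Longrightarrow> adjacent_perm w permutes {a..b}"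
  by (induction w) (auto intro!: permutes_compose permutes_swap_id permutes_id simp del: id_apply)

lemma adjacent_perm_outside:
  "set w \<subseteq> {a..<b} \<Longrightarrow> k \<notin> {a..b} \<Longrightarrow> adjacent_perm w k = k"
  using adjacent_perm_permutes permutes_not_in by metis

text \<open>This is what tells the coset representatives apart: the remaining letters, all below
  \<open>k\<close>, fix the last point.\<close>

lemma adjacent_perm_upt_last: "a \<le> Suc k \<Longrightarrow> adjacent_perm [a..<Suc k] (Suc k) = a"
proof (induction "Suc k - a" arbitrary: a)
  case (Suc d)
  then have "[a..<Suc k] = a # [Suc a..<Suc k]"
    by (simp add: upt_rec)
  with Suc show ?case
    by (simp)
qed auto

lemma inj_adjacent_perm: "inj (adjacent_perm w)"
  by (induction w) (auto intro!: inj_compose inj_on_id simp del: o_apply)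

text \<open>Undoing the word that sends the last point to its image under \<open>p\<close> leaves a
  permutation with one point fewer.\<close>

lemma ex_adjacent_word:
  assumes "p permutes {a..b}"
  shows "\<exists>w. set w \<subseteq> {a..<b} \<and> adjacent_perm w = p"
  using assms
proof (induction b arbitrary: p)
  case 0
  have "p = id"
    using 0 by (cases a) (auto simp: permutes_empty permutes_sing)
  then show ?case by (intro exI[of _ "[]"]) auto
next
  case (Suc k)
  show ?case
  proof (cases "a \<le> Suc k")
    case False
    then have "p = id" using Suc.prems by (simp add: permutes_empty)
    then show ?thesis by (intro exI[of _ "[]"]) auto
  next
    case True
    define c where "c = p (Suc k)"
    define d where "d = adjacent_perm [c..<Suc k]"
    have c: "a \<le> c" "c \<le> Suc k"
      using permutes_in_image[OF Suc.prems, of "Suc k"] True by (auto simp: c_def)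
    have d: "d permutes {a..Suc k}"
      unfolding d_def by (rule adjacent_perm_permutes) (use c in auto)
    have q: "inv_into UNIV d \<circ> p permutes {a..Suc k}"
      using Suc.prems d permutes_compose permutes_inv by blast
    have "(inv_into UNIV d \<circ> p) (Suc k) = Suc k"
      using adjacent_perm_upt_last[OF c(2)] d
      by (metis c_def comp_apply d_def permutes_inverses(2))
    then have "inv_into UNIV d \<circ> p permutes {a..k}"
      using q by (intro permutes_superset[OF q]) (auto simp: le_Suc_eq)
    from Suc.IH[OF this] obtain w where w: "set w \<subseteq> {a..<k}" "adjacent_perm w = inv_into UNIV d \<circ> p"
      by blast
    have "adjacent_perm ([c..<Suc k] @ w) = p"
      using d by (simp add: adjacent_perm_append w d_def[symmetric] o_assoc permutes_inv_o)
    moreover have "set ([c..<Suc k] @ w) \<subseteq> {a..<Suc k}"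
      using w c by auto
    ultimately show ?thesis by blast
  qed
qed

context coxeter_elements
begin

text \<open>The element and the permutation are factored by the same \<open>a\<close> and
  \<open>v\<close>, which allows a comparison of permutations to be lifted to elements.\<close>

lemma word_normal_form:
  assumes "set w \<subseteq> {1..<Suc k}" "k \<le> m"
  shows "\<exists>a v. 1 \<le> a \<and> a \<le> Suc k \<and> set v \<subseteq> {1..<k} \<and>
    word_prod w = word_prod [a..<Suc k] * word_prod v \<and>
    adjacent_perm w = adjacent_perm [a..<Suc k] \<circ> adjacent_perm v"
  using assms(1)
proof (induction w)
  case Nil
  show ?case by (intro exI[of _ "Suc k"] exI[of _ "[]"]) auto
next
  case (Cons i w)
  then obtain a v where av: "1 \<le> a" "a \<le> Suc k" "set v \<subseteq> {1..<k}"
    "word_prod w = word_prod [a..<Suc k] * word_prod v"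
    "adjacent_perm w = adjacent_perm [a..<Suc k] \<circ> adjacent_perm v"
    by (metis insert_subset list.simps(15))
  have i: "1 \<le> i" "i \<le> k" using Cons.prems by auto
  define b where "b = (if i = a then Suc a else if Suc i = a then i else a)"
  define u where "u = (if Suc i < a then [i] else if a < i then [i - 1] else [])"
  have eq: "s i * word_prod [a..<Suc k] = word_prod [b..<Suc k] * word_prod u"
    unfolding b_def u_def using s_mult_descending i av assms(2) by blast
  have "adjacent.word_prod (i # [a..<Suc k]) = adjacent.word_prod ([b..<Suc k] @ u)"
    unfolding b_def u_def using adjacent.s_mult_descending[of i k a k] i av by (simp)
  then have peq: "transpose i (Suc i) \<circ> adjacent_perm [a..<Suc k] = adjacent_perm [b..<Suc k] \<circ> adjacent_perm u"
    by (simp add: adjacent_word_prod adjacent_perm_append times_endo_def)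
  show ?case
  proof (intro exI conjI)
    show "1 \<le> b" "b \<le> Suc k" using av i by (auto simp: b_def)
    show "set (u @ v) \<subseteq> {1..<k}" using av i by (auto simp: u_def)
    show "word_prod (i # w) = word_prod [b..<Suc k] * word_prod (u @ v)"
      using eq by (simp add: av mult.assoc[symmetric])
    show "adjacent_perm (i # w) = adjacent_perm [b..<Suc k] \<circ> adjacent_perm (u @ v)"
      using peq by (simp add: av o_assoc adjacent_perm_append)
  qed
qed

text \<open>The image of the last point determines the coset representative; it cancels because
  permutations are injective, and induction applies to the rest.\<close>

theorem coxeter_presentation:
  assumes "set w \<subseteq> {1..<Suc k}" "set v \<subseteq> {1..<Suc k}" "k \<le> m" "adjacent_perm w = adjacent_perm v"
  shows "word_prod w = word_prod v"
  using assms
proof (induction k arbitrary: w v)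
  case (Suc k)
  obtain a w' where a: "1 \<le> a" "a \<le> Suc (Suc k)" "set w' \<subseteq> {1..<Suc k}"
    "word_prod w = word_prod [a..<Suc (Suc k)] * word_prod w'"
    "adjacent_perm w = adjacent_perm [a..<Suc (Suc k)] \<circ> adjacent_perm w'"
    using word_normal_form Suc.prems by blast
  obtain b v' where b: "1 \<le> b" "b \<le> Suc (Suc k)" "set v' \<subseteq> {1..<Suc k}"
    "word_prod v = word_prod [b..<Suc (Suc k)] * word_prod v'"
    "adjacent_perm v = adjacent_perm [b..<Suc (Suc k)] \<circ> adjacent_perm v'"
    using word_normal_form Suc.prems by blast
  have "adjacent_perm w (Suc (Suc k)) = a"
    using a adjacent_perm_outside[OF a(3), of "Suc (Suc k)"] adjacent_perm_upt_last[of a "Suc k"] by auto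
  moreover have "adjacent_perm v (Suc (Suc k)) = b"
    using b adjacent_perm_outside[OF b(3), of "Suc (Suc k)"] adjacent_perm_upt_last[of b "Suc k"] by auto
  ultimately have "a = b" using Suc.prems by simp
  then have "adjacent_perm [b..<Suc (Suc k)] \<circ> adjacent_perm w' = adjacent_perm [b..<Suc (Suc k)] \<circ> adjacent_perm v'"
    using a(5) b(5) Suc.prems(4) by metis
  then have "adjacent_perm w' = adjacent_perm v'"
    using injD[OF fun.inj_map[OF inj_adjacent_perm]] by blast
  then have "word_prod w' = word_prod v'"
    using Suc.IH a(3) b(3) Suc.prems(3) by (meson Suc_leD)
  then show ?case using a(4) b(4) \<open>a = b\<close> by metis
qed auto

end

section \<open>Monoids satisfying the relations\<close>

text \<open>Domain and image of \<open>f\<close> have complements of equal size, and a bijection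
  between these completes the permutation.\<close>

lemma ex_permutes_extending:
  assumes "finite A" "inj_on f B" "B \<subseteq> A" "f ` B \<subseteq> A"
  shows "\<exists>p. p permutes A \<and> (\<forall>b\<in>B. p b = f b)"
proof -
  have fin: "finite B" using assms finite_subset by blast
  have "card (A - B) = card (A - f ` B)"
    using assms fin by (simp add: card_Diff_subset card_image)
  then obtain h where h: "bij_betw h (A - B) (A - f ` B)"
    using assms finite_same_card_bij by (metis finite_Diff)
  have "bij_betw f B (f ` B)"
    using assms by (simp add: inj_on_imp_bij_betw)
  then have u: "bij_betw (\<lambda>x. if x \<in> B then f x else h x) (B \<union> (A - B)) (f ` B \<union> (A - f ` B))"
    using h by (intro bij_betw_disjoint_Un) (auto simp: bij_betw_def)
  have eqs: "B \<union> (A - B) = A" "f ` B \<union> (A - f ` B) = A" using assms by auto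
  have "bij_betw (\<lambda>x. if x \<in> B then f x else h x) A A"
    using u unfolding eqs .
  then have "bij_betw (\<lambda>x. if x \<in> A then if x \<in> B then f x else h x else x) A A"
    by (rule bij_betw_cong[THEN iffD1, rotated]) auto
  then have "(\<lambda>x. if x \<in> A then if x \<in> B then f x else h x else x) permutes A"
    by (rule bij_imp_permutes) auto
  then show ?thesis using assms by (intro exI conjI) (assumption, auto)
qed

lemma mult_lift: "a * b = c \<Longrightarrow> a * (b * z) = c * z" for a :: "'m::semigroup_mult"
  by (simp add: mult.assoc[symmetric])

lemma commute_mult:
  "a * b = b * a \<Longrightarrow> a * c = c * a \<Longrightarrow> a * (b * c) = b * c * a" for a :: "'m::semigroup_mult"
  by (metis mult.assoc)

text \<open>Working with an arbitrary assignment makes every derived equation a consequence of the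
  relations. Values of \<open>\<gamma>\<close> outside \<open>generators n\<close> are
  unconstrained, hence the index bounds in the lemmas.\<close>

locale presented =
  fixes n :: nat and \<gamma> :: "generator \<Rightarrow> 'm::monoid_mult"
  assumes three_le: "3 \<le> n"
    and relation: "(u, v) \<in> relations n \<Longrightarrow> prod_list (map \<gamma> u) = prod_list (map \<gamma> v)"
begin

abbreviation "x \<equiv> \<gamma> X"
abbreviation "s i \<equiv> \<gamma> (S i)"

lemma s_squares: "1 \<le> i \<Longrightarrow> i \<le> n - 1 \<Longrightarrow> s i * s i = 1"
  using relation[OF coxeter[of i i n]] by (simp add: coxeter_exponent_def)

sublocale coxeter_elements "n - 1" s
proof
  fix i j
  show "s i * s i = 1" if "1 \<le> i" "i \<le> n - 1" using that s_squares by simp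
  show "s i * s (Suc i) * s i = s (Suc i) * s i * s (Suc i)" if "1 \<le> i" "Suc i \<le> n - 1"
  proof -
    let ?a = "s i" and ?b = "s (Suc i)"
    have "?a * (?b * (?a * (?b * (?a * ?b)))) = 1"
      using relation[OF coxeter[of i "Suc i" n]] that
      by (simp add: coxeter_exponent_def numeral_eq_Suc)
    \<comment> \<open>Multiplying \<open>(ab)^3 = 1\<close> on the right by \<open>bab\<close>
      cancels the last three letters and leaves \<open>aba = bab\<close>.\<close>
    then have "?a * (?b * (?a * (?b * (?a * ?b)))) * (?b * ?a * ?b) = ?b * ?a * ?b"
      by simp
    moreover have "?a * ?a = 1" "?b * ?b = 1" using s_squares that by simp_all
    ultimately show ?thesis
      by (simp add: mult.assoc mult_lift[of ?a ?a] mult_lift[of ?b ?b])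
  qed
  show "s i * s j = s j * s i" if "1 \<le> i" "i + 2 \<le> j" "j \<le> n - 1"
  proof -
    have "s i * (s j * (s i * s j)) = 1"
      using relation[OF coxeter[of i j n]] that
      by (simp add: coxeter_exponent_def numeral_eq_Suc)
    then have "s i * (s j * (s i * s j)) * (s j * s i) = s j * s i" by simp
    moreover have "s i * s i = 1" "s j * s j = 1" using s_squares that by simp_all
    ultimately show ?thesis
      by (simp add: mult.assoc mult_lift[of "s i" "s i"] mult_lift[of "s j" "s j"])
  qed
qed

section \<open>The image of the symmetric group and the conjugates of x\<close>

definition perm_elem :: "(nat \<Rightarrow> nat) \<Rightarrow> 'm" where
  "perm_elem p = word_prod (SOME w. set w \<subseteq> {1..<n} \<and> adjacent_perm w = p)"

abbreviation Sym :: "(nat \<Rightarrow> nat) \<Rightarrow> bool" where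
  "Sym p \<equiv> p permutes {1..n}"

text \<open>By the Coxeter presentation all words for one permutation have the same value, so the
  choice in \<open>perm_elem\<close> does not matter.\<close>

lemma perm_elem_adjacent_perm: "set w \<subseteq> {1..<n} \<Longrightarrow> perm_elem (adjacent_perm w) = word_prod w"
  unfolding perm_elem_def
  by (rule someI2[of _ w]) (use three_le in \<open>auto intro!: coxeter_presentation[where k = "n - 1"]\<close>)

lemma perm_elem_id [simp]: "perm_elem id = 1"
  using perm_elem_adjacent_perm[of "[]"] by simp

lemma perm_elem_comp:
  assumes "Sym p" "Sym q"
  shows "perm_elem (p \<circ> q) = perm_elem p * perm_elem q"
proof -
  obtain v w where "set v \<subseteq> {1..<n}" "adjacent_perm v = p" "set w \<subseteq> {1..<n}" "adjacent_perm w = q"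
    using ex_adjacent_word assms by metis
  then show ?thesis
    using perm_elem_adjacent_perm[of v] perm_elem_adjacent_perm[of w] perm_elem_adjacent_perm[of "v @ w"]
    by (auto simp: adjacent_perm_append)
qed

lemma perm_elem_inverse:
  assumes "Sym p"
  shows "perm_elem p * perm_elem (inv_into UNIV p) = 1" "perm_elem (inv_into UNIV p) * perm_elem p = 1"
    "perm_elem p * (perm_elem (inv_into UNIV p) * z) = z" "perm_elem (inv_into UNIV p) * (perm_elem p * z) = z"
proof -
  show *: "perm_elem p * perm_elem (inv_into UNIV p) = 1" "perm_elem (inv_into UNIV p) * perm_elem p = 1"
    using assms perm_elem_comp[symmetric] permutes_inv[OF assms] permutes_inv_o[OF assms] by simp_all
  show "perm_elem p * (perm_elem (inv_into UNIV p) * z) = z" "perm_elem (inv_into UNIV p) * (perm_elem p * z) = z"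
    by (simp_all add: mult.assoc[symmetric] *)
qed

lemma perm_elem_cancel_right:
  assumes "Sym p" "a * perm_elem p = b * perm_elem p"
  shows "a = b"
  using assms(2) perm_elem_inverse[OF assms(1)] by (metis mult.assoc mult.right_neutral)

lemma x_relations:
  "x * x * x = x" "x * s 1 = x" "s 1 * x = x"
  "x * s 2 * x * s 2 = x * s 2 * x" "s 2 * x * s 2 * x = x * s 2 * x"
  "x * s 2 * x * x = x * s 2 * x" "x * x * s 2 * x = x * s 2 * x"
proof -
  have r: "x * (x * x) = x" "x * s 1 = s 1 * x" "s 1 * x = x"
    "x * (s 2 * x) = x * (s 2 * (x * s 2))" "x * (s 2 * (x * s 2)) = s 2 * (x * (s 2 * x))"
    "s 2 * (x * (s 2 * x)) = x * (s 2 * (x * x))" "x * (s 2 * (x * x)) = x * (x * (s 2 * x))"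
    using relation[OF x_cubed] relation[OF x_s1_1] relation[OF x_s1_2] relation[OF x_s2_1]
      relation[OF x_s2_2] relation[OF x_s2_3] relation[OF x_s2_4] by simp_all
  show "x * x * x = x" "x * s 1 = x" "s 1 * x = x"
    "x * s 2 * x * s 2 = x * s 2 * x" "s 2 * x * s 2 * x = x * s 2 * x"
    "x * s 2 * x * x = x * s 2 * x" "x * x * s 2 * x = x * s 2 * x"
    unfolding mult.assoc using r by metis+
qed

text \<open>The instance \<open>i = 3\<close> of the relation for \<open>y_word\<close>, since
  \<open>y_word 3\<close> is \<open>[X]\<close>.\<close>

lemma x_s3: "4 \<le> n \<Longrightarrow> x * s 3 * x = s 3 * x * s 3"
  using relation[OF y_braid[of 3 n]] by (simp add: numeral_3_eq_3 mult.assoc)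

lemma perm_elem_commute:
  assumes "p permutes {a..n}" "1 \<le> a" "\<And>i. a \<le> i \<Longrightarrow> i \<le> n - 1 \<Longrightarrow> s i * z = z * s i"
  shows "perm_elem p * z = z * perm_elem p"
proof -
  obtain w where w: "set w \<subseteq> {a..<n}" "adjacent_perm w = p"
    using ex_adjacent_word assms by metis
  have "word_prod w * z = z * word_prod w"
    using w(1)
  proof (induction w)
    case (Cons i w)
    then have "s i * z = z * s i" "word_prod w * z = z * word_prod w"
      using assms(3)[of i] by auto
    then show ?case by (simp add: mult.assoc) (simp add: mult.assoc[symmetric])
  qed simp
  moreover have "perm_elem p = word_prod w"
    using perm_elem_adjacent_perm[of w] w assms(2) by fastforce
  ultimately show ?thesis by simp
qed

lemma perm_elem_commute_x:
  assumes "p permutes {4..n}"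
  shows "perm_elem p * x = x * perm_elem p"
  by (rule perm_elem_commute[OF assms]) (use relation[OF x_commute] in auto)

text \<open>
  The conjugate of \<open>x\<close> that maps the block \<open>{a, b}\<close> to \<open>{c}\<close> and \<open>{c}\<close> to \<open>{a, b}\<close>;
  the value is meaningful only if \<open>a, b, c\<close> are distinct points of \<open>{1..n}\<close>.
\<close>

definition cross :: "nat \<Rightarrow> nat \<Rightarrow> nat \<Rightarrow> 'm" where
  "cross a b c = (let p = SOME p. Sym p \<and> p 1 = a \<and> p 2 = b \<and> p 3 = c
    in perm_elem p * x * perm_elem (inv_into UNIV p))"

text \<open>Two admissible choices of \<open>p\<close> differ by a permutation fixing 1, 2 and 3,
  which commutes with \<open>x\<close>; so the choice in \<open>cross\<close> does not
  matter.\<close>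

lemma cross_perm_elem:
  assumes "Sym p" "p 1 = a" "p 2 = b" "p 3 = c"
  shows "cross a b c * perm_elem p = perm_elem p * x"
proof -
  have "\<exists>p. Sym p \<and> p 1 = a \<and> p 2 = b \<and> p 3 = c" using assms by blast
  then have ex: "Sym q \<and> q 1 = a \<and> q 2 = b \<and> q 3 = c"
    if "q = (SOME p. Sym p \<and> p 1 = a \<and> p 2 = b \<and> p 3 = c)" for q
    unfolding that by (rule someI_ex)
  obtain q where q: "Sym q" "q 1 = a" "q 2 = b" "q 3 = c"
    and qc: "cross a b c = perm_elem q * x * perm_elem (inv_into UNIV q)"
    using ex unfolding cross_def Let_def by blast
  define r where "r = inv_into UNIV q \<circ> p"
  have r: "Sym r" using q assms unfolding r_def by (simp add: permutes_compose permutes_inv)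
  have "r 1 = 1" "r 2 = 2" "r 3 = 3"
    unfolding r_def using q assms by (metis comp_apply permutes_inverses(2))+
  then have "k \<in> {1..n} - {4..n} \<Longrightarrow> r k = k" for k
    by (cases "k = 1 \<or> k = 2 \<or> k = 3") auto
  then have r4: "r permutes {4..n}"
    using permutes_superset[OF r] by blast
  have p: "perm_elem p = perm_elem q * perm_elem r"
    using perm_elem_comp[OF q(1) r] permutes_inv_o[OF q(1)] by (simp add: r_def o_assoc)
  show ?thesis
    by (simp add: p qc mult.assoc perm_elem_inverse[OF q(1)] perm_elem_commute_x[OF r4])
qed

definition points :: "nat list \<Rightarrow> bool" where
  "points xs \<longleftrightarrow> distinct xs \<and> set xs \<subseteq> {1..n}"

text \<open>Such a \<open>p\<close> serves as a frame: conjugation by it carries an equation about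
  the points 1, 2, ... to arbitrary distinct points.\<close>

lemma ex_frame:
  assumes "points xs"
  shows "\<exists>p. Sym p \<and> (\<forall>i<length xs. p (Suc i) = xs ! i)"
proof -
  have "length xs = card (set xs)" using assms by (simp add: points_def distinct_card)
  also have "\<dots> \<le> n" using assms card_mono[of "{1..n}" "set xs"] by (simp add: points_def)
  finally have len: "length xs \<le> n" .
  have "\<exists>p. Sym p \<and> (\<forall>i\<in>{1..length xs}. p i = xs ! (i - 1))"
  proof (rule ex_permutes_extending)
    show "inj_on (\<lambda>i. xs ! (i - 1)) {1..length xs}"
      using assms by (auto simp: inj_on_def points_def nth_eq_iff_index_eq)
    show "(\<lambda>i. xs ! (i - 1)) ` {1..length xs} \<subseteq> {1..n}"
      using assms by (auto simp: points_def subset_iff)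
  qed (use len in auto)
  then show ?thesis by fastforce
qed

lemma frame3:
  assumes "points [a, b, c]"
  obtains p where "Sym p" "p 1 = a" "p 2 = b" "p 3 = c"
proof -
  obtain p where p: "Sym p" "\<And>i. i < 3 \<Longrightarrow> p (Suc i) = [a, b, c] ! i"
    using ex_frame[OF assms] by auto
  have "p 1 = a" using p(2)[of 0] by simp
  moreover have "p 2 = b" using p(2)[of 1] by (simp add: numeral_2_eq_2)
  moreover have "p 3 = c" using p(2)[of 2] by simp
  ultimately show ?thesis using p(1) that by blast
qed

lemma frame4:
  assumes "points [a, b, c, d]"
  obtains p where "Sym p" "p 1 = a" "p 2 = b" "p 3 = c" "p 4 = d"
proof -
  obtain p where p: "Sym p" "\<And>i. i < 4 \<Longrightarrow> p (Suc i) = [a, b, c, d] ! i"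
    using ex_frame[OF assms] by auto
  have "p 1 = a" using p(2)[of 0] by simp
  moreover have "p 2 = b" using p(2)[of 1] by (simp add: numeral_2_eq_2)
  moreover have "p 3 = c" using p(2)[of 2] by simp
  moreover have "p 4 = d" using p(2)[of 3] by simp
  ultimately show ?thesis using p(1) that by blast
qed

lemma frame5:
  assumes "points [a, b, c, d, e]"
  obtains p where "Sym p" "p 1 = a" "p 2 = b" "p 3 = c" "p 4 = d" "p 5 = e"
proof -
  obtain p where p: "Sym p" "\<And>i. i < 5 \<Longrightarrow> p (Suc i) = [a, b, c, d, e] ! i"
    using ex_frame[OF assms] by auto
  have "p 1 = a" using p(2)[of 0] by simp
  moreover have "p 2 = b" using p(2)[of 1] by (simp add: numeral_2_eq_2)
  moreover have "p 3 = c" using p(2)[of 2] by simp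
  moreover have "p 4 = d" using p(2)[of 3] by simp
  moreover have "p 5 = e" using p(2)[of 4] by simp
  ultimately show ?thesis using p(1) that by blast
qed

lemma points_length: "points xs \<Longrightarrow> length xs \<le> n"
  using card_mono[of "{1..n}" "set xs"] by (simp add: points_def distinct_card[symmetric])

text \<open>If \<open>q\<close> is a frame for \<open>a, b, c\<close>, then
  \<open>p \<circ> q\<close> is one for their images, so conjugation merely renames the
  points.\<close>

lemma perm_elem_cross:
  assumes "Sym p" "points [a, b, c]"
  shows "perm_elem p * cross a b c = cross (p a) (p b) (p c) * perm_elem p"
proof -
  obtain q where q: "Sym q" "q 1 = a" "q 2 = b" "q 3 = c" using frame3 assms by blast
  have pq: "Sym (p \<circ> q)" using q assms by (simp add: permutes_compose)
  show ?thesis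
  proof (rule perm_elem_cancel_right[OF q(1)])
    have "perm_elem p * cross a b c * perm_elem q = perm_elem (p \<circ> q) * x"
      by (simp add: mult.assoc cross_perm_elem[OF q] perm_elem_comp[OF assms(1) q(1)])
    also have "\<dots> = cross (p a) (p b) (p c) * perm_elem (p \<circ> q)"
      using cross_perm_elem[OF pq] q by simp
    finally show "perm_elem p * cross a b c * perm_elem q = cross (p a) (p b) (p c) * perm_elem p * perm_elem q"
      by (simp add: mult.assoc perm_elem_comp[OF assms(1) q(1)])
  qed
qed

definition swap :: "nat \<Rightarrow> nat \<Rightarrow> 'm" where
  "swap a b = perm_elem (transpose a b)"

lemma Sym_transpose: "a \<in> {1..n} \<Longrightarrow> b \<in> {1..n} \<Longrightarrow> Sym (transpose a b)"
  by (rule permutes_swap_id)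

lemma swap_commute: "swap a b = swap b a"
  by (simp add: swap_def transpose_commute)

lemma swap_swap [simp]:
  assumes "points [a, b]"
  shows "swap a b * swap a b = 1" "swap a b * (swap a b * z) = z"
proof -
  show *: "swap a b * swap a b = 1"
    using assms perm_elem_comp[OF Sym_transpose Sym_transpose, of a b a b]
    by (simp add: swap_def points_def)
  show "swap a b * (swap a b * z) = z" by (simp add: mult_lift[OF *])
qed

lemma perm_elem_swap:
  assumes "Sym p" "a \<in> {1..n}" "b \<in> {1..n}"
  shows "perm_elem p * swap a b = swap (p a) (p b) * perm_elem p"
proof -
  have "p \<circ> transpose a b = transpose (p a) (p b) \<circ> p"
  proof
    fix k
    have "p k = p l \<longleftrightarrow> k = l" for l
      using permutes_inj[OF assms(1)] by (rule inj_eq)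
    then show "(p \<circ> transpose a b) k = (transpose (p a) (p b) \<circ> p) k"
      unfolding comp_apply transpose_def by (simp only: if_distrib[of p])
  qed
  moreover have "p a \<in> {1..n}" "p b \<in> {1..n}"
    using assms permutes_in_image[OF assms(1)] by simp_all
  ultimately show ?thesis
    using assms perm_elem_comp[OF assms(1) Sym_transpose, of a b]
      perm_elem_comp[OF Sym_transpose assms(1), of "p a" "p b"]
    by (simp add: swap_def)
qed

lemma swap_swap_conj:
  assumes "points [a, b]" "c \<in> {1..n}" "d \<in> {1..n}"
  shows "swap a b * swap c d = swap (transpose a b c) (transpose a b d) * swap a b"
  using perm_elem_swap[OF Sym_transpose, of a b c d] assms by (simp add: swap_def points_def)

lemma swap_cross:
  assumes "points [a, b]" "points [c, d, e]"
  shows "swap a b * cross c d e =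
    cross (transpose a b c) (transpose a b d) (transpose a b e) * swap a b"
  using perm_elem_cross[OF Sym_transpose, of a b c d e] assms by (simp add: swap_def points_def)

lemma s_eq_swap: "1 \<le> i \<Longrightarrow> i < n \<Longrightarrow> s i = swap i (Suc i)"
  using perm_elem_adjacent_perm[of "[i]"] by (simp add: swap_def)

end

declare One_nat_def [simp del]

context presented
begin

lemma points_map: "Sym p \<Longrightarrow> points xs \<Longrightarrow> points (map p xs)"
  unfolding points_def distinct_map set_map
  by (metis image_mono inj_on_subset permutes_image permutes_inj_on subset_UNIV)

declare points_def [simp]

lemma swap_perm_elem:
  assumes "Sym p" "p i = a" "p (Suc i) = b" "1 \<le> i" "i < n"
  shows "swap a b * perm_elem p = perm_elem p * s i"
  using perm_elem_swap[of p i "Suc i"] assms by (simp add: s_eq_swap)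

lemma ex_third_point: "points [a, b] \<Longrightarrow> \<exists>c. points [a, b, c]"
proof -
  assume ab: "points [a, b]"
  have "\<not> {1, 2, 3} \<subseteq> {a, b}"
    using card_mono[of "{a, b}" "{1, 2, 3::nat}"] card_insert_le_m1[of 2 "{b}" a] by auto
  then obtain c where "c \<in> {1, 2, 3}" "c \<notin> {a, b}" by blast
  then show ?thesis using ab three_le by (intro exI[of _ c]) auto
qed

subsection \<open>Three points\<close>

text \<open>The relations of \<open>x\<close>, \<open>s 1\<close> and \<open>s 2\<close> seen in a
  frame: multiplied by \<open>perm_elem p\<close> on the right, every factor turns into a
  generator.\<close>

lemma cross_relations:
  assumes "points [a, b, c]"
  shows "cross a b c * cross a b c * cross a b c = cross a b c"
    "cross a b c * swap a b = cross a b c" "swap a b * cross a b c = cross a b c"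
    "cross a b c * swap b c * cross a b c * swap b c = cross a b c * swap b c * cross a b c"
    "swap b c * cross a b c * swap b c * cross a b c = cross a b c * swap b c * cross a b c"
    "cross a b c * swap b c * cross a b c * cross a b c = cross a b c * swap b c * cross a b c"
    "cross a b c * cross a b c * swap b c * cross a b c = cross a b c * swap b c * cross a b c"
proof -
  obtain p where p: "Sym p" "p 1 = a" "p 2 = b" "p 3 = c" using frame3[OF assms] .
  have r: "cross a b c * perm_elem p = perm_elem p * x" "swap a b * perm_elem p = perm_elem p * s 1"
    "swap b c * perm_elem p = perm_elem p * s 2"
    using cross_perm_elem[OF p] swap_perm_elem[OF p(1), of 1] swap_perm_elem[OF p(1), of 2] p three_le
    by simp_all
  note rules = mult.assoc r r[THEN mult_lift] x_relations[unfolded mult.assoc]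
  show "cross a b c * cross a b c * cross a b c = cross a b c"
    "cross a b c * swap a b = cross a b c" "swap a b * cross a b c = cross a b c"
    "cross a b c * swap b c * cross a b c * swap b c = cross a b c * swap b c * cross a b c"
    "swap b c * cross a b c * swap b c * cross a b c = cross a b c * swap b c * cross a b c"
    "cross a b c * swap b c * cross a b c * cross a b c = cross a b c * swap b c * cross a b c"
    "cross a b c * cross a b c * swap b c * cross a b c = cross a b c * swap b c * cross a b c"
    by (rule perm_elem_cancel_right[OF p(1)], simp only: rules)+
qed

lemma cross_sym: "points [a, b, c] \<Longrightarrow> cross b a c = cross a b c"
  using swap_cross[of a b a b c] cross_relations[of a b c] perm_elem_cancel_right[of "transpose a b" "cross b a c" "cross a b c"]
  by (simp add: Sym_transpose swap_def[symmetric])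

text \<open>This is \<open>x s_3 x = s_3 x s_3\<close> in a frame, where conjugation by
  \<open>swap c d\<close> exchanges the two crosses.\<close>

lemma cross_swap_commute: "points [a, b, c, d] \<Longrightarrow> cross a b c * cross a b d = cross a b d * swap c d"
proof -
  assume pts: "points [a, b, c, d]"
  then obtain p where p: "Sym p" "p 1 = a" "p 2 = b" "p 3 = c" "p 4 = d" using frame4 by blast
  have n: "4 \<le> n" using points_length[OF pts] by simp
  have r: "cross a b c * perm_elem p = perm_elem p * x" "swap c d * perm_elem p = perm_elem p * s 3"
    using cross_perm_elem[OF p(1-4)] swap_perm_elem[OF p(1), of 3] p n by simp_all
  have "cross a b c * swap c d * cross a b c = swap c d * cross a b c * swap c d"
    by (rule perm_elem_cancel_right[OF p(1)])
      (simp only: mult.assoc r r[THEN mult_lift] x_s3[OF n, unfolded mult.assoc])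
  moreover have "swap c d * cross a b c = cross a b d * swap c d"
    using swap_cross[of c d a b c] pts by simp
  ultimately have "cross a b c * cross a b d * swap c d = cross a b d"
    using pts by (simp add: mult.assoc)
  then have "cross a b c * cross a b d * (swap c d * swap c d) = cross a b d * swap c d"
    by (simp only: mult.assoc[symmetric])
  then show ?thesis using pts by simp
qed

text \<open>It makes \<open>join\<close> independent of its auxiliary third point. The exchange rule
  for the two crosses, used with \<open>c\<close> and \<open>d\<close> in either order, carries the
  swap through the square.\<close>

lemma cross_square_independent:
  assumes "points [a, b, c, d]"
  shows "cross a b c * cross a b c = cross a b d * cross a b d"
proof -
  let ?s = "swap c d" and ?c = "cross a b c" and ?d = "cross a b d"
  have cd: "?c * ?d = ?d * ?s" using cross_swap_commute assms by blast
  have s: "?s * ?c = ?d * ?s" "?s * ?d = ?c * ?s" "?s * ?s = 1"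
    using swap_cross[of c d a b c] swap_cross[of c d a b d] assms by simp_all
  have "?d * ?d * ?s = ?d * (?c * ?d)" by (simp only: cd mult.assoc)
  also have "\<dots> = ?d * ?c * (?s * ?c * ?s)" using s by (metis mult.assoc mult_1_right)
  also have "?d * ?c = ?c * ?s" 
    using cross_swap_commute[of a b d c] assms by (simp add: swap_commute)
  also have "?c * ?s * (?s * ?c * ?s) = ?c * ?c * ?s"
    using assms by (simp add: mult.assoc)
  finally have "?d * ?d * ?s * ?s = ?c * ?c * ?s * ?s" by simp
  then show ?thesis using s(3) by (simp add: mult.assoc)
qed

section \<open>Idempotents that merge two blocks\<close>

definition join :: "nat \<Rightarrow> nat \<Rightarrow> 'm" where
  "join a b = (let c = SOME c. points [a, b, c] in cross a b c * cross a b c)"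

lemma join_eq: "points [a, b, c] \<Longrightarrow> join a b = cross a b c * cross a b c"
proof -
  assume abc: "points [a, b, c]"
  define d where "d = (SOME d. points [a, b, d])"
  have abd: "points [a, b, d]" unfolding d_def using abc by (rule someI)
  have "join a b = cross a b d * cross a b d" by (simp only: join_def Let_def d_def)
  also have "\<dots> = cross a b c * cross a b c"
    using cross_square_independent[of a b c d] abc abd by (cases "c = d") auto
  finally show ?thesis .
qed

lemma join_cross:
  assumes "points [a, b, c]"
  shows "join a b * cross a b c = cross a b c" "cross a b c * join a b = cross a b c"
  using cross_relations(1)[OF assms] by (simp_all add: join_eq[OF assms] mult.assoc)

lemma join_join_same: "points [a, b] \<Longrightarrow> join a b * join a b = join a b"
proof -
  assume "points [a, b]"
  then obtain c where c: "points [a, b, c]" using ex_third_point by blast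
  show ?thesis using join_cross[OF c] by (simp add: join_eq[OF c] mult.assoc)
qed

lemma join_swap:
  assumes "points [a, b]"
  shows "join a b * swap a b = join a b" "swap a b * join a b = join a b"
proof -
  obtain c where c: "points [a, b, c]" using ex_third_point assms by blast
  show "join a b * swap a b = join a b" "swap a b * join a b = join a b"
    using cross_relations(2,3)[OF c] mult_lift[OF cross_relations(3)[OF c]]
    unfolding join_eq[OF c] by (simp_all only: mult.assoc)
qed

lemma join_sym: "points [a, b] \<Longrightarrow> join b a = join a b"
proof -
  assume ab: "points [a, b]"
  obtain c where c: "points [a, b, c]" using ex_third_point[OF ab] by blast
  then have "points [b, a, c]" by auto
  then show ?thesis using join_eq[OF c] join_eq[of b a c] cross_sym[OF c] by simp
qed

lemma perm_elem_join:
  assumes "Sym p" "points [a, b]"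
  shows "perm_elem p * join a b = join (p a) (p b) * perm_elem p"
proof -
  obtain c where c: "points [a, b, c]" using ex_third_point assms by blast
  have "points [p a, p b, p c]"
    using points_map[OF assms(1) c] by (simp only: list.map)
  then have j: "join (p a) (p b) = cross (p a) (p b) (p c) * cross (p a) (p b) (p c)"
    by (rule join_eq)
  note r = perm_elem_cross[OF assms(1) c]
  show ?thesis
    unfolding j join_eq[OF c] by (simp only: mult.assoc[symmetric] r) (simp only: mult.assoc r)
qed

lemma swap_join:
  assumes "points [a, b]" "points [c, d]"
  shows "swap a b * join c d = join (transpose a b c) (transpose a b d) * swap a b"
  using perm_elem_join[OF Sym_transpose, of a b c d] assms by (simp add: swap_def)

text \<open>The chain of relations for \<open>x s_2 x\<close> identifies both products with one
  element, so joins that share a point commute.\<close>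

lemma join_join_cross:
  assumes "points [a, b, c]"
  shows "join a b * join a c = cross a b c * swap b c * cross a b c"
    "join a c * join a b = cross a b c * swap b c * cross a b c"
proof -
  let ?s = "swap b c" and ?x = "cross a b c"
  have ac: "join a c = ?s * join a b * ?s"
    using swap_join[of b c a b] assms by (simp add: mult.assoc)
  note r = cross_relations(4-7)[OF assms, unfolded mult.assoc]
  have j: "join a b = ?x * ?x" using join_eq[OF assms] .
  have "join a b * join a c = ?x * (?x * ?s * ?x * ?x) * ?s" by (simp only: ac j mult.assoc)
  then show "join a b * join a c = ?x * ?s * ?x" by (simp only: mult.assoc r r[THEN mult_lift, unfolded mult.assoc])
  have "join a c * join a b = ?s * (?x * (?x * ?s * ?x)) * ?x" by (simp only: ac j mult.assoc)
  then show "join a c * join a b = ?x * ?s * ?x" by (simp only: mult.assoc r r[THEN mult_lift, unfolded mult.assoc])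
qed

lemma join_commute_overlap: "points [a, b, c] \<Longrightarrow> join a b * join a c = join a c * join a b"
  by (simp only: join_join_cross)

text \<open>Once \<open>a\<close>, \<open>b\<close> and \<open>c\<close> lie in one block, permuting
  or crossing them changes nothing.\<close>

lemma join_join_absorb:
  assumes "points [a, b, c]"
  shows "join a b * join a c * swap b c = join a b * join a c"
    "swap b c * (join a b * join a c) = join a b * join a c"
    "join a b * join a c * swap a b = join a b * join a c"
    "swap a b * (join a b * join a c) = join a b * join a c"
    "join a b * join a c * cross a b c = join a b * join a c"
    "cross a b c * (join a b * join a c) = join a b * join a c"
proof -
  note r = cross_relations[OF assms, unfolded mult.assoc]
  show "join a b * join a c * swap b c = join a b * join a c"
    "swap b c * (join a b * join a c) = join a b * join a c"
    "join a b * join a c * swap a b = join a b * join a c"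
    "swap a b * (join a b * join a c) = join a b * join a c"
    "join a b * join a c * cross a b c = join a b * join a c"
    "cross a b c * (join a b * join a c) = join a b * join a c"
    unfolding join_join_cross[OF assms]
    by (simp_all only: mult.assoc r r[THEN mult_lift, unfolded mult.assoc])
qed

text \<open>The product absorbs \<open>swap a b\<close> on both sides, while conjugation by it turns
  \<open>join a c\<close> into \<open>join b c\<close>.\<close>

lemma join_join_rotate: "points [a, b, c] \<Longrightarrow> join a b * join a c = join a b * join b c"
proof -
  assume abc: "points [a, b, c]"
  have "join a b * join a c = swap a b * (join a b * join a c)"
    using join_join_absorb(4) abc by simp
  also have "\<dots> = join a b * join b c * swap a b"
    using swap_join[of a b a b] swap_join[of a b a c] join_sym[of a b] abc
    by (simp add: mult.assoc[symmetric]) (simp add: mult.assoc)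
  finally have "join a b * join a c * swap a b = join a b * join b c"
    using abc by (simp add: mult.assoc)
  then show ?thesis using join_join_absorb(3) abc by simp
qed

subsection \<open>Four points\<close>

lemma sigma_relations:
  assumes "4 \<le> n"
  defines "\<sigma> \<equiv> s 2 * s 3 * s 1 * s 2"
  shows "x * x * \<sigma> * x * x * \<sigma> = x * s 2 * s 3 * s 2 * x" "\<sigma> * x * x * \<sigma> * x * x = x * s 2 * s 3 * s 2 * x"
  using relation[OF x_sigma_1[OF assms(1)]] relation[OF x_sigma_2[OF assms(1)]]
  by (simp_all add: \<sigma>_def sigma_word_def mult.assoc)

text \<open>\<open>\<sigma>\<close> exchanges 1 with 3 and 2 with 4, so it conjugates the join of 1
  and 2 to that of 3 and 4; and \<open>s_2 s_3 s_2\<close> is the transposition of 2 and 4. The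
  relations for \<open>\<sigma>\<close> thus give both products in a frame.\<close>

lemma join_join_disjoint:
  assumes "points [a, b, c, d]"
  shows "join a b * join c d = cross a b c * swap b d * cross a b c"
    "join c d * join a b = cross a b c * swap b d * cross a b c"
proof -
  obtain p where p: "Sym p" "p 1 = a" "p 2 = b" "p 3 = c" "p 4 = d" using frame4[OF assms] .
  have n: "4 \<le> n" using points_length[OF assms] by simp
  define q where "q = adjacent_perm [2, 3, 1, 2]"
  define \<sigma> where "\<sigma> = s 2 * s 3 * s 1 * s 2"
  have q: "Sym q" unfolding q_def by (rule adjacent_perm_permutes) (use n in auto)
  have q\<sigma>: "perm_elem q = \<sigma>"
    using perm_elem_adjacent_perm[of "[2, 3, 1, 2]"] n by (simp add: q_def \<sigma>_def mult.assoc)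
  have q1: "q 1 = 3" "q 2 = 4" "q 3 = 1" by (simp_all add: q_def transpose_def)
  have \<sigma>\<sigma>: "\<sigma> * \<sigma> = 1"
  proof -
    have "s 2 * (s 2 * z) = z" "s 3 * (s 3 * z) = z" "s 1 * (s 1 * z) = z" "s 1 * s 3 = s 3 * s 1" for z
      using n s_square_left s_comm[of 1 3] by auto
    moreover have "s 2 * s 2 = 1" using n s_square[of 2] by simp
    ultimately show ?thesis
      by (simp add: \<sigma>_def mult.assoc mult_lift[of "s 1" "s 3"])
  qed
  have pq: "Sym (p \<circ> q)" using p q by (simp add: permutes_compose)
  \<comment> \<open>\<open>p \<circ> q\<close> is a frame for \<open>c, d, a\<close>; this expresses
    \<open>join c d\<close> through \<open>\<sigma>\<close> and \<open>x\<close>.\<close>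
  have "cross c d a * perm_elem (p \<circ> q) = perm_elem (p \<circ> q) * x"
    using cross_perm_elem[OF pq] q1 p by simp
  then have cross_cda: "cross c d a * (perm_elem p * (\<sigma> * z)) = perm_elem p * (\<sigma> * (x * z))" for z
    unfolding perm_elem_comp[OF p(1) q] q\<sigma> by (simp only: mult.assoc[symmetric])
  have cross_cda: "cross c d a * (perm_elem p * z) = perm_elem p * (\<sigma> * (x * (\<sigma> * z)))" for z
    using cross_cda[of "\<sigma> * z"] by (simp add: mult_lift[OF \<sigma>\<sigma>])
  have r: "cross a b c * perm_elem p = perm_elem p * x" using cross_perm_elem[OF p(1-4)] .
  have sbd: "swap b d = swap b c * swap c d * swap b c"
    using swap_swap_conj[of b c c d] assms by (simp add: mult.assoc)
  have s23: "swap b c * perm_elem p = perm_elem p * s 2" "swap c d * perm_elem p = perm_elem p * s 3"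
    using swap_perm_elem[OF p(1), of 2] swap_perm_elem[OF p(1), of 3] p n by simp_all
  have r': "swap b d * perm_elem p = perm_elem p * (s 2 * (s 3 * s 2))"
    unfolding sbd by (simp only: mult.assoc s23 s23[THEN mult_lift])
  have j: "join a b = cross a b c * cross a b c" "join c d = cross c d a * cross c d a"
    using join_eq[of a b c] join_eq[of c d a] assms by auto
  have s\<sigma>: "\<sigma> * (\<sigma> * z) = z" for z by (simp add: mult_lift[OF \<sigma>\<sigma>])
  note rules = mult.assoc r r' r[THEN mult_lift] r'[THEN mult_lift] cross_cda cross_cda[of 1, unfolded mult_1_right] s\<sigma> j \<sigma>\<sigma>
    sigma_relations[OF n, folded \<sigma>_def, unfolded mult.assoc]
  show "join a b * join c d = cross a b c * swap b d * cross a b c"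
    "join c d * join a b = cross a b c * swap b d * cross a b c"
    by (rule perm_elem_cancel_right[OF p(1)], simp only: rules)+
qed

lemma join_commute:
  assumes "points [a, b]" "points [c, d]"
  shows "join a b * join c d = join c d * join a b"
proof -
  consider "a \<noteq> c" "a \<noteq> d" "b \<noteq> c" "b \<noteq> d" | "a = c" "b = d" | "a = d" "b = c" | "a = c" "b \<noteq> d" | "a = d" "b \<noteq> c"
    | "b = c" "a \<noteq> d" | "b = d" "a \<noteq> c"
    by blast
  then show ?thesis
  proof cases
    case 1
    then have "points [a, b, c, d]" using assms by simp
    then show ?thesis by (simp only: join_join_disjoint)
  next
    case 3
    then show ?thesis using join_sym assms by simp
  next
    case 4
    then show ?thesis using join_commute_overlap[of a b d] assms by simp
  next
    case 5
    then show ?thesis using join_commute_overlap[of a b c] assms join_sym[of a c] by simp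
  next
    case 6
    then show ?thesis using join_commute_overlap[of b a d] assms join_sym[of a b] by simp
  next
    case 7
    then show ?thesis using join_commute_overlap[of b a c] assms join_sym[of a b] join_sym[of b c] by simp
  qed simp
qed

text \<open>A cross exchanges the block \<open>{a, b}\<close> with \<open>{c}\<close>, so merging
  \<open>d\<close> with \<open>a\<close> on one side amounts to merging it with \<open>c\<close> on
  the other.\<close>

lemma join_cross_exchange:
  assumes "points [a, b, c, d]"
  shows "join a d * cross a b c = cross a b c * join c d"
    "cross a b c * join a d = join c d * cross a b c"
proof -
  let ?x = "cross a b c" and ?s = "swap b d"
  have abc: "points [a, b, c]" and abd: "points [a, b, d]" using assms by auto
  have sj: "?s * join a b = join a d * ?s" "join a b * ?s = ?s * join a d"
    using swap_join[of b d a b] swap_join[of b d a d] assms by simp_all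
  note jx = join_cross[OF abc] and jc = join_commute_overlap[OF abd]
  note dis = join_join_disjoint[OF assms]
  have abs: "join a b * (join a d * ?s) = join a b * join a d"
    using join_join_absorb(1)[OF abd] by (simp only: mult.assoc)
  have abs': "?s * (join a d * join a b) = join a b * join a d"
    using join_join_absorb(2)[OF abd] by (simp only: jc)
  \<comment> \<open>The cross lends a factor \<open>join a b\<close>, and the formula for disjoint
    joins then produces the square of the cross, which is \<open>join a b\<close> again.\<close>
  have "?x * join c d = ?x * (join a b * join c d)"
    by (simp only: mult.assoc[symmetric] jx)
  also have "\<dots> = join a b * (?s * ?x)"
    unfolding dis(1) by (simp only: join_eq[OF abc] mult.assoc)
  also have "\<dots> = join a b * ((?s * join a b) * ?x)" by (simp only: mult.assoc jx)
  also have "\<dots> = join a b * (join a d * ?s) * ?x" by (simp only: mult.assoc sj(1))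
  also have "\<dots> = join a d * (join a b * ?x)" by (simp only: abs) (simp only: jc mult.assoc)
  finally show "join a d * ?x = ?x * join c d" by (simp only: jx)
  have "join c d * ?x = join c d * join a b * ?x" by (simp only: mult.assoc jx)
  also have "\<dots> = ?x * ?s * join a b"
    unfolding dis(2) by (simp only: join_eq[OF abc] mult.assoc)
  also have "\<dots> = ?x * (join a b * ?s) * join a b" by (simp only: mult.assoc[symmetric] jx)
  also have "\<dots> = ?x * (?s * (join a d * join a b))" by (simp only: mult.assoc sj(2))
  also have "\<dots> = ?x * join a b * join a d" by (simp only: abs' mult.assoc)
  finally show "?x * join a d = join c d * ?x" by (simp only: jx)
qed


text \<open>
  For \<open>p \<noteq> q\<close>, this maps the block \<open>{p, j}\<close> to \<open>{p}\<close> and \<open>{q}\<close> to \<open>{q, j}\<close>.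
\<close>

definition move :: "nat \<Rightarrow> nat \<Rightarrow> nat \<Rightarrow> 'm" where
  "move p j q = (if p = q then join p j else cross p j q * swap p q)"

lemma move_same [simp]: "move p j p = join p j"
  by (simp add: move_def)

lemma move_eq: "p \<noteq> q \<Longrightarrow> move p j q = cross p j q * swap p q"
  by (simp add: move_def)

section \<open>Composition of moves and their interplay with joins\<close>

lemma perm_elem_move:
  assumes "Sym r" "points [p, j]" "points [q, j]"
  shows "perm_elem r * move p j q = move (r p) (r j) (r q) * perm_elem r"
proof (cases "p = q")
  case True
  then show ?thesis using perm_elem_join assms by simp
next
  case False
  then have ne: "r p \<noteq> r q" using permutes_inj[OF assms(1)] by (metis injD)
  have c: "perm_elem r * cross p j q = cross (r p) (r j) (r q) * perm_elem r"
    using perm_elem_cross[OF assms(1), of p j q] False assms by simp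
  have s: "perm_elem r * swap p q = swap (r p) (r q) * perm_elem r"
    using perm_elem_swap[OF assms(1)] assms by simp
  show ?thesis
    unfolding move_eq[OF False] move_eq[OF ne]
    by (simp only: mult.assoc[symmetric] c) (simp only: mult.assoc s)
qed

lemma swap_move:
  assumes "points [a, b]" "points [p, j]" "points [q, j]"
  shows "swap a b * move p j q =
    move (transpose a b p) (transpose a b j) (transpose a b q) * swap a b"
  using perm_elem_move[OF Sym_transpose, of a b p j q] assms by (simp add: swap_def)

text \<open>Two cases carry content: the return to \<open>p\<close>, where \<open>join\<close>
  appears as the square of a cross, and three distinct labels, where the exchange rule for crosses
  applies.\<close>

lemma move_move:
  assumes "points [p, j]" "points [q, j]" "points [r, j]"
  shows "move p j q * move q j r = move p j r"
proof -
  have pq: "move p j q * move q j r = cross p j q * cross p j r * (swap p q * swap q r)" if "p \<noteq> q" "q \<noteq> r" "p \<noteq> r"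
  proof -
    have "swap p q * cross q j r = cross p j r * swap p q"
      using swap_cross[of p q q j r] assms that by simp
    then have "cross p j q * (swap p q * cross q j r) * swap q r = cross p j q * (cross p j r * swap p q) * swap q r"
      by (simp only:)
    then show ?thesis by (simp only: move_eq that mult.assoc not_False_eq_True)
  qed
  consider "p = q" "q = r" | "p = q" "q \<noteq> r" | "p \<noteq> q" "q = r" | "p \<noteq> q" "q \<noteq> r" "p = r" | "p \<noteq> q" "q \<noteq> r" "p \<noteq> r"
    by blast
  then show ?thesis
  proof cases
    case 1
    then show ?thesis using join_join_same assms by simp
  next
    case 2
    then show ?thesis using join_cross(1)[of p j r] assms by (simp add: move_eq mult.assoc[symmetric])
  next
    case 3
    then have "swap p q * join q j = join p j * swap p q" "cross p j q * join p j = cross p j q"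
      using swap_join[of p q q j] join_cross(2)[of p j q] assms by simp_all
    then show ?thesis using 3 by (simp add: move_eq mult.assoc) (simp add: mult.assoc[symmetric])
  next
    case 4
    have sw: "swap p q * cross q j p = cross p j q * swap p q" and j: "join p j = cross p j q * cross p j q"
      and sqp: "swap q p = swap p q" and ss: "swap p q * swap p q = 1"
      using swap_cross[of p q q j p] join_eq[of p j q] 4 assms swap_commute by simp_all
    have "move p j q = cross p j q * swap p q" "move q j p = cross q j p * swap p q"
      using 4 sqp by (simp_all add: move_eq)
    then have "move p j q * move q j p = cross p j q * (swap p q * cross q j p) * swap p q"
      by (simp only: mult.assoc)
    also have "\<dots> = join p j" unfolding sw j by (simp only: mult.assoc ss mult_1_right)
    finally show ?thesis using 4 by simp
  next
    case 5
    have c: "swap q r * swap p q = swap p r * swap q r" and ss: "swap q r * swap q r = 1"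
      using swap_swap_conj[of q r p q] 5 assms by simp_all
    have "swap q r * (swap p q * swap q r) = swap q r * swap p q * swap q r"
      by (simp only: mult.assoc)
    also have "\<dots> = swap p r"
      unfolding c by (simp only: mult.assoc ss mult_1_right)
    finally have "swap q r * (swap p q * swap q r) = swap p r" .
    then have "cross p j q * cross p j r * (swap p q * swap q r) = cross p j r * swap p r"
      using cross_swap_commute[of p j q r] 5 assms by (simp add: mult.assoc)
    then show ?thesis using pq 5 by (simp add: move_eq)
  qed
qed

lemma join_move: "points [p, j] \<Longrightarrow> points [q, j] \<Longrightarrow> join p j * move p j q = move p j q"
  using move_move[of p j p q] by simp

lemma move_join: "points [p, j] \<Longrightarrow> points [q, j] \<Longrightarrow> move p j q * join q j = move p j q"
  using move_move[of p j q q] by simp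

lemma join_cross_three:
  assumes "points [a, b, c]"
  shows "join a c * cross a b c = join a b * join a c" "cross a b c * join a c = join a b * join a c"
proof -
  have "join a c * cross a b c = join a c * (join a b * cross a b c)"
    by (simp only: join_cross[OF assms])
  also have "\<dots> = join a b * join a c * cross a b c"
    by (simp only: mult.assoc[symmetric] join_commute_overlap[OF assms])
  finally show "join a c * cross a b c = join a b * join a c"
    by (simp only: join_join_absorb(5)[OF assms])
  have "cross a b c * join a c = cross a b c * join a b * join a c"
    by (simp only: join_cross[OF assms])
  then show "cross a b c * join a c = join a b * join a c"
    by (simp only: mult.assoc join_join_absorb(6)[OF assms])
qed

text \<open>When \<open>p\<close> and \<open>q\<close> are merged, before or after, a move of
  \<open>j\<close> between them only records that \<open>j\<close> lies in their common
  block.\<close>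

lemma join_move_three:
  assumes "points [p, j, q]"
  shows "join p q * move p j q = join p q * join p j" "move p j q * join p q = join p q * join p j"
proof -
  have pqj: "points [p, q, j]" and pq: "p \<noteq> q" "points [p, q]" using assms by auto
  note c = join_commute_overlap[OF assms]
  have "join p q * move p j q = join p q * join p j * swap p q"
    by (simp only: move_eq[OF pq(1)] mult.assoc[symmetric] join_cross_three(1)[OF assms] c)
  then show "join p q * move p j q = join p q * join p j"
    by (simp only: join_join_absorb(3)[OF pqj])
  have "move p j q * join p q = cross p j q * join p q"
    by (simp only: move_eq[OF pq(1)] mult.assoc join_swap[OF pq(2)])
  then show "move p j q * join p q = join p q * join p j"
    by (simp only: join_cross_three(2)[OF assms] c)
qed

text \<open>For \<open>w = q\<close> both sides collapse to a merge of three points. Otherwise the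
  join passes through the cross to the other endpoint, and the swap in the move brings it
  back.\<close>

lemma join_move_commute_endpoint:
  assumes "points [w, j]" "points [p, j]" "points [q, j]" "p \<noteq> q" "w \<noteq> p"
  shows "join p w * move p j q = move p j q * join p w" "join p w * move q j p = move q j p * join p w"
proof -
  have *: "join p w * move p j q = move p j q * join p w \<and> join p w * move q j p = move q j p * join p w"
  proof (cases "w = q")
    case True
    have pts: "points [p, j, q]" "points [q, j, p]" "points [q, p]" "points [p, j]" "points [q, j]" "points [p, q, j]"
      using assms by auto
    then show ?thesis
      using True join_move_three[OF pts(1)] join_move_three[OF pts(2)] join_sym[OF pts(3)] by simp
  next
    case False
    have pts: "points [p, j, q, w]" "points [q, j, p, w]" "points [p, q]" "points [p, w]" "points [q, w]" using assms False by auto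
    have s: "swap p q * join p w = join q w * swap p q" "swap p q * join q w = join p w * swap p q"
      using swap_join[of p q p w] swap_join[of p q q w] pts(3-5) False assms by simp_all
    have "join p w * move p j q = cross p j q * (join q w * swap p q)"
      by (simp only: move_eq[OF assms(4)] mult.assoc[symmetric] join_cross_exchange(1)[OF pts(1)])
    also have "\<dots> = move p j q * join p w"
      by (simp only: move_eq[OF assms(4)] s[symmetric] mult.assoc)
    finally have 1: "join p w * move p j q = move p j q * join p w" .
    have "join p w * move q j p = cross q j p * (join q w * swap q p)"
      by (simp only: move_eq[OF assms(4)[symmetric]] mult.assoc[symmetric] join_cross_exchange(2)[OF pts(2), symmetric])
    also have "\<dots> = move q j p * join p w"
      unfolding move_eq[OF assms(4)[symmetric]] swap_commute[of q p] s(1)[symmetric] by (simp only: mult.assoc)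
    finally show ?thesis using 1 by blast
  qed
  then show "join p w * move p j q = move p j q * join p w" "join p w * move q j p = move q j p * join p w"
    by blast+
qed

lemma join_move_commute:
  assumes "points [u, v]" "points [u, j]" "points [v, j]" "points [p, j]" "points [q, j]"
  shows "join u v * move p j q = move p j q * join u v"
proof -
  consider "p = q" | "p \<noteq> q" "u = p \<or> u = q \<or> v = p \<or> v = q" | "p \<noteq> q" "u \<noteq> p" "u \<noteq> q"
    by blast
  then show ?thesis
  proof cases
    case 1
    then show ?thesis using join_commute[of u v p j] assms by simp
  next
    case 2
    then show ?thesis
      using join_move_commute_endpoint[of v j p q] join_move_commute_endpoint[of v j q p]
        join_move_commute_endpoint[of u j p q] join_move_commute_endpoint[of u j q p]
        join_sym[of u v] assms by auto
  next
    case 3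
    \<comment> \<open>\<open>u\<close> differs from both labels, so the move is factored through
      \<open>u\<close>; each factor then has \<open>u\<close> as an endpoint.\<close>
    then have "join u v * move p j u = move p j u * join u v" "join u v * move u j q = move u j q * join u v"
      using join_move_commute_endpoint[of v j u p] join_move_commute_endpoint[of v j u q] assms by simp_all
    then show ?thesis
      using commute_mult move_move[of p j u q] assms by metis
  qed
qed

text \<open>After the merge, \<open>u\<close> and \<open>v\<close> name the same block. In the
  generic case the join absorbs \<open>swap u v\<close>, which renames the source.\<close>

lemma join_move_source:
  assumes "points [u, v]" "points [u, j]" "points [v, j]" "points [q, j]"
  shows "join u v * move v j q = join u v * move u j q"
proof -
  have pts: "points [u, j, v]" "points [v, j, u]" "points [v, u]" "points [u, v, j]" "points [v, u, j]"
    using assms by auto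
  note r = join_join_rotate[OF pts(4)] join_sym[OF assms(1)]
  consider "q = v" | "q = u" | "q \<noteq> u" "q \<noteq> v" by blast
  then show ?thesis
  proof cases
    case 1
    then show ?thesis using join_move_three(1)[OF pts(1)] r by simp
  next
    case 2
    then show ?thesis using join_move_three(1)[OF pts(2)] r by simp
  next
    case 3
    then have s: "swap u v * move v j q = move u j q * swap u v"
      using swap_move[of u v v j q] assms by simp
    have "join u v * move v j q = join u v * (swap u v * move v j q)"
      by (simp only: mult.assoc[symmetric] join_swap[OF assms(1)])
    also have "\<dots> = move u j q * join u v * swap u v"
      by (simp only: s mult.assoc[symmetric] join_move_commute[OF assms(1,2,3,2,4)])
    also have "\<dots> = join u v * move u j q"
      by (simp only: mult.assoc join_swap[OF assms(1)] join_move_commute[OF assms(1,2,3,2,4)])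
    finally show ?thesis .
  qed
qed

lemma join_move_target:
  assumes "points [u, v]" "points [u, j]" "points [v, j]" "points [p, j]"
  shows "join u v * move p j v = join u v * move p j u"
proof -
  have pts: "points [u, j, v]" "points [v, j, u]" "points [v, u]" "points [u, v, j]" "points [v, u, j]"
    using assms by auto
  note r = join_join_rotate[OF pts(4)] join_sym[OF assms(1)]
  consider "p = v" | "p = u" | "p \<noteq> u" "p \<noteq> v" by blast
  then show ?thesis
  proof cases
    case 1
    then show ?thesis using join_move_three(1)[OF pts(2)] r by simp
  next
    case 2
    then show ?thesis using join_move_three(1)[OF pts(1)] r by simp
  next
    case 3
    then have s: "swap u v * move p j v = move p j u * swap u v"
      using swap_move[of u v p j v] assms by simp
    have "join u v * move p j v = join u v * (swap u v * move p j v)"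
      by (simp only: mult.assoc[symmetric] join_swap[OF assms(1)])
    also have "\<dots> = move p j u * join u v * swap u v"
      by (simp only: s mult.assoc[symmetric] join_move_commute[OF assms(1,2,3,4,2)])
    also have "\<dots> = join u v * move p j u"
      by (simp only: mult.assoc join_swap[OF assms(1)] join_move_commute[OF assms(1,2,3,4,2)])
    finally show ?thesis .
  qed
qed

subsection \<open>Moves of distinct points commute\<close>

text \<open>Exchanging \<open>j\<close> and \<open>k\<close> moves both in opposite directions. This
  links permutations of non-representatives to moves.\<close>

lemma join_join_swap:
  assumes "points [a, j, b, k]"
  shows "join a j * join b k * swap j k = move a j b * move b k a"
proof -
  have ab: "a \<noteq> b" "b \<noteq> a" using assms by auto
  have s: "swap a b * cross b k a = cross a k b * swap a b" "swap a b * swap b a = 1"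
    "swap j k * cross a j b = cross a k b * swap j k"
    using swap_cross[of a b b k a] swap_cross[of j k a j b] swap_commute[of b a] assms by simp_all
  have "move a j b * move b k a = cross a j b * (swap a b * cross b k a) * swap b a"
    by (simp only: move_eq[OF ab(1)] move_eq[OF ab(2)] mult.assoc)
  also have "\<dots> = cross a j b * cross a k b"
    by (simp only: s mult.assoc mult_1_right)
  also have "\<dots> = cross a j b * (swap j k * cross a j b) * swap j k"
    unfolding s(3) using assms by (simp add: mult.assoc)
  also have "\<dots> = join a j * join b k * swap j k"
    by (simp only: join_join_disjoint[OF assms] mult.assoc)
  finally show ?thesis by simp
qed

text \<open>By the previous lemma both orders equal \<open>join a j * join b k * swap j k\<close>,
  in which the two pairs enter symmetrically.\<close>

lemma move_commute_opposite:
  assumes "points [a, j, b, k]"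
  shows "move a j b * move b k a = move b k a * move a j b"
proof -
  have pts: "points [b, k, a, j]" using assms by auto
  show ?thesis
    by (simp only: join_join_swap[OF assms, symmetric] join_join_swap[OF pts, symmetric]
        swap_commute[of k j] join_join_disjoint[OF assms])
qed

text \<open>\<open>j\<close> and \<open>k\<close> share the block of \<open>a\<close> before the
  moves and that of \<open>b\<close> afterwards; joins expressing this can be inserted on either
  side, and they absorb the swap.\<close>

lemma move_parallel_absorb:
  assumes "points [a, j, b, k]"
  shows "swap j k * (move a j b * move a k b) = move a j b * move a k b"
    "move a j b * move a k b * swap j k = move a j b * move a k b"
proof -
  have c: "join a k * move a j b = move a j b * join a k" "join b j * move a k b = move a k b * join b j"
    using join_move_commute[of a k j a b] join_move_commute[of b j k a b] assms by simp_all
  have e: "join a j * move a j b = move a j b" "join a k * move a k b = move a k b"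
    "move a j b * join b j = move a j b" "move a k b * join b k = move a k b"
    using join_move[of a j b] join_move[of a k b] move_join[of a j b] move_join[of a k b] assms by simp_all
  have abs: "swap j k * (join a j * join a k) = join a j * join a k" "join b j * join b k * swap j k = join b j * join b k"
    using join_join_absorb(2)[of a j k] join_join_absorb(1)[of b j k] assms by simp_all
  have l: "move a j b * move a k b = join a j * join a k * (move a j b * move a k b)"
  proof -
    have "join a j * join a k * (move a j b * move a k b) = join a j * (join a k * move a j b) * move a k b"
      by (simp only: mult.assoc)
    also have "\<dots> = (join a j * move a j b) * (join a k * move a k b)"
      by (simp only: c mult.assoc)
    finally show ?thesis by (simp only: e)
  qed
  have r: "move a j b * move a k b = move a j b * move a k b * (join b j * join b k)"
  proof -
    have "move a j b * move a k b * (join b j * join b k) = move a j b * (move a k b * join b j) * join b k"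
      by (simp only: mult.assoc)
    also have "\<dots> = (move a j b * join b j) * (move a k b * join b k)"
      by (simp only: c[symmetric] mult.assoc)
    finally show ?thesis by (simp only: e)
  qed
  have "swap j k * (move a j b * move a k b) = swap j k * (join a j * join a k) * (move a j b * move a k b)"
    by (subst l) (simp only: mult.assoc)
  then show "swap j k * (move a j b * move a k b) = move a j b * move a k b"
    by (simp only: abs l[symmetric])
  have "move a j b * move a k b * swap j k = move a j b * move a k b * (join b j * join b k * swap j k)"
    by (subst r) (simp only: mult.assoc)
  then show "move a j b * move a k b * swap j k = move a j b * move a k b"
    by (simp only: abs r[symmetric])
qed

text \<open>Conjugation by \<open>swap j k\<close> reverses the order of the factors, and both
  orders absorb this swap.\<close>

lemma move_commute_parallel:
  assumes "points [a, j, b, k]"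
  shows "move a j b * move a k b = move a k b * move a j b"
proof -
  have pts: "points [a, k, b, j]" using assms by auto
  have "swap j k * (move a j b * move a k b) = move a k b * move a j b * swap j k"
    using swap_move[of j k a j b] swap_move[of j k a k b] assms
    by (simp add: mult.assoc[symmetric]) (simp add: mult.assoc)
  then show ?thesis
    using move_parallel_absorb[OF assms] move_parallel_absorb[OF pts] swap_commute[of j k] by simp
qed

text \<open>The word for \<open>y_4\<close> equals \<open>(s_3 x s_3) (q x q^-1) (q s_3)\<close>:
  two conjugates of \<open>x\<close> followed by the permutation that exchanges 1 with 4 and 2 with
  3.\<close>

lemma y4_perm:
  assumes "5 \<le> n"
  defines "q \<equiv> adjacent_perm [3, 2, 1, 3, 2]"
  shows "Sym q" "q 1 = 4" "q 2 = 3" "q 3 = 1" "perm_elem q = s 3 * s 2 * s 1 * s 3 * s 2"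
    "perm_elem q * s 3 = swap 1 4 * swap 2 3"
proof -
  show "Sym q" unfolding q_def by (rule adjacent_perm_permutes) (use assms in auto)
  show "q 1 = 4" "q 2 = 3" "q 3 = 1" by (simp_all add: q_def transpose_def)
  show pq: "perm_elem q = s 3 * s 2 * s 1 * s 3 * s 2"
    using perm_elem_adjacent_perm[of "[3, 2, 1, 3, 2]"] assms by (simp add: q_def mult.assoc)
  have "transpose 3 4 \<circ> transpose 2 3 \<circ> transpose 1 2 \<circ> transpose 3 4 \<circ> transpose 2 3 \<circ> transpose 3 4 =
    transpose 1 4 \<circ> transpose 2 (3::nat)"
  proof
    fix k :: nat
    consider "k = 1" | "k = 2" | "k = 3" | "k = 4" | "k \<notin> {1, 2, 3, 4}" by blast
    then show "(transpose 3 4 \<circ> transpose 2 3 \<circ> transpose 1 2 \<circ> transpose 3 4 \<circ> transpose 2 3 \<circ> transpose 3 4) k =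
      (transpose 1 4 \<circ> transpose 2 3) k"
      by cases (simp_all add: transpose_apply_other) 
  qed
  then have e: "adjacent_perm [3, 2, 1, 3, 2, 3] = transpose 1 4 \<circ> transpose 2 3"
    by (simp add: comp_assoc One_nat_def[symmetric])
  have "perm_elem q * s 3 = perm_elem (adjacent_perm [3, 2, 1, 3, 2, 3])"
    unfolding pq using perm_elem_adjacent_perm[of "[3, 2, 1, 3, 2, 3]"] assms by (simp add: mult.assoc)
  also have "\<dots> = swap 1 4 * swap 2 3"
    unfolding e swap_def by (rule perm_elem_comp; rule Sym_transpose) (use assms in auto)
  finally show "perm_elem q * s 3 = swap 1 4 * swap 2 3" .
qed

text \<open>The instance \<open>i = 4\<close> of the relations for \<open>y\<^sub>i\<close>; no larger instance is needed.\<close>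

lemma y4_relation:
  assumes "5 \<le> n"
  defines "y \<equiv> s 3 * x * s 2 * s 1 * s 3 * s 2 * x * s 3"
  shows "y * s 4 * y = s 4 * y * s 4"
proof -
  have "l_word (Suc 1) = [X, S 2, S 1]" "l_word (Suc 2) = S 3 # l_word 2 @ [S 3, S 2]"
    "y_word (Suc 2) = [X]" "y_word (Suc 3) = l_word 3 @ y_word 3 @ [S 3]"
    by (simp_all del: Suc_1 Suc_numeral add: One_nat_def)
  then have y4: "y_word 4 = [S 3, X, S 2, S 1, S 3, S 2, X, S 3]"
    by simp
  have "(y_word 4 @ [S 4] @ y_word 4, [S 4] @ y_word 4 @ [S 4]) \<in> relations n"
    by (rule y_braid) (use assms in auto)
  from relation[OF this] show ?thesis
    by (simp add: y4 y_def mult.assoc)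
qed

text \<open>In a frame \<open>y_4\<close> becomes two parallel moves followed by
  \<open>swap a b\<close>, and \<open>s_4\<close> becomes \<open>swap b c\<close>; removing the
  permutations from the relation leaves an equation between moves.\<close>

lemma move_triangle_parallel:
  assumes "points [a, j, k, b, c]"
  shows "move a j b * move a k b * (move b j c * move b k c) = move a j c * move a k c"
proof -
  obtain p where p: "Sym p" "p 1 = a" "p 2 = j" "p 3 = k" "p 4 = b" "p 5 = c" using frame5[OF assms] .
  have n: "5 \<le> n" using points_length[OF assms] by simp
  define y where "y = s 3 * x * s 2 * s 1 * s 3 * s 2 * x * s 3"
  define q where "q = adjacent_perm [3, 2, 1, 3, 2]"
  note q = y4_perm[OF n, folded q_def]
  have pq: "Sym (p \<circ> q)" using p(1) q(1) by (simp add: permutes_compose)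
  have t: "Sym (transpose 3 4)" by (rule Sym_transpose) (use n in auto)
  then have pt: "Sym (p \<circ> transpose 3 4)" using p(1) by (simp add: permutes_compose)
  have g3: "perm_elem (transpose 3 4) = s 3" using s_eq_swap[of 3] n by (simp add: swap_def)
  have c1: "cross a j b * (perm_elem p * s 3) = perm_elem p * s 3 * x"
    using cross_perm_elem[OF pt, of a j b] p by (simp add: perm_elem_comp[OF p(1) t] g3)
  have c2: "cross b k a * (perm_elem p * perm_elem q) = perm_elem p * perm_elem q * x"
    using cross_perm_elem[OF pq, of b k a] p q by (simp add: perm_elem_comp[OF p(1) q(1)])
  have sw: "perm_elem p * (swap 1 4 * swap 2 3) = swap a b * swap j k * perm_elem p"
    using perm_elem_swap[OF p(1), of 1 4] perm_elem_swap[OF p(1), of 2 3] p n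
    by (simp add: mult.assoc[symmetric]) (simp add: mult.assoc)
  \<comment> \<open>\<open>Y b\<close> is \<open>y\<close> seen in the frame. The parameter lets
    conjugation by \<open>swap b c\<close> turn \<open>Y b\<close> into \<open>Y c\<close>.\<close>
  define Y where "Y b = move a j b * move a k b * swap a b" for b
  have ab: "a \<noteq> b" "a \<noteq> c" and ajbk: "points [a, j, b, k]" "points [a, j, c, k]" using assms by auto
  have Yab: "cross a j b * cross b k a * (swap a b * swap j k) = Y b"
  proof -
    have sk: "swap a b * cross a k b = cross b k a * swap a b"
      using swap_cross[of a b a k b] assms by simp
    have jk: "swap a b * swap j k = swap j k * swap a b"
      using swap_swap_conj[of a b j k] assms by auto
    have aa: "swap a b * swap a b = 1" using assms by simp
    have "move a j b * move a k b = cross a j b * (swap a b * cross a k b) * swap a b"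
      by (simp only: move_eq[OF ab(1)] mult.assoc)
    also have "\<dots> = cross a j b * cross b k a"
      by (simp only: sk mult.assoc aa mult_1_right)
    finally have m: "move a j b * move a k b = cross a j b * cross b k a" .
    show ?thesis
      unfolding Y_def m[symmetric] jk
      by (simp only: mult.assoc[symmetric]) (simp only: move_parallel_absorb(2)[OF ajbk(1)])
  qed
  have Yp: "Y b * perm_elem p = perm_elem p * y"
  proof -
    have "perm_elem p * y = (perm_elem p * s 3 * x) * (s 2 * s 1 * s 3 * s 2 * x * s 3)"
      by (simp only: y_def mult.assoc)
    also have "\<dots> = cross a j b * (perm_elem p * perm_elem q * x) * s 3"
      unfolding c1[symmetric] q(5) by (simp only: mult.assoc)
    also have "\<dots> = cross a j b * cross b k a * (perm_elem p * (perm_elem q * s 3))"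
      unfolding c2[symmetric] by (simp only: mult.assoc)
    also have "\<dots> = Y b * perm_elem p"
      unfolding q(6) sw Yab[symmetric] by (simp only: mult.assoc)
    finally show ?thesis by simp
  qed
  have s4: "swap b c * perm_elem p = perm_elem p * s 4"
    using swap_perm_elem[OF p(1), of 4] p n by simp
  have "Y b * swap b c * Y b = swap b c * Y b * swap b c"
    by (rule perm_elem_cancel_right[OF p(1)])
      (simp only: mult.assoc Yp s4 Yp[THEN mult_lift] s4[THEN mult_lift] y4_relation[OF n, folded y_def, unfolded mult.assoc])
  moreover have "swap b c * Y b = Y c * swap b c"
  proof -
    have e: "swap b c * move a j b = move a j c * swap b c" "swap b c * move a k b = move a k c * swap b c"
      "swap b c * swap a b = swap a c * swap b c"
      using swap_move[of b c a j b] swap_move[of b c a k b] swap_swap_conj[of b c a b] assms by auto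
    show ?thesis
      unfolding Y_def by (simp only: mult.assoc e e[THEN mult_lift, unfolded mult.assoc])
  qed
  ultimately have "Y b * Y c * swap b c = Y c * (swap b c * swap b c)"
    by (simp only: mult.assoc)
  then have "Y b * Y c * swap b c * swap b c = Y c * (swap b c * swap b c) * swap b c" by simp
  then have Y: "Y b * Y c = Y c * swap b c" using assms by (simp add: mult.assoc)
  have e: "swap a b * move a j c = move b j c * swap a b" "swap a b * move a k c = move b k c * swap a b"
    using swap_move[of a b a j c] swap_move[of a b a k c] assms by auto
  \<comment> \<open>Collecting the swaps on the right exposes the four moves; the other side of the
    relation ends in the same permutation, which cancels.\<close>
  have YY: "Y b * Y c = move a j b * move a k b * (move b j c * move b k c) * (swap a b * swap a c)"
    unfolding Y_def by (simp only: mult.assoc e e[THEN mult_lift, unfolded mult.assoc])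
  have "swap a c * swap b c = swap a b * swap a c"
    using swap_swap_conj[of a c b c] swap_commute[of a b] assms by auto
  then have YS: "Y c * swap b c = move a j c * move a k c * (swap a b * swap a c)"
    by (simp only: Y_def mult.assoc)
  have inv: "swap a b * swap a c * (swap a c * swap a b) = 1" using assms by (simp add: mult.assoc)
  have "move a j b * move a k b * (move b j c * move b k c) * (swap a b * swap a c) * (swap a c * swap a b) =
    move a j c * move a k c * (swap a b * swap a c) * (swap a c * swap a b)"
    by (simp only: YY[symmetric] YS[symmetric] Y)
  then show ?thesis by (simp only: mult.assoc[of _ "swap a b * swap a c"] inv mult_1_right)
qed


text \<open>Composing the right-hand side of the triangle equation from moves via \<open>b\<close>
  shows the two sides to differ only in the order of the middle factors. The outer factors are
  cancelled by reverse moves, and the joins left over are absorbed.\<close>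

lemma move_commute_consecutive:
  assumes "points [a, j, k, b, c]"
  shows "move a k b * move b j c = move b j c * move a k b"
proof -
  let ?J = "\<lambda>p q. move p j q" and ?K = "\<lambda>p q. move p k q"
  have tj: "?J a b * ?J b c = ?J a c" "?J b a * ?J a b = join b j"
    using move_move[of a j b c] move_move[of b j a b] assms by auto
  have tk: "?K a b * ?K b c = ?K a c" "?K b c * ?K c b = join b k"
    using move_move[of a k b c] move_move[of b k c b] assms by auto
  have cj: "join b j * ?K a b = ?K a b * join b j" "join b k * ?J b c = ?J b c * join b k"
    using join_move_commute[of b j k a b] join_move_commute[of b k j b c] assms by auto
  have e: "join b j * ?J b c = ?J b c" "?K a b * join b k = ?K a b"
    using join_move[of b j c] move_join[of a k b] assms by auto
  have h: "?J a b * ?K a b * (?J b c * ?K b c) = ?J a b * ?J b c * (?K a b * ?K b c)"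
    unfolding tj tk by (rule move_triangle_parallel[OF assms])
  have jj: "join b k * join b j = join b j * join b k"
    using join_commute[of b k b j] assms by auto
  have "?K a b * ?J b c = (?K a b * join b k) * (join b j * ?J b c)" by (simp only: e)
  also have "\<dots> = ?K a b * (join b k * join b j) * ?J b c" by (simp only: mult.assoc)
  also have "\<dots> = (?K a b * join b j) * (join b k * ?J b c)"
    unfolding jj by (simp only: mult.assoc)
  also have "\<dots> = join b j * (?K a b * ?J b c) * join b k"
    unfolding cj(2) cj(1)[symmetric] by (simp only: mult.assoc)
  also have "\<dots> = ?J b a * (?J a b * ?K a b * (?J b c * ?K b c)) * ?K c b"
    by (simp only: tj(2)[symmetric] tk(2)[symmetric] mult.assoc)
  also have "\<dots> = join b j * ?J b c * (?K a b * join b k)"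
    unfolding h by (simp only: tj(2)[symmetric] tk(2)[symmetric] mult.assoc)
  finally show ?thesis by (simp only: e)
qed

text \<open>The labels may coincide in many ways; factoring the move of \<open>k\<close> through
  intermediate labels leaves only parallel, opposite and consecutive moves, besides joins.\<close>

lemma move_commute:
  assumes "j \<noteq> k" "{p, q, u, v} \<inter> {j, k} = {}" "{j, k, p, q, u, v} \<subseteq> {1..n}"
  shows "move p j q * move u k v = move u k v * move p j q"
proof -
  let ?A = "{p, q, u, v}"
  have pts: "points [a, j]" "points [a, k]" if "a \<in> ?A" for a
    using that assms by auto
  have consecutive: "move b j c * move a k b = move a k b * move b j c" "move a j b * move b k c = move b k c * move a j b"
    if "a \<noteq> b" "a \<noteq> c" "b \<noteq> c" "a \<in> ?A" "b \<in> ?A" "c \<in> ?A" for a b c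
  proof -
    have "points [a, j, k, b, c] \<and> points [a, k, j, b, c]"
      using that(1-3) pts[OF that(4)] pts[OF that(5)] pts[OF that(6)] assms(1) by auto
    then show "move b j c * move a k b = move a k b * move b j c" "move a j b * move b k c = move b k c * move a j b"
      using move_commute_consecutive[of a j k b c] move_commute_consecutive[of a k j b c] by metis+
  qed
  have four: "points [a, j, b, k]" if "a \<noteq> b" "a \<in> ?A" "b \<in> ?A" for a b
    using that(1) pts[OF that(2)] pts[OF that(3)] assms(1) by auto
  \<comment> \<open>Commuting with \<open>move c k w\<close> and \<open>move w k d\<close> implies
    commuting with their product \<open>move c k d\<close>.\<close>
  have via: "move a j b * move c k d = move c k d * move a j b"
    if "c \<in> ?A" "w \<in> ?A" "d \<in> ?A" "move a j b * move c k w = move c k w * move a j b"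
      "move a j b * move w k d = move w k d * move a j b" for a b c d w
    using commute_mult[OF that(4,5)] move_move[OF pts(2)[OF that(1)] pts(2)[OF that(2)] pts(2)[OF that(3)]] by simp
  show ?thesis
  proof (cases "p = q \<or> u = v")
    case True
    then show ?thesis
    proof
      assume "p = q"
      then show ?thesis
        using join_move_commute[of p j k u v] pts[of p] pts[of u] pts[of v] assms(1) by simp
    next
      assume "u = v"
      then show ?thesis
        using join_move_commute[of u k j p q] pts[of u] pts[of p] pts[of q] assms(1) by simp
    qed
  next
    case False
    then have ne: "p \<noteq> q" "u \<noteq> v" by auto
    have from_p: "move p j q * move p k w = move p k w * move p j q" if "p \<noteq> w" "w \<in> ?A" for w
    proof (cases "w = q")
      case True
      then show ?thesis using move_commute_parallel[OF four] ne by simp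
    next
      case False
      show ?thesis
      proof (rule via[of _ q])
        show "move p j q * move p k q = move p k q * move p j q"
          by (rule move_commute_parallel[OF four]) (use ne in auto)
        show "move p j q * move q k w = move q k w * move p j q"
          by (rule consecutive) (use False ne that in auto)
      qed (use that in auto)
    qed
    have into_p: "move p j q * move u k p = move u k p * move p j q" if "u \<noteq> p"
    proof (cases "u = q")
      case True
      then show ?thesis using move_commute_opposite[OF four] ne by simp
    next
      case False
      show ?thesis by (rule consecutive) (use False that ne in auto)
    qed
    consider "u = p" | "u \<noteq> p" "v = p" | "u \<noteq> p" "v \<noteq> p" by blast
    then show ?thesis
    proof cases
      case 1
      then show ?thesis using from_p[of v] ne by simp
    next
      case 2
      then show ?thesis using into_p by simp
    next
      case 3
      then show ?thesis using via[of u p v p q] into_p from_p[of v] by simp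
    qed
  qed
qed

end

section \<open>Ordered products of commuting elements\<close>

text \<open>The monoid is not commutative, so a fixed order of the factors is needed to make the
  product a function of the set; commutation enters as a hypothesis where it matters.\<close>

definition ordered_prod :: "(nat \<Rightarrow> 'm::monoid_mult) \<Rightarrow> nat set \<Rightarrow> 'm" where
  "ordered_prod F J = prod_list (map F (sorted_list_of_set J))"

lemma ordered_prod_empty [simp]: "ordered_prod F {} = 1"
  by (simp add: ordered_prod_def)

lemma ordered_prod_insert:
  assumes "finite J" "j \<notin> J" "\<And>k. k \<in> J \<Longrightarrow> F j * F k = F k * F j"
  shows "ordered_prod F (insert j J) = F j * ordered_prod F J"
proof -
  have "prod_list (map F (insort j xs)) = F j * prod_list (map F xs)"
    if "\<And>k. k \<in> set xs \<Longrightarrow> F j * F k = F k * F j" for xs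
    using that
  proof (induction xs)
    case (Cons k xs)
    have "F j * F k = F k * F j" using Cons.prems by simp
    then have "F k * (F j * y) = F j * (F k * y)" for y
      by (simp only: mult.assoc[symmetric])
    with Cons show ?case by simp
  qed simp
  from this[of "sorted_list_of_set J"] show ?thesis using assms by (simp add: ordered_prod_def)
qed

lemma ordered_prod_remove:
  assumes "finite J" "j \<in> J" "\<And>k. k \<in> J \<Longrightarrow> k \<noteq> j \<Longrightarrow> F j * F k = F k * F j"
  shows "ordered_prod F J = F j * ordered_prod F (J - {j})"
proof -
  have "insert j (J - {j}) = J" using assms by auto
  then show ?thesis using ordered_prod_insert[of "J - {j}" j F] assms by simp
qed

lemma ordered_prod_cong:
  assumes "finite J" "\<And>j. j \<in> J \<Longrightarrow> F j = G j"
  shows "ordered_prod F J = ordered_prod G J"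
  unfolding ordered_prod_def using assms by (intro arg_cong[of _ _ prod_list] map_cong) auto

lemma ordered_prod_commute:
  assumes "finite J" "\<And>j. j \<in> J \<Longrightarrow> a * F j = F j * a"
  shows "a * ordered_prod F J = ordered_prod F J * a"
proof -
  have "a * prod_list (map F xs) = prod_list (map F xs) * a"
    if "\<And>k. k \<in> set xs \<Longrightarrow> a * F k = F k * a" for xs
    using that
  proof (induction xs)
    case (Cons k xs)
    then have "a * F k = F k * a" "a * prod_list (map F xs) = prod_list (map F xs) * a" by auto
    then have "a * (F k * prod_list (map F xs)) = F k * prod_list (map F xs) * a" by (rule commute_mult)
    then show ?case by simp
  qed simp
  from this[of "sorted_list_of_set J"] show ?thesis using assms by (simp add: ordered_prod_def)
qed

lemma ordered_prod_mult:
  assumes "finite J"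
    "\<And>i j. i \<in> J \<Longrightarrow> j \<in> J \<Longrightarrow> i \<noteq> j \<Longrightarrow> F i * F j = F j * F i"
    "\<And>i j. i \<in> J \<Longrightarrow> j \<in> J \<Longrightarrow> i \<noteq> j \<Longrightarrow> G i * G j = G j * G i"
    "\<And>i j. i \<in> J \<Longrightarrow> j \<in> J \<Longrightarrow> i \<noteq> j \<Longrightarrow> G i * F j = F j * G i"
    "\<And>i j. i \<in> J \<Longrightarrow> j \<in> J \<Longrightarrow> i \<noteq> j \<Longrightarrow> (F i * G i) * (F j * G j) = (F j * G j) * (F i * G i)"
  shows "ordered_prod F J * ordered_prod G J = ordered_prod (\<lambda>j. F j * G j) J"
  using assms
proof (induction J rule: finite_induct)
  case (insert j J)
  have FG: "ordered_prod F J * ordered_prod G J = ordered_prod (\<lambda>j. F j * G j) J"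
    by (rule insert.IH) (use insert.prems in simp_all)
  have c: "G j * ordered_prod F J = ordered_prod F J * G j"
    by (rule ordered_prod_commute[OF insert.hyps(1)], rule insert.prems(3)) (use insert.hyps in auto)
  have ne: "k \<in> J \<Longrightarrow> j \<noteq> k" for k using insert.hyps by auto
  have ins: "ordered_prod F (insert j J) = F j * ordered_prod F J"
    "ordered_prod G (insert j J) = G j * ordered_prod G J"
    "ordered_prod (\<lambda>j. F j * G j) (insert j J) = (F j * G j) * ordered_prod (\<lambda>j. F j * G j) J"
    by (rule ordered_prod_insert[OF insert.hyps(1,2)], rule insert.prems; use ne in blast)+
  have "ordered_prod F (insert j J) * ordered_prod G (insert j J) =
      F j * ordered_prod F J * (G j * ordered_prod G J)"
    by (simp only: ins)
  also have "\<dots> = F j * (G j * ordered_prod F J) * ordered_prod G J"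
    by (simp only: c mult.assoc)
  also have "\<dots> = (F j * G j) * ordered_prod (\<lambda>j. F j * G j) J"
    by (simp only: FG[symmetric] mult.assoc)
  also have "\<dots> = ordered_prod (\<lambda>j. F j * G j) (insert j J)"
    by (simp only: ins)
  finally show ?case .
qed simp

text \<open>\<open>p\<close> need not preserve the order of the points, so the factors over its
  image have to be rearranged. Used for conjugation by a transposition.\<close>

lemma ordered_prod_intertwine:
  assumes "finite J" "inj p" "\<And>j. j \<in> J \<Longrightarrow> a * F j = G (p j) * a"
    "\<And>i j. i \<in> J \<Longrightarrow> j \<in> J \<Longrightarrow> i \<noteq> j \<Longrightarrow> F i * F j = F j * F i"
    "\<And>i j. i \<in> J \<Longrightarrow> j \<in> J \<Longrightarrow> i \<noteq> j \<Longrightarrow> G (p i) * G (p j) = G (p j) * G (p i)"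
  shows "a * ordered_prod F J = ordered_prod G (p ` J) * a"
  using assms(1,3-)
proof (induction J rule: finite_induct)
  case (insert j J)
  have IH: "a * ordered_prod F J = ordered_prod G (p ` J) * a"
    by (rule insert.IH) (use insert.prems in simp_all)
  have aj: "a * F j = G (p j) * a" using insert.prems by simp
  have ne: "k \<in> J \<Longrightarrow> j \<noteq> k" for k using insert.hyps by auto
  have "ordered_prod F (insert j J) = F j * ordered_prod F J"
    by (rule ordered_prod_insert[OF insert.hyps(1,2)], rule insert.prems; use ne in blast)
  then have "a * ordered_prod F (insert j J) = a * F j * ordered_prod F J"
    by (simp only: mult.assoc)
  also have "\<dots> = G (p j) * ordered_prod G (p ` J) * a"
    unfolding aj by (simp only: IH mult.assoc)
  also have "G (p j) * ordered_prod G (p ` J) = ordered_prod G (insert (p j) (p ` J))"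
    by (rule ordered_prod_insert[symmetric])
      (use insert.prems insert.hyps ne inj_image_mem_iff[OF assms(2)] in auto)
  finally show ?case by simp
qed simp

text \<open>In the presence of \<open>a\<close> factors are exchanged one by one, \<open>a\<close>
  passing each new factor. Used when \<open>a\<close> is a join that identifies two labels.\<close>

lemma ordered_prod_absorb:
  assumes "finite J" "\<And>j. j \<in> J \<Longrightarrow> a * F j = a * G j" "\<And>j. j \<in> J \<Longrightarrow> a * G j = G j * a"
    "\<And>i j. i \<in> J \<Longrightarrow> j \<in> J \<Longrightarrow> i \<noteq> j \<Longrightarrow> F i * F j = F j * F i"
    "\<And>i j. i \<in> J \<Longrightarrow> j \<in> J \<Longrightarrow> i \<noteq> j \<Longrightarrow> G i * G j = G j * G i"
  shows "a * ordered_prod F J = a * ordered_prod G J"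
  using assms
proof (induction J rule: finite_induct)
  case (insert j J)
  have IH: "a * ordered_prod F J = a * ordered_prod G J"
    by (rule insert.IH) (use insert.prems in simp_all)
  have aj: "a * F j = G j * a" "G j * a = a * G j" using insert.prems by simp_all
  have ne: "k \<in> J \<Longrightarrow> j \<noteq> k" for k using insert.hyps by auto
  have "ordered_prod F (insert j J) = F j * ordered_prod F J"
    by (rule ordered_prod_insert[OF insert.hyps(1,2)], rule insert.prems; use ne in blast)
  then have "a * ordered_prod F (insert j J) = a * F j * ordered_prod F J"
    by (simp only: mult.assoc)
  also have "\<dots> = G j * (a * ordered_prod G J)"
    unfolding aj(1) by (simp only: IH mult.assoc)
  also have "\<dots> = a * (G j * ordered_prod G J)"
    by (simp only: aj(2) mult.assoc[symmetric])
  also have "G j * ordered_prod G J = ordered_prod G (insert j J)"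
    by (rule ordered_prod_insert[symmetric]) (use insert.prems insert.hyps ne in auto)
  finally show ?case .
qed simp

section \<open>Transfers between retractions\<close>

text \<open>\<open>J\<close> holds the non-representatives and \<open>f\<close> sends each point to
  the representative of its block; retractions with the same \<open>J\<close> have the same
  representatives.\<close>

definition retraction :: "nat \<Rightarrow> nat set \<Rightarrow> (nat \<Rightarrow> nat) \<Rightarrow> bool" where
  "retraction n J f \<longleftrightarrow> J \<subseteq> {1..n} \<and> (\<forall>j\<in>J. f j \<in> {1..n} - J) \<and> (\<forall>j. j \<notin> J \<longrightarrow> f j = j)"

lemma retraction_upd:
  "retraction n J f \<Longrightarrow> b \<in> J \<Longrightarrow> v \<in> {1..n} - J \<Longrightarrow> retraction n J (f(b := v))"
  by (auto simp: retraction_def)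

lemma retraction_merge:
  "retraction n J f \<Longrightarrow> u \<in> {1..n} - J \<Longrightarrow> v \<in> {1..n} - J \<Longrightarrow> u \<noteq> v \<Longrightarrow>
    retraction n (insert v J) (id(v := u) \<circ> f)"
  by (auto simp: retraction_def)

lemma retraction_permute:
  assumes "retraction n J f" "\<pi> permutes J"
  shows "retraction n J (f \<circ> \<pi>)"
  using assms permutes_in_image[OF assms(2)] permutes_not_in[OF assms(2)]
  by (auto simp: retraction_def)

lemma retraction_conj:
  assumes "retraction n J f" "a \<in> {1..n}" "b \<in> {1..n}"
  shows "retraction n (transpose a b ` J) (transpose a b \<circ> f \<circ> transpose a b)"
proof -
  let ?t = "transpose a b"
  have t: "?t permutes {1..n}" using assms by (intro permutes_swap_id)
  have mem: "j \<in> ?t ` J \<longleftrightarrow> ?t j \<in> J" for j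
    by (metis image_iff transpose_involutory)
  have rng: "?t j \<in> {1..n} \<longleftrightarrow> j \<in> {1..n}" for j using permutes_in_image[OF t] .
  show ?thesis
    unfolding retraction_def
  proof (intro conjI ballI allI impI subsetI)
    fix j assume "j \<in> ?t ` J"
    then have j: "?t j \<in> J" by (simp only: mem)
    then show "j \<in> {1..n}" using assms(1) rng by (auto simp: retraction_def)
    have "f (?t j) \<in> {1..n} - J" using assms(1) j by (auto simp: retraction_def)
    then show "(?t \<circ> f \<circ> ?t) j \<in> {1..n} - ?t ` J"
      unfolding comp_apply Diff_iff mem rng transpose_involutory .
  next
    fix j assume "j \<notin> ?t ` J"
    then have "?t j \<notin> J" by (simp only: mem not_False_eq_True)
    then have "f (?t j) = ?t j" using assms(1) by (auto simp: retraction_def)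
    then show "(?t \<circ> f \<circ> ?t) j = j" by simp
  qed
qed

context presented
begin

definition transfer :: "nat set \<Rightarrow> (nat \<Rightarrow> nat) \<Rightarrow> (nat \<Rightarrow> nat) \<Rightarrow> 'm" where
  "transfer J f f' = ordered_prod (\<lambda>j. move (f j) j (f' j)) J"

abbreviation "retr \<equiv> retraction n"

lemma retr_finite: "retr J f \<Longrightarrow> finite J"
  by (auto simp: retraction_def intro: finite_subset)

lemma retr_points: "retr J f \<Longrightarrow> j \<in> J \<Longrightarrow> k \<in> J \<Longrightarrow> points [f j, k]"
  by (auto simp: retraction_def)

text \<open>Labels are representatives, so they lie outside \<open>J\<close> and differ from all
  moved points, as \<open>move_commute\<close> requires.\<close>

lemma move_sites_commute:
  assumes "retr J f" "retr J f'" "retr J h" "retr J h'" "i \<in> J" "k \<in> J" "i \<noteq> k"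
  shows "move (f i) i (f' i) * move (h k) k (h' k) = move (h k) k (h' k) * move (f i) i (f' i)"
  by (rule move_commute) (use assms in \<open>auto simp: retraction_def\<close>)

section \<open>Products of transfers with joins, crosses and permutations\<close>

lemma transfer_remove:
  assumes "retr J f" "retr J f'" "j \<in> J"
  shows "transfer J f f' = move (f j) j (f' j) * transfer (J - {j}) f f'"
    "transfer J f f' = transfer (J - {j}) f f' * move (f j) j (f' j)"
proof -
  have fin: "finite J" using retr_finite assms by blast
  show 1: "transfer J f f' = move (f j) j (f' j) * transfer (J - {j}) f f'"
    unfolding transfer_def
    by (rule ordered_prod_remove[OF fin assms(3)]) (rule move_sites_commute[OF assms(1,2,1,2,3)]; simp)
  have "move (f j) j (f' j) * transfer (J - {j}) f f' = transfer (J - {j}) f f' * move (f j) j (f' j)"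
    unfolding transfer_def
    by (rule ordered_prod_commute) (use fin move_sites_commute[OF assms(1,2,1,2,3)] in auto)
  with 1 show "transfer J f f' = transfer (J - {j}) f f' * move (f j) j (f' j)" by simp
qed

lemma transfer_cong:
  assumes "finite J" "\<And>j. j \<in> J \<Longrightarrow> f j = g j" "\<And>j. j \<in> J \<Longrightarrow> f' j = g' j"
  shows "transfer J f f' = transfer J g g'"
  unfolding transfer_def by (rule ordered_prod_cong) (use assms in auto)

lemma transfer_transfer:
  assumes "retr J f" "retr J f'" "retr J f''"
  shows "transfer J f f' * transfer J f' f'' = transfer J f f''"
proof -
  have mm: "move (f j) j (f' j) * move (f' j) j (f'' j) = move (f j) j (f'' j)" if "j \<in> J" for j
    by (rule move_move; rule retr_points) (use assms that in auto)
  have "transfer J f f' * transfer J f' f'' =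
      ordered_prod (\<lambda>j. move (f j) j (f' j) * move (f' j) j (f'' j)) J"
    unfolding transfer_def
    by (rule ordered_prod_mult) (use assms retr_finite move_sites_commute mm in \<open>simp_all\<close>)
  also have "\<dots> = transfer J f f''"
    unfolding transfer_def by (rule ordered_prod_cong) (use assms retr_finite mm in auto)
  finally show ?thesis .
qed

lemma transfer_join_site:
  assumes "retr J f" "retr J f'" "j \<in> J"
  shows "transfer J f f' * join (f' j) j = transfer J f f'" "join (f j) j * transfer J f f' = transfer J f f'"
proof -
  have pts: "points [f j, j]" "points [f' j, j]" using retr_points assms by blast+
  show "transfer J f f' * join (f' j) j = transfer J f f'"
    unfolding transfer_remove(2)[OF assms] mult.assoc by (simp only: move_join[OF pts])
  show "join (f j) j * transfer J f f' = transfer J f f'"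
    unfolding transfer_remove(1)[OF assms] by (simp only: mult.assoc[symmetric] join_move[OF pts])
qed

text \<open>Points with a common lower label are already merged by the factors at these points; two
  non-representatives are linked through their representative.\<close>

lemma transfer_join:
  assumes "retr J f" "retr J f'" "points [a, b]" "f' a = f' b"
  shows "transfer J f f' * join a b = transfer J f f'"
proof -
  let ?A = "transfer J f f'"
  have site: "?A * join (f' j) j = ?A" if "j \<in> J" for j
    using transfer_join_site assms that by blast
  consider "a \<notin> J" | "a \<in> J" "b \<notin> J" | "a \<in> J" "b \<in> J" by blast
  then show ?thesis
  proof cases
    case 1
    then have "f' a = a" using assms(2) by (simp add: retraction_def)
    moreover have "b \<in> J"
      using calculation assms(2-4) by (auto simp: retraction_def)
    ultimately show ?thesis using site[of b] assms(4) by simp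
  next
    case 2
    then have "f' b = b" using assms(2) by (simp add: retraction_def)
    then show ?thesis using site[of a] 2 assms(3,4) join_sym[of a b] by simp
  next
    case 3
    define u where "u = f' a"
    have u: "points [u, a]" "points [u, b]" "u = f' b"
      using retr_points[OF assms(2)] 3 assms(4) u_def by metis+
    then have pts: "points [a, u, b]" using assms(3) by auto
    have "?A = ?A * join u a * join u b" using site[of a] site[of b] 3 u u_def by simp
    also have "\<dots> = ?A * (join a u * join a b)"
      using join_join_rotate[OF pts] join_sym[of u a] u by (simp add: mult.assoc)
    finally have A: "?A = ?A * (join a u * join a b)" .
    have "?A * join a b = ?A * (join a u * (join a b * join a b))"
      by (subst A) (simp only: mult.assoc)
    then show ?thesis using join_join_same[OF assms(3)] A by simp
  qed
qed

lemma transfer_swap_same: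
  assumes "retr J f" "retr J f'" "points [a, b]" "f' a = f' b"
  shows "transfer J f f' * swap a b = transfer J f f'"
proof -
  have "transfer J f f' * join a b * swap a b = transfer J f f' * join a b"
    by (simp only: mult.assoc join_swap[OF assms(3)])
  then show ?thesis by (simp only: transfer_join[OF assms])
qed

text \<open>\<open>v\<close> becomes a further non-representative with label \<open>u\<close>: under
  \<open>join u v\<close> every label \<open>v\<close> may be renamed to \<open>u\<close>, and the
  join itself becomes the factor at \<open>v\<close>.\<close>

lemma transfer_merge:
  assumes "retr J f" "retr J f'" "u \<in> {1..n} - J" "v \<in> {1..n} - J" "u \<noteq> v"
  shows "transfer J f f' * join u v = transfer (insert v J) (id(v := u) \<circ> f) (id(v := u) \<circ> f')"
proof -
  define q where "q = id(v := u)"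
  have fin: "finite J" using retr_finite assms by blast
  have R: "retr (insert v J) (q \<circ> f)" "retr (insert v J) (q \<circ> f')"
    unfolding q_def using retraction_merge assms by blast+
  have side: "points [u, v]" "points [u, j]" "points [v, j]" "points [f j, j]" "points [f' j, j]"
    "points [q (f j), j]" "points [q (f' j), j]" if "j \<in> J" for j
    using assms that by (auto simp: retraction_def q_def)
  have c: "join u v * move (f j) j (f' j) = move (f j) j (f' j) * join u v" if "j \<in> J" for j
    by (rule join_move_commute) (use side[OF that] in blast)+
  have "transfer J f f' * join u v = join u v * ordered_prod (\<lambda>j. move (f j) j (f' j)) J"
    unfolding transfer_def by (rule ordered_prod_commute[symmetric]) (use c fin in auto)
  also have "\<dots> = join u v * ordered_prod (\<lambda>j. move (q (f j)) j (q (f' j))) J"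
  proof (rule ordered_prod_absorb[OF fin])
    fix j assume j: "j \<in> J"
    have "join u v * move (f j) j (f' j) = join u v * move (q (f j)) j (f' j)"
      using join_move_source[OF side(1,2,3,5)[OF j]] by (cases "f j = v") (auto simp: q_def)
    also have "\<dots> = join u v * move (q (f j)) j (q (f' j))"
      using join_move_target[OF side(1,2,3,6)[OF j]] by (cases "f' j = v") (auto simp: q_def)
    finally show "join u v * move (f j) j (f' j) = join u v * move (q (f j)) j (q (f' j))" .
    show "join u v * move (q (f j)) j (q (f' j)) = move (q (f j)) j (q (f' j)) * join u v"
      by (rule join_move_commute) (use side[OF j] in blast)+
  next
    fix i j assume "i \<in> J" "j \<in> J" "i \<noteq> j"
    then show "move (f i) i (f' i) * move (f j) j (f' j) = move (f j) j (f' j) * move (f i) i (f' i)"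
      "move (q (f i)) i (q (f' i)) * move (q (f j)) j (q (f' j)) =
       move (q (f j)) j (q (f' j)) * move (q (f i)) i (q (f' i))"
      using move_sites_commute[OF assms(1,2,1,2)] move_sites_commute[OF R R, of i j] by auto
  qed
  also have "\<dots> = transfer (insert v J) (q \<circ> f) (q \<circ> f')"
  proof -
    have "f v = v" "f' v = v" using assms by (auto simp: retraction_def)
    then show ?thesis
      using transfer_remove(1)[OF R, of v] assms(4) by (simp add: transfer_def q_def)
  qed
  finally show ?thesis unfolding q_def .
qed

lemma transfer_cross_same:
  assumes "retr J f" "retr J f'" "points [a, b, c]" "f' a = f' b" "f' a = f' c"
  shows "transfer J f f' * cross a b c = transfer J f f'"
proof -
  have pts: "points [a, b]" "points [a, c]" using assms by auto
  have "transfer J f f' = transfer J f f' * join a b * join a c"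
    using transfer_join[OF assms(1,2)] pts assms(4,5) by simp
  then have A: "transfer J f f' = transfer J f f' * (join a b * join a c)"
    by (simp only: mult.assoc)
  have "transfer J f f' * cross a b c = transfer J f f' * (join a b * join a c * cross a b c)"
    by (subst A) (simp only: mult.assoc)
  then show ?thesis by (simp only: join_join_absorb[OF assms(3)] A[symmetric])
qed

text \<open>The idempotent \<open>transfer J f' f'\<close> is split off on the right, so that only
  its factor at \<open>b\<close> meets the move.\<close>

lemma transfer_move:
  assumes "retr J f" "retr J f'" "b \<in> J" "v \<in> {1..n} - J"
  shows "transfer J f f' * move (f' b) b v = transfer J f (f'(b := v))"
proof -
  define h where "h = f'(b := v)"
  have h: "retr J h" unfolding h_def using retraction_upd assms by blast
  have rest: "transfer (J - {b}) f' f' = transfer (J - {b}) f' h"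
    by (rule transfer_cong) (use retr_finite assms in \<open>auto simp: h_def\<close>)
  have bv: "join (f' b) b * move (f' b) b (h b) = move (f' b) b (h b)"
    by (rule join_move; rule retr_points) (use assms h in auto)
  have hb: "h b = v" by (simp add: h_def)
  have c: "move (f' b) b (h b) * transfer (J - {b}) f' h = transfer (J - {b}) f' h * move (f' b) b (h b)"
    using transfer_remove[OF assms(2) h assms(3)] by metis
  have "transfer J f' f' * move (f' b) b (h b) = join (f' b) b * (transfer (J - {b}) f' h * move (f' b) b (h b))"
    unfolding transfer_remove(1)[OF assms(2,2,3)] rest move_same by (simp only: mult.assoc)
  also have "\<dots> = transfer J f' h"
    unfolding c[symmetric] transfer_remove(1)[OF assms(2) h assms(3)]
    by (simp only: mult.assoc[symmetric] bv)
  finally have "transfer J f f' * (transfer J f' f' * move (f' b) b (h b)) = transfer J f h"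
    by (simp only: transfer_transfer[OF assms(1,2) h])
  then have "transfer J f f' * move (f' b) b v = transfer J f h"
    by (simp only: mult.assoc[symmetric] transfer_transfer[OF assms(1,2,2)] hb)
  then show ?thesis by (simp add: h_def)
qed

text \<open>A cross is a move followed by a swap. Its labels \<open>a\<close> and \<open>c\<close>
  may be replaced by their representatives because the transfer absorbs the corresponding
  joins.\<close>

lemma transfer_cross:
  assumes "retr J f" "retr J f'" "points [a, b, c]" "f' a = f' b" "f' c \<noteq> f' b" "b \<in> J"
  shows "transfer J f f' * cross a b c = transfer J f (f'(b := f' c)) * swap a c"
proof -
  let ?A = "transfer J f f'"
  define u v where "u = f' b" and "v = f' c"
  have u: "u \<in> {1..n} - J" "f' u = u" and v: "v \<in> {1..n} - J" "f' v = v"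
    using assms by (auto simp: retraction_def u_def v_def)
  have ub: "points [u, b]" "points [v, b]" "points [a, b]" "points [c, b]"
    using u v assms by auto
  have 1: "?A * move a b c = ?A * move u b c"
  proof (cases "a = u")
    case False
    then have ua: "points [u, a]" using u assms(3) by auto
    have A: "?A * join u a = ?A"
      using transfer_join[OF assms(1,2) ua] u assms(4) u_def by simp
    have "?A * join u a * move a b c = ?A * join u a * move u b c"
      using join_move_source[OF ua ub(1,3,4)] by (simp only: mult.assoc)
    then show ?thesis by (simp only: A)
  qed simp
  have 2: "?A * move u b c = ?A * move u b v"
  proof (cases "c = v")
    case False
    then have vc: "points [v, c]" using v assms(3) by auto
    have A: "?A * join v c = ?A"
      using transfer_join[OF assms(1,2) vc] v v_def by simp
    have "?A * join v c * move u b c = ?A * join v c * move u b v"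
      using join_move_target[OF vc ub(2,4,1)] by (simp only: mult.assoc)
    then show ?thesis by (simp only: A)
  qed simp
  have "cross a b c = move a b c * swap a c"
    using assms(3) by (simp add: move_eq mult.assoc)
  then have "?A * cross a b c = ?A * move a b c * swap a c" by (simp only: mult.assoc)
  also have "\<dots> = ?A * move (f' b) b v * swap a c" unfolding u_def[symmetric] by (simp only: 1 2)
  also have "\<dots> = transfer J f (f'(b := v)) * swap a c"
    by (simp only: transfer_move[OF assms(1,2,6) v(1)])
  finally show ?thesis by (simp only: v_def)
qed

text \<open>For equal labels the swap is absorbed; for different labels it combines with two joins
  to a pair of opposite moves by \<open>join_join_swap\<close>.\<close>

lemma transfer_transpose:
  assumes "retr J f" "retr J f'" "j \<in> J" "k \<in> J"
  shows "transfer J f f' * swap j k = transfer J f (f' \<circ> transpose j k)"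
proof (cases "f' j = f' k")
  case True
  then have eq: "f' \<circ> transpose j k = f'" by (auto simp: fun_eq_iff transpose_def)
  show ?thesis
  proof (cases "j = k")
    case True
    then show ?thesis by (simp add: swap_def transpose_same flip: id_def)
  next
    case False
    then have "points [j, k]" using assms by (auto simp: retraction_def)
    then show ?thesis using transfer_swap_same[OF assms(1,2)] True eq by simp
  qed
next
  case False
  then have jk: "j \<noteq> k" "k \<noteq> j" by auto
  define h where "h = f' \<circ> transpose j k"
  define a b where "a = f' j" and "b = f' k"
  let ?K = "J - {j} - {k}"
  have h: "retr J h"
    unfolding h_def by (rule retraction_permute[OF assms(2) permutes_swap_id[OF assms(3,4)]])
  have hj: "h j = b" "h k = a" by (simp_all add: h_def a_def b_def)
  have pts: "points [a, j, b, k]" "points [j, k]"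
    using retr_points[OF assms(2)] assms(3,4) False jk unfolding a_def b_def
    by (auto simp: retraction_def)
  have fin: "finite ?K" using retr_finite assms by blast
  have rest: "transfer ?K f' f' = transfer ?K f' h"
    by (rule transfer_cong[OF fin]) (auto simp: h_def transpose_apply_other)
  have two: "transfer J f' g = move a j (g j) * (move b k (g k) * transfer ?K f' g)" if g: "retr J g" for g
  proof -
    have "transfer (J - {j}) f' g = move (f' k) k (g k) * transfer ?K f' g"
      unfolding transfer_def
      by (rule ordered_prod_remove)
        (use retr_finite[OF assms(2)] assms(4) jk move_sites_commute[OF assms(2) g assms(2) g assms(4)] in auto)
    then show ?thesis
      unfolding transfer_remove(1)[OF assms(2) g assms(3)] a_def b_def by simp
  qed
  have c: "swap j k * transfer ?K f' h = transfer ?K f' h * swap j k"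
    unfolding transfer_def
  proof (rule ordered_prod_commute[OF fin])
    fix i assume i: "i \<in> ?K"
    have "f' i \<noteq> j" "f' i \<noteq> k" "h i \<noteq> j" "h i \<noteq> k" "i \<noteq> j" "i \<noteq> k"
      using i assms(2,3,4) h by (auto simp: retraction_def)
    then show "swap j k * move (f' i) i (h i) = move (f' i) i (h i) * swap j k"
      using swap_move[OF pts(2) retr_points[OF assms(2), of i i] retr_points[OF h, of i i]] i
      by (simp add: transpose_apply_other)
  qed
  have "transfer J f' f' * swap j k = join a j * join b k * (transfer ?K f' h * swap j k)"
    unfolding two[OF assms(2)] rest a_def[symmetric] b_def[symmetric] move_same by (simp only: mult.assoc)
  also have "\<dots> = join a j * join b k * swap j k * transfer ?K f' h"
    by (simp only: c[symmetric] mult.assoc)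
  also have "\<dots> = transfer J f' h"
    unfolding join_join_swap[OF pts(1)] two[OF h] hj by (simp only: mult.assoc)
  finally have "transfer J f f' * (transfer J f' f' * swap j k) = transfer J f h"
    by (simp only: transfer_transfer[OF assms(1,2) h])
  then show ?thesis
    by (simp only: mult.assoc[symmetric] transfer_transfer[OF assms(1,2,2)] h_def)
qed

lemma transfer_permute_sites:
  assumes "\<pi> permutes J" "retr J f" "retr J f'"
  shows "transfer J f f' * perm_elem \<pi> = transfer J f (f' \<circ> \<pi>)"
proof -
  have J: "J \<subseteq> {1..n}" "finite J" using assms(2) retr_finite by (auto simp: retraction_def)
  have "\<forall>f'. retr J f' \<longrightarrow> transfer J f f' * perm_elem \<pi> = transfer J f (f' \<circ> \<pi>)"
    using assms(1) J(2)
  proof (induction rule: permutes_induct)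
    case id
    show ?case using perm_elem_id by (simp add: id_def)
  next
    case (swap a b p)
    have t: "transpose a b permutes J" using swap by (intro permutes_swap_id)
    have S: "Sym (transpose a b)" "Sym p"
      using permutes_subset[OF t J(1)] permutes_subset[OF swap(4) J(1)] by blast+
    show ?case
    proof (intro allI impI)
      fix f' assume f': "retr J f'"
      have "transfer J f f' * perm_elem (transpose a b \<circ> p) = transfer J f f' * swap a b * perm_elem p"
        by (simp only: perm_elem_comp[OF S] swap_def mult.assoc)
      also have "\<dots> = transfer J f (f' \<circ> transpose a b \<circ> p)"
        using swap(5)[rule_format, OF retraction_permute[OF f' t]]
        by (simp only: transfer_transpose[OF assms(2) f' swap(1,2)])
      finally show "transfer J f f' * perm_elem (transpose a b \<circ> p) = transfer J f (f' \<circ> (transpose a b \<circ> p))"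
        by (simp only: comp_assoc)
    qed
  qed
  then show ?thesis using assms(3) by blast
qed

text \<open>\<open>\<pi>\<close> need not preserve \<open>J\<close>. If it moves a representative
  \<open>r\<close>, then \<open>r\<close> and \<open>\<pi> r\<close> have the same label, so the
  transposition sending \<open>\<pi> r\<close> back to \<open>r\<close> is absorbed; induction on
  the moved representatives ends with a permutation of \<open>J\<close>.\<close>

lemma transfer_permute:
  assumes "Sym \<pi>" "retr J f" "retr J f'" "retr J (f' \<circ> \<pi>)"
  shows "transfer J f f' * perm_elem \<pi> = transfer J f (f' \<circ> \<pi>)"
  using assms(1,4)
proof (induction "card {r \<in> {1..n} - J. \<pi> r \<noteq> r}" arbitrary: \<pi> rule: less_induct)
  case less
  show ?case
  proof (cases "\<exists>r\<in>{1..n} - J. \<pi> r \<noteq> r")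
    case False
    have "\<pi> permutes J"
      by (rule permutes_superset[OF less.prems(1)]) (use False in blast)
    then show ?thesis using transfer_permute_sites assms by blast
  next
    case True
    then obtain r where r: "r \<in> {1..n} - J" "\<pi> r \<noteq> r" by blast
    have \<pi>r: "\<pi> r \<in> {1..n}" using permutes_in_image[OF less.prems(1)] r by blast
    have pts: "points [r, \<pi> r]" using r \<pi>r by auto
    have f'r: "f' r = f' (\<pi> r)"
      using r less.prems(2) assms(3) by (simp add: retraction_def)
    define t where "t = transpose r (\<pi> r)"
    have t: "Sym t" unfolding t_def by (rule Sym_transpose) (use r \<pi>r in auto)
    have tt: "t \<circ> (t \<circ> \<pi>) = \<pi>" by (simp add: t_def fun_eq_iff)
    have ft: "f' \<circ> (t \<circ> \<pi>) = f' \<circ> \<pi>"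
    proof
      fix i
      show "(f' \<circ> (t \<circ> \<pi>)) i = (f' \<circ> \<pi>) i"
        using f'r by (simp add: t_def transpose_def)
    qed
    have S: "Sym (t \<circ> \<pi>)" using t less.prems(1) by (rule permutes_compose[rotated])
    have sub: "{i \<in> {1..n} - J. (t \<circ> \<pi>) i \<noteq> i} \<subset> {i \<in> {1..n} - J. \<pi> i \<noteq> i}"
    proof
      have "(t \<circ> \<pi>) i = i" if "\<pi> i = i" for i
      proof -
        have "i \<noteq> r" using r that by auto
        moreover have "i \<noteq> \<pi> r" using that calculation injD[OF permutes_inj[OF less.prems(1)]] by metis
        ultimately show ?thesis using that by (simp add: t_def transpose_apply_other)
      qed
      then show "{i \<in> {1..n} - J. (t \<circ> \<pi>) i \<noteq> i} \<subseteq> {i \<in> {1..n} - J. \<pi> i \<noteq> i}" by blast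
      have "(t \<circ> \<pi>) r = r" by (simp add: t_def)
      then show "{i \<in> {1..n} - J. (t \<circ> \<pi>) i \<noteq> i} \<noteq> {i \<in> {1..n} - J. \<pi> i \<noteq> i}"
        using r by blast
    qed
    have "transfer J f f' * perm_elem \<pi> = transfer J f f' * swap r (\<pi> r) * perm_elem (t \<circ> \<pi>)"
      using perm_elem_comp[OF t S] by (simp add: tt swap_def t_def[symmetric] mult.assoc)
    also have "\<dots> = transfer J f f' * perm_elem (t \<circ> \<pi>)"
      by (simp only: transfer_swap_same[OF assms(2,3) pts f'r])
    also have "\<dots> = transfer J f (f' \<circ> (t \<circ> \<pi>))"
      by (rule less.hyps[OF psubset_card_mono[OF _ sub] S]) (use less.prems ft in auto)
    finally show ?thesis by (simp only: ft)
  qed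
qed

text \<open>Replacing the representative \<open>r\<close> by \<open>k\<close> conjugates the
  transfer by a transposition, which is absorbed on the left because \<open>r\<close> and
  \<open>k\<close> share an upper block; only the right-hand swap survives.\<close>

lemma transfer_change_representative:
  assumes "retr J f" "retr J f'" "k \<in> J" "f k = r"
  defines "t \<equiv> transpose r k"
  shows "transfer J f f' = transfer (t ` J) (t \<circ> f) (t \<circ> f' \<circ> t) * swap r k"
    "retr (t ` J) (t \<circ> f)" "retr (t ` J) (t \<circ> f' \<circ> t)"
proof -
  have r: "r \<in> {1..n} - J" "f r = r" using assms by (auto simp: retraction_def)
  have pts: "points [r, k]" using retr_points assms by blast
  have rk: "r \<in> {1..n}" "k \<in> {1..n}" using pts by auto
  have ft: "f \<circ> t = f" using assms(4) r by (auto simp: t_def fun_eq_iff transpose_def)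
  have R: "retr (t ` J) (t \<circ> f \<circ> t)" "retr (t ` J) (t \<circ> f' \<circ> t)"
    unfolding t_def using retraction_conj assms(1,2) rk by blast+
  then show "retr (t ` J) (t \<circ> f)" "retr (t ` J) (t \<circ> f' \<circ> t)"
    by (simp_all add: comp_assoc ft)
  have invol: "t (t j) = j" for j by (simp add: t_def)
  have "swap r k * transfer J f f' = transfer (t ` J) (t \<circ> f \<circ> t) (t \<circ> f' \<circ> t) * swap r k"
    unfolding transfer_def
  proof (rule ordered_prod_intertwine[OF retr_finite[OF assms(1)]])
    show "inj t" by (simp add: t_def)
    fix j assume j: "j \<in> J"
    show "swap r k * move (f j) j (f' j) =
      move ((t \<circ> f \<circ> t) (t j)) (t j) ((t \<circ> f' \<circ> t) (t j)) * swap r k"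
      unfolding comp_apply invol unfolding t_def
      by (rule swap_move[OF pts]; rule retr_points) (use assms j in auto)
  next
    fix i j assume ij: "i \<in> J" "j \<in> J" "i \<noteq> j"
    show "move (f i) i (f' i) * move (f j) j (f' j) = move (f j) j (f' j) * move (f i) i (f' i)"
      by (rule move_sites_commute[OF assms(1,2,1,2) ij])
    show "move ((t \<circ> f \<circ> t) (t i)) (t i) ((t \<circ> f' \<circ> t) (t i)) * move ((t \<circ> f \<circ> t) (t j)) (t j) ((t \<circ> f' \<circ> t) (t j)) =
      move ((t \<circ> f \<circ> t) (t j)) (t j) ((t \<circ> f' \<circ> t) (t j)) * move ((t \<circ> f \<circ> t) (t i)) (t i) ((t \<circ> f' \<circ> t) (t i))"
      by (rule move_sites_commute[OF R R]) (use ij invol in \<open>auto intro: imageI, metis\<close>)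
  qed
  moreover have "swap r k * transfer J f f' = transfer J f f'"
  proof -
    have "join r k * transfer J f f' = transfer J f f'"
      using transfer_join_site(2)[OF assms(1-3)] assms(4) by simp
    moreover have "swap r k * (join r k * transfer J f f') = join r k * transfer J f f'"
      by (simp only: mult.assoc[symmetric] join_swap[OF pts])
    ultimately show ?thesis by simp
  qed
  ultimately show "transfer J f f' = transfer (t ` J) (t \<circ> f) (t \<circ> f' \<circ> t) * swap r k"
    by (simp add: comp_assoc ft)
qed

end

section \<open>Words as relations on functions\<close>

text \<open>Pairs of labellings of the upper and the lower row. They live on all naturals, and
  points that a generator does not touch keep their value, so \<open>n\<close> does not
  enter.\<close>

primrec generator_rel :: "generator \<Rightarrow> ((nat \<Rightarrow> nat) \<times> (nat \<Rightarrow> nat)) set" where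
  "generator_rel X = {(u, u(1 := u 3, 2 := u 3, 3 := u 1)) | u. u 1 = u 2}"
| "generator_rel (S i) = {(u, u \<circ> transpose i (Suc i)) | u. True}"

definition word_rel :: "generator list \<Rightarrow> ((nat \<Rightarrow> nat) \<times> (nat \<Rightarrow> nat)) set" where
  "word_rel w = foldr (\<lambda>a r. generator_rel a O r) w Id"

lemma word_rel_simps [simp]:
  "word_rel [] = Id" "word_rel (a # w) = generator_rel a O word_rel w"
  by (simp_all add: word_rel_def)

lemma word_rel_append: "word_rel (v @ w) = word_rel v O word_rel w"
  by (induction v) (simp_all add: O_assoc)

text \<open>
  If \<open>f\<close> and \<open>f'\<close> label the upper and the lower points by their blocks, then \<open>pair_rel f f'\<close>
  consists of the pairs of functions that are constant on the blocks.
\<close>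

definition pair_rel :: "(nat \<Rightarrow> nat) \<Rightarrow> (nat \<Rightarrow> nat) \<Rightarrow> ((nat \<Rightarrow> nat) \<times> (nat \<Rightarrow> nat)) set" where
  "pair_rel f f' = range (\<lambda>\<phi>. (\<phi> \<circ> f, \<phi> \<circ> f'))"

lemma pair_rel_id: "pair_rel id id = Id"
  by (auto simp: pair_rel_def)

lemma pair_rel_S: "pair_rel f f' O generator_rel (S i) = pair_rel f (f' \<circ> transpose i (Suc i))"
  by (auto simp: pair_rel_def comp_assoc intro!: relcompI)

lemma pair_rel_X:
  assumes "f' 1 = f' 2"
  shows "pair_rel f f' O generator_rel X = pair_rel f (f'(1 := f' 3, 2 := f' 3, 3 := f' 1))"
proof -
  have eq: "(\<phi> \<circ> f')(1 := (\<phi> \<circ> f') 3, 2 := (\<phi> \<circ> f') 3, 3 := (\<phi> \<circ> f') 1) =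
    \<phi> \<circ> f'(1 := f' 3, 2 := f' 3, 3 := f' 1)" for \<phi> :: "nat \<Rightarrow> nat"
    by (auto simp: fun_eq_iff)
  have "(\<phi> \<circ> f', \<phi> \<circ> f'(1 := f' 3, 2 := f' 3, 3 := f' 1)) \<in> generator_rel X" for \<phi> :: "nat \<Rightarrow> nat"
    unfolding eq[symmetric] using assms by auto
  moreover have "v = \<phi> \<circ> f'(1 := f' 3, 2 := f' 3, 3 := f' 1)" if "(\<phi> \<circ> f', v) \<in> generator_rel X" for \<phi> v
    using that unfolding eq[symmetric] by auto
  ultimately show ?thesis
    unfolding pair_rel_def by blast
qed

text \<open>\<open>X\<close> accepts only labellings that agree at 1 and 2, so the labels of these
  two points may be merged beforehand.\<close>

lemma pair_rel_X_merge:
  defines "q \<equiv> \<lambda>f'. id(f' 2 := f' (1::nat))"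
  shows "pair_rel f f' O generator_rel X = pair_rel (q f' \<circ> f) (q f' \<circ> f') O generator_rel X"
proof
  show "pair_rel f f' O generator_rel X \<subseteq> pair_rel (q f' \<circ> f) (q f' \<circ> f') O generator_rel X"
  proof (rule subsetI, clarify)
    fix u w v assume "(u, w) \<in> pair_rel f f'" and v: "(w, v) \<in> generator_rel X"
    then obtain \<phi> where \<phi>: "u = \<phi> \<circ> f" "w = \<phi> \<circ> f'" by (auto simp: pair_rel_def)
    have "\<phi> (f' 1) = \<phi> (f' 2)" using v \<phi> by auto
    then have "\<phi> \<circ> q f' = \<phi>" by (auto simp: q_def fun_eq_iff)
    then have "u = \<phi> \<circ> (q f' \<circ> f)" "w = \<phi> \<circ> (q f' \<circ> f')"
      unfolding \<phi> by (simp_all only: o_assoc)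
    then have "(u, w) \<in> pair_rel (q f' \<circ> f) (q f' \<circ> f')"
      unfolding pair_rel_def by blast
    with v show "(u, v) \<in> pair_rel (q f' \<circ> f) (q f' \<circ> f') O generator_rel X" by blast
  qed
  have "pair_rel (q f' \<circ> f) (q f' \<circ> f') \<subseteq> pair_rel f f'"
    unfolding pair_rel_def o_assoc by blast
  then show "pair_rel (q f' \<circ> f) (q f' \<circ> f') O generator_rel X \<subseteq> pair_rel f f' O generator_rel X"
    by blast
qed

section \<open>Every word as a transfer times a permutation, and uniqueness of the value\<close>

context presented
begin

text \<open>A relation rather than a function of \<open>\<rho>\<close>, since the data are far from
  unique; that \<open>m\<close> depends on \<open>\<rho>\<close> only is
  \<open>represents_unique\<close>.\<close>

definition represents :: "((nat \<Rightarrow> nat) \<times> (nat \<Rightarrow> nat)) set \<Rightarrow> 'm \<Rightarrow> bool" where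
  "represents \<rho> m \<longleftrightarrow> (\<exists>J f f' p. retr J f \<and> retr J f' \<and> Sym p \<and>
     \<rho> = pair_rel f (f' \<circ> p) \<and> m = transfer J f f' * perm_elem p)"

lemma represents_Id: "represents Id 1"
  unfolding represents_def
  by (rule exI[of _ "{}"], rule exI[of _ id], rule exI[of _ id], rule exI[of _ id])
    (simp add: retraction_def transfer_def pair_rel_id permutes_id)

lemma represents_S:
  assumes "represents \<rho> m" "1 \<le> i" "i < n"
  shows "represents (\<rho> O generator_rel (S i)) (m * s i)"
proof -
  obtain J f f' p where r: "retr J f" "retr J f'" "Sym p" "\<rho> = pair_rel f (f' \<circ> p)"
    "m = transfer J f f' * perm_elem p"
    using assms(1) unfolding represents_def by blast
  let ?t = "transpose i (Suc i)"
  have t: "Sym ?t" by (rule Sym_transpose) (use assms in auto)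
  have "Sym (p \<circ> ?t)" using t r(3) by (rule permutes_compose)
  moreover have "\<rho> O generator_rel (S i) = pair_rel f (f' \<circ> (p \<circ> ?t))"
    unfolding r pair_rel_S by (simp only: comp_assoc)
  moreover have "m * s i = transfer J f f' * perm_elem (p \<circ> ?t)"
    unfolding r perm_elem_comp[OF r(3) t] using s_eq_swap[OF assms(2,3)] by (simp add: swap_def mult.assoc)
  ultimately show ?thesis using r(1,2) unfolding represents_def by blast
qed

text \<open>Each point is replaced in turn by the representative of its lower block, which makes
  \<open>transfer_merge\<close> applicable.\<close>

lemma transfer_join_labels:
  assumes "retr J f" "retr J f'" "points [a, b]" "f' a \<noteq> f' b"
  shows "transfer J f f' * join a b = transfer J f f' * join (f' a) (f' b)"
proof -
  let ?A = "transfer J f f'"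
  have half: "?A * join a b = ?A * join (f' a) b" if ab: "points [a, b]" "f' a \<noteq> f' b" for a b
  proof (cases "f' a = a")
    case False
    have aJ: "a \<in> J" using False assms(2) by (auto simp: retraction_def)
    then have u: "f' (f' a) = f' a" "points [f' a, a]" "f' a \<noteq> b"
      using assms(2) ab(2) retr_points[OF assms(2) aJ aJ] by (auto simp: retraction_def)
    then have pts: "points [a, f' a, b]" "points [a, f' a]" using ab(1) by auto
    have A: "?A * join a (f' a) = ?A"
      using transfer_join[OF assms(1,2) pts(2)] u by simp
    have "?A * join a (f' a) * join a b = ?A * join a (f' a) * join (f' a) b"
      using join_join_rotate[OF pts(1)] by (simp only: mult.assoc)
    then show ?thesis by (simp only: A)
  qed simp
  have u: "f' (f' a) = f' a" "points [f' a, b]" "points [b, f' a]"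
    using assms by (cases "a \<in> J"; auto simp: retraction_def)+
  have v: "points [f' a, f' b]" "points [f' b, f' a]"
    using assms by (cases "a \<in> J"; cases "b \<in> J"; auto simp: retraction_def)+
  have "?A * join a b = ?A * join b (f' a)"
    using half[OF assms(3,4)] join_sym[OF u(2)] by simp
  also have "\<dots> = ?A * join (f' b) (f' a)"
    by (rule half) (use u assms(4) in auto)
  finally show ?thesis using join_sym[OF v(1)] by simp
qed

text \<open>Passing \<open>x\<close> through the permutation turns it into a cross of
  \<open>a\<close>, \<open>b\<close>, \<open>c\<close>. Once \<open>a\<close> and \<open>b\<close>
  have equal labels, the effect depends on whether \<open>c\<close> shares that label and on which
  of \<open>a\<close> and \<open>b\<close> is a non-representative.\<close>

lemma represents_X:
  assumes "represents \<rho> m"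
  shows "represents (\<rho> O generator_rel X) (m * x)"
proof -
  obtain J f f' p where r: "retr J f" "retr J f'" "Sym p" "\<rho> = pair_rel f (f' \<circ> p)"
    "m = transfer J f f' * perm_elem p"
    using assms(1) unfolding represents_def by blast
  define a b c where "a = p 1" and "b = p 2" and "c = p 3"
  have "points [1, 2, 3]" using three_le by simp
  then have pts: "points [a, b, c]"
    using points_map[OF r(3), of "[1, 2, 3]"] unfolding a_def b_def c_def by (simp only: list.map)
  have p_other: "p k \<noteq> a" "p k \<noteq> b" "p k \<noteq> c" if "k \<noteq> 1" "k \<noteq> 2" "k \<noteq> 3" for k
    using that injD[OF permutes_inj[OF r(3)]] unfolding a_def b_def c_def by blast+
  have mx: "m * x = transfer J f f' * cross a b c * perm_elem p"
    unfolding r using cross_perm_elem[OF r(3), of a b c] by (simp add: a_def b_def c_def mult.assoc)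
  \<comment> \<open>Reduction to equal labels at \<open>a\<close> and \<open>b\<close>: the cross
    provides \<open>join a b\<close> on its left, and on the side of functions
    \<open>pair_rel_X_merge\<close> has the same effect.\<close>
  have "\<exists>J f f'. retr J f \<and> retr J f' \<and> f' a = f' b \<and> m * x = transfer J f f' * cross a b c * perm_elem p \<and>
    \<rho> O generator_rel X = pair_rel f (f' \<circ> p) O generator_rel X"
  proof (cases "f' a = f' b")
    case True
    then show ?thesis using r mx by blast
  next
    case False
    define u v where "u = f' a" and "v = f' b"
    define q where "q = id(v := u)"
    have ab: "points [a, b]" using pts by auto
    have uv: "u \<in> {1..n} - J" "v \<in> {1..n} - J" "u \<noteq> v"
      using r(2) pts False unfolding u_def v_def
      by (cases "a \<in> J"; cases "b \<in> J"; auto simp: retraction_def)+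
    have "transfer J f f' * cross a b c = transfer J f f' * join a b * cross a b c"
      using join_cross[OF pts] by (simp add: mult.assoc)
    also have "\<dots> = transfer (insert v J) (q \<circ> f) (q \<circ> f') * cross a b c"
      unfolding transfer_join_labels[OF r(1,2) ab False] u_def[symmetric] v_def[symmetric]
        transfer_merge[OF r(1,2) uv] q_def ..
    finally have 1: "m * x = transfer (insert v J) (q \<circ> f) (q \<circ> f') * cross a b c * perm_elem p"
      unfolding mx by simp
    have 2: "\<rho> O generator_rel X = pair_rel (q \<circ> f) ((q \<circ> f') \<circ> p) O generator_rel X"
      using pair_rel_X_merge[of f "f' \<circ> p"]
      by (simp add: r q_def u_def v_def a_def b_def comp_assoc)
    have "(q \<circ> f') a = (q \<circ> f') b" using uv by (simp add: q_def u_def[symmetric] v_def[symmetric])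
    then show ?thesis
      using 1 2 retraction_merge[OF r(1) uv] retraction_merge[OF r(2) uv] unfolding q_def by blast
  qed
  then obtain J f f' where f: "retr J f" "retr J f'" "f' a = f' b"
    and mx: "m * x = transfer J f f' * cross a b c * perm_elem p"
    and \<rho>X: "\<rho> O generator_rel X = pair_rel f (f' \<circ> p) O generator_rel X"
    by blast
  define h where "h = (f' \<circ> p)(1 := f' c, 2 := f' c, 3 := f' a)"
  have \<rho>h: "\<rho> O generator_rel X = pair_rel f h"
    unfolding \<rho>X h_def using pair_rel_X[of "f' \<circ> p" f] f(3) by (simp add: a_def b_def c_def)
  have h_eq: "h = g \<circ> p" if "g a = f' c" "g b = f' c" "g c = f' a" "\<And>i. i \<notin> {a, b, c} \<Longrightarrow> g i = f' i"
    for g :: "nat \<Rightarrow> nat"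
  proof
    fix k :: nat
    consider "k = 1" | "k = 2" | "k = 3" | "k \<noteq> 1" "k \<noteq> 2" "k \<noteq> 3" by blast
    then show "h k = (g \<circ> p) k"
      using that p_other[of k] by cases (auto simp: h_def a_def b_def c_def)
  qed
  have final: ?thesis if "retr J g" "d \<in> {1..n}" "e \<in> {1..n}"
    "transfer J f f' * cross a b c = transfer J f g * swap d e" "h = g \<circ> transpose d e \<circ> p" for g d e
  proof -
    have t: "Sym (transpose d e)" using that by (intro Sym_transpose)
    have "m * x = transfer J f g * perm_elem (transpose d e \<circ> p)"
      unfolding mx that(4) swap_def perm_elem_comp[OF t r(3)] by (simp only: mult.assoc)
    moreover have "Sym (transpose d e \<circ> p)" using r(3) t by (rule permutes_compose)
    ultimately show ?thesis
      using f(1) that(1,5) \<rho>h unfolding represents_def by (metis comp_assoc)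
  qed
  show ?thesis
  proof (cases "f' c = f' b")
    case True
    \<comment> \<open>The cross is absorbed here; the trivial transposition fits this case into the
      common conclusion.\<close>
    have aa: "transpose a a = id" by simp
    show ?thesis
    proof (rule final)
      have "transfer J f f' * cross a b c = transfer J f f'"
        by (rule transfer_cross_same[OF f(1,2) pts]) (use f(3) True in auto)
      then show "transfer J f f' * cross a b c = transfer J f f' * swap a a"
        by (simp only: swap_def aa perm_elem_id mult_1_right)
      have "h = f' \<circ> p" by (rule h_eq) (use f(3) True in auto)
      then show "h = f' \<circ> transpose a a \<circ> p" by (simp only: aa comp_id)
    qed (use f(2) pts in auto)
  next
    case False
    show ?thesis
    proof (cases "b \<in> J")
      case True
      have c: "f' c \<in> {1..n} - J"
        using pts f(2) by (cases "c \<in> J") (auto simp: retraction_def)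
      show ?thesis
      proof (rule final)
        show "transfer J f f' * cross a b c = transfer J f (f'(b := f' c)) * swap a c"
          by (rule transfer_cross[OF f(1,2) pts f(3) False True])
        show "retr J (f'(b := f' c))" by (rule retraction_upd[OF f(2) True c])
        show "h = f'(b := f' c) \<circ> transpose a c \<circ> p"
          by (rule h_eq) (use pts f(3) in \<open>auto simp: transpose_def\<close>)
      qed (use pts in auto)
    next
      case bJ: False
      then have "f' b = b" using f(2) by (simp add: retraction_def)
      \<comment> \<open>Distinct points with equal labels cannot both be representatives. The
        symmetry of \<open>cross\<close> in its first two points then lets \<open>a\<close> play the
        part of \<open>b\<close>.\<close>
      then have a: "a \<in> J" using f(2,3) pts by (auto simp: retraction_def)
      have c: "f' c \<in> {1..n} - J"
        using pts f(2) by (cases "c \<in> J") (auto simp: retraction_def)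
      have pts': "points [b, a, c]" using pts by auto
      show ?thesis
      proof (rule final)
        show "transfer J f f' * cross a b c = transfer J f (f'(a := f' c)) * swap b c"
          using transfer_cross[OF f(1,2) pts' f(3)[symmetric] _ a] False f(3) cross_sym[OF pts] by simp
        show "retr J (f'(a := f' c))" by (rule retraction_upd[OF f(2) a c])
        show "h = f'(a := f' c) \<circ> transpose b c \<circ> p"
          by (rule h_eq) (use pts f(3) in \<open>auto simp: transpose_def\<close>)
      qed (use pts in auto)
    qed
  qed
qed

text \<open>\<open>\<phi>\<close> and \<open>\<psi>\<close> translate the block labels of the two
  expressions into each other. Induction on the number of points that are representatives only for
  the second expression; each step exchanges one of them with its representative in the
  first.\<close>

lemma transfer_unique:
  assumes "retr J f" "retr J f1" "Sym p" "retr J' f'" "retr J' f1'" "Sym p'"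
    "f = \<phi> \<circ> f'" "f1 \<circ> p = \<phi> \<circ> (f1' \<circ> p')" "f' = \<psi> \<circ> f" "f1' \<circ> p' = \<psi> \<circ> (f1 \<circ> p)"
  shows "transfer J f f1 * perm_elem p = transfer J' f' f1' * perm_elem p'"
  using assms
proof (induction "card (J - J')" arbitrary: J f f1 p \<phi> \<psi> rule: less_induct)
  case less
  note R = less.prems(1,2,4,5) and P = less.prems(3,6) and \<phi> = less.prems(7,8) and \<psi> = less.prems(9,10)
  have fix_R: "f r = r" "f1 r = r" if "r \<notin> J" for r using R that by (auto simp: retraction_def)
  have fix_R': "f' r = r" "f1' r = r" if "r \<notin> J'" for r using R that by (auto simp: retraction_def)
  have im: "f i \<notin> J" "f1 i \<notin> J" "f' i \<notin> J'" "f1' i \<notin> J'" for i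
    using R by (cases "i \<in> J"; cases "i \<in> J'"; auto simp: retraction_def)+
  show ?case
  proof (cases "J \<subseteq> J'")
    case True
    \<comment> \<open>A point outside \<open>J'\<close> is outside \<open>J\<close> as well, hence
      its own label for both retractions.\<close>
    have \<phi>fix: "\<phi> k = k" if "k \<notin> J'" for k
    proof -
      have "f k = k" using that True fix_R by blast
      moreover have "f k = \<phi> k" using \<phi>(1) fix_R'(1)[OF that] by (metis comp_apply)
      ultimately show ?thesis by simp
    qed
    have ff: "f = f'"
    proof
      fix j
      have "f j = \<phi> (f' j)" using \<phi>(1) by (metis comp_apply)
      then show "f j = f' j" using \<phi>fix im by simp
    qed
    have ff1: "f1 \<circ> p = f1' \<circ> p'"
    proof
      fix j
      have "(f1 \<circ> p) j = \<phi> ((f1' \<circ> p') j)" using \<phi>(2) by (metis comp_apply)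
      then show "(f1 \<circ> p) j = (f1' \<circ> p') j" using \<phi>fix im by simp
    qed
    have JJ: "J = J'"
    proof (rule equalityI[OF True], rule subsetI, rule ccontr)
      fix r assume r: "r \<in> J'" "r \<notin> J"
      have "f' r = r" using ff fix_R(1)[OF r(2)] by simp
      then show False using im(3)[of r] r(1) by simp
    qed
    \<comment> \<open>The two permutations may still differ, but only by a permutation that the
      transfer converts into a change of its lower retraction.\<close>
    define \<pi> where "\<pi> = p \<circ> inv_into UNIV p'"
    have \<pi>: "Sym \<pi>" unfolding \<pi>_def using permutes_inv[OF P(2)] P(1) by (rule permutes_compose)
    have pp: "\<pi> \<circ> p' = p" unfolding \<pi>_def using P(2) by (simp add: comp_assoc permutes_inv_o)
    have f\<pi>: "f1 \<circ> \<pi> = f1'"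
    proof -
      have "f1 \<circ> \<pi> = (f1' \<circ> p') \<circ> inv_into UNIV p'" unfolding \<pi>_def o_assoc ff1 ..
      then show ?thesis using P(2) by (simp add: comp_assoc permutes_inv_o)
    qed
    have "transfer J f f1 * perm_elem p = transfer J f f1 * perm_elem \<pi> * perm_elem p'"
      using perm_elem_comp[OF \<pi> P(2)] by (simp add: pp mult.assoc)
    also have "transfer J f f1 * perm_elem \<pi> = transfer J f f1'"
      using transfer_permute[OF \<pi> R(1,2)] f\<pi> R(4) JJ by simp
    finally show ?thesis by (simp add: JJ ff)
  next
    case False
    then obtain k where k: "k \<in> J" "k \<notin> J'" by blast
    define r where "r = f k"
    define t where "t = transpose r k"
    note new = transfer_change_representative[OF R(1,2) k(1) r_def[symmetric], folded t_def]
    have r: "r \<notin> J" "f r = r" using im fix_R by (simp_all add: r_def)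
    have rk: "r \<in> {1..n}" "k \<in> {1..n}" "r \<noteq> k"
      using R(1) k(1) by (auto simp: retraction_def r_def)
    \<comment> \<open>Otherwise \<open>r\<close> and \<open>k\<close> would be distinct labels of
      \<open>f'\<close>, although \<open>f\<close> puts them into one block.\<close>
    have rJ': "r \<in> J'"
    proof (rule ccontr)
      assume "r \<notin> J'"
      then have "f' r = r" "f' k = k" using fix_R' k by auto
      moreover have "f' k = \<psi> (f k)" "f' r = \<psi> (f r)" using \<psi>(1) by (metis comp_apply)+
      ultimately show False using rk(3) r(2) by (simp add: r_def)
    qed
    have t: "Sym t" unfolding t_def by (rule Sym_transpose[OF rk(1,2)])
    \<comment> \<open>The exchange replaces \<open>k\<close> by \<open>r\<close> among the
      non-representatives; as \<open>r\<close> lies in \<open>J'\<close>, the difference loses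
      \<open>k\<close> and gains nothing.\<close>
    have sub: "t ` J - J' \<subset> J - J'"
    proof
      have "t j \<in> J - J'" if "j \<in> J" "t j \<notin> J'" for j
        using that k r rJ' by (cases "j = k") (auto simp: t_def transpose_def split: if_splits)
      then show "t ` J - J' \<subseteq> J - J'" by blast
      have "k \<notin> t ` J"
      proof
        assume "k \<in> t ` J"
        then obtain j where "j \<in> J" "k = t j" by blast
        moreover have "t (t j) = j" by (simp add: t_def)
        ultimately have "t k = j" by metis
        then show False using r(1) \<open>j \<in> J\<close> by (simp add: t_def)
      qed
      then show "t ` J - J' \<noteq> J - J'" using k by blast
    qed
    have fin: "finite (J - J')" using retr_finite[OF R(1)] by blast
    have "transfer J f f1 * perm_elem p = transfer (t ` J) (t \<circ> f) (t \<circ> f1 \<circ> t) * perm_elem (t \<circ> p)"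
      unfolding new(1) perm_elem_comp[OF t P(1)] swap_def t_def[symmetric] by (simp only: mult.assoc)
    also have "\<dots> = transfer J' f' f1' * perm_elem p'"
    proof (rule less.hyps[OF psubset_card_mono[OF fin sub] new(2,3) _ R(3,4) P(2)])
      show "Sym (t \<circ> p)" using P(1) t by (rule permutes_compose)
      show "t \<circ> f = (t \<circ> \<phi>) \<circ> f'" unfolding \<phi>(1) by (simp only: comp_assoc)
      have c: "t \<circ> f1 \<circ> t \<circ> (t \<circ> p) = t \<circ> (f1 \<circ> p)"
        by (simp add: fun_eq_iff t_def)
      show "t \<circ> f1 \<circ> t \<circ> (t \<circ> p) = (t \<circ> \<phi>) \<circ> (f1' \<circ> p')" unfolding c \<phi>(2) by (simp only: comp_assoc)
      have c': "(\<psi> \<circ> t) \<circ> (t \<circ> g) = \<psi> \<circ> g" for g :: "nat \<Rightarrow> nat" by (simp add: fun_eq_iff t_def)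
      show "f' = (\<psi> \<circ> t) \<circ> (t \<circ> f)" unfolding c' by (rule \<psi>(1))
      show "f1' \<circ> p' = (\<psi> \<circ> t) \<circ> (t \<circ> f1 \<circ> t \<circ> (t \<circ> p))" unfolding c c' by (rule \<psi>(2))
    qed
    finally show ?thesis .
  qed
qed

text \<open>The pair of label functions is itself a member of its \<open>pair_rel\<close>, so
  equality of the relations yields relabellings in both directions.\<close>

lemma represents_unique:
  assumes "represents \<rho> m" "represents \<rho> m'"
  shows "m = m'"
proof -
  obtain J f f1 p where r: "retr J f" "retr J f1" "Sym p" "\<rho> = pair_rel f (f1 \<circ> p)"
    "m = transfer J f f1 * perm_elem p"
    using assms(1) unfolding represents_def by blast
  obtain J' f' f1' p' where r': "retr J' f'" "retr J' f1'" "Sym p'" "\<rho> = pair_rel f' (f1' \<circ> p')"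
    "m' = transfer J' f' f1' * perm_elem p'"
    using assms(2) unfolding represents_def by blast
  have "(f, f1 \<circ> p) \<in> pair_rel f (f1 \<circ> p)" "(f', f1' \<circ> p') \<in> pair_rel f' (f1' \<circ> p')"
    unfolding pair_rel_def by (rule range_eqI[of _ _ id], simp)+
  then have "(f, f1 \<circ> p) \<in> pair_rel f' (f1' \<circ> p')" "(f', f1' \<circ> p') \<in> pair_rel f (f1 \<circ> p)"
    using r(4) r'(4) by simp_all
  then obtain \<phi> \<psi> where "f = \<phi> \<circ> f'" "f1 \<circ> p = \<phi> \<circ> (f1' \<circ> p')" "f' = \<psi> \<circ> f" "f1' \<circ> p' = \<psi> \<circ> (f1 \<circ> p)"
    unfolding pair_rel_def by blast
  then show ?thesis
    unfolding r(5) r'(5) using transfer_unique[OF r(1-3) r'(1-3)] by blast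
qed

lemma represents_word:
  "w \<in> lists (generators n) \<Longrightarrow> represents (word_rel w) (prod_list (map \<gamma> w))"
proof (induction w rule: rev_induct)
  case Nil
  show ?case using represents_Id by simp
next
  case (snoc a w)
  then have IH: "represents (word_rel w) (prod_list (map \<gamma> w))" and a: "a \<in> generators n" by auto
  have "represents (word_rel w O generator_rel a) (prod_list (map \<gamma> w) * \<gamma> a)"
  proof (cases a)
    case X
    then show ?thesis using represents_X[OF IH] by simp
  next
    case (S i)
    then have "1 \<le> i" "i < n" using a by (auto simp: generators_def)
    then show ?thesis using represents_S[OF IH] S by simp
  qed
  then show ?case by (simp add: word_rel_append)
qed

theorem word_problem:
  assumes "u \<in> lists (generators n)" "v \<in> lists (generators n)" "word_rel u = word_rel v"
  shows "prod_list (map \<gamma> u) = prod_list (map \<gamma> v)"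
  using represents_word[OF assms(1)] represents_word[OF assms(2)] assms(3) represents_unique by simp

end

section \<open>The relations hold for the associated relations on functions\<close>

lemma comp_transpose: "u \<circ> transpose i j = u(i := u j, j := u i)"
  by (auto simp: fun_eq_iff transpose_def)

lemma in_word_rel_X:
  "(u, v) \<in> word_rel (X # w) \<longleftrightarrow> u 1 = u 2 \<and> (u(1 := u 3, 2 := u 3, 3 := u 1), v) \<in> word_rel w"
  by auto

lemma in_word_rel_S:
  "(u, v) \<in> word_rel (S i # w) \<longleftrightarrow> (u(i := u (Suc i), Suc i := u i), v) \<in> word_rel w"
  by (auto simp: comp_transpose)

lemmas in_word_rel = in_word_rel_X in_word_rel_S

text \<open>Explicit values at the points 1 to 4 reduce the relations in \<open>X\<close>,
  \<open>S 1\<close>, \<open>S 2\<close> and \<open>S 3\<close> to rewriting.\<close>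

definition upd4 :: "(nat \<Rightarrow> nat) \<Rightarrow> nat \<Rightarrow> nat \<Rightarrow> nat \<Rightarrow> nat \<Rightarrow> nat \<Rightarrow> nat" where
  "upd4 u a b c d = u(1 := a, 2 := b, 3 := c, 4 := d)"

lemma upd4_self: "upd4 u (u 1) (u 2) (u 3) (u 4) = u"
  by (simp add: upd4_def)

lemma in_word_rel_upd4:
  "(upd4 u a b c d, v) \<in> word_rel (X # w) \<longleftrightarrow> a = b \<and> (upd4 u c c a d, v) \<in> word_rel w"
  "(upd4 u a b c d, v) \<in> word_rel (S 1 # w) \<longleftrightarrow> (upd4 u b a c d, v) \<in> word_rel w"
  "(upd4 u a b c d, v) \<in> word_rel (S 2 # w) \<longleftrightarrow> (upd4 u a c b d, v) \<in> word_rel w"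
  "(upd4 u a b c d, v) \<in> word_rel (S 3 # w) \<longleftrightarrow> (upd4 u a b d c, v) \<in> word_rel w"
  "(upd4 u a b c d, v) \<in> word_rel [] \<longleftrightarrow> v = upd4 u a b c d"
proof -
  have "(upd4 u a b c d)(1 := c, 2 := c, 3 := a) = upd4 u c c a d"
    "(upd4 u a b c d)(1 := b, 2 := a) = upd4 u b a c d"
    "(upd4 u a b c d)(2 := c, 3 := b) = upd4 u a c b d"
    "(upd4 u a b c d)(3 := d, 4 := c) = upd4 u a b d c"
    by (auto simp: upd4_def fun_eq_iff)
  moreover have "upd4 u a b c d 1 = a" "upd4 u a b c d 2 = b" "upd4 u a b c d 3 = c" "upd4 u a b c d 4 = d"
    by (simp_all add: upd4_def)
  moreover have "Suc 1 = 2" "Suc 2 = 3" "Suc 3 = 4" by simp_all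
  ultimately show "(upd4 u a b c d, v) \<in> word_rel (X # w) \<longleftrightarrow> a = b \<and> (upd4 u c c a d, v) \<in> word_rel w"
    "(upd4 u a b c d, v) \<in> word_rel (S 1 # w) \<longleftrightarrow> (upd4 u b a c d, v) \<in> word_rel w"
    "(upd4 u a b c d, v) \<in> word_rel (S 2 # w) \<longleftrightarrow> (upd4 u a c b d, v) \<in> word_rel w"
    "(upd4 u a b c d, v) \<in> word_rel (S 3 # w) \<longleftrightarrow> (upd4 u a b d c, v) \<in> word_rel w"
    by (simp_all only: in_word_rel)
qed auto

lemma word_rel_eqI4:
  assumes "\<And>u a b c d z. (upd4 u a b c d, z) \<in> word_rel v \<longleftrightarrow> (upd4 u a b c d, z) \<in> word_rel w"
  shows "word_rel v = word_rel w"
proof -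
  have "(u, z) \<in> word_rel v \<longleftrightarrow> (u, z) \<in> word_rel w" for u z
    using assms[of u "u 1" "u 2" "u 3" "u 4" z] by (simp only: upd4_self)
  then show ?thesis by auto
qed

lemma word_rel_map_S: "word_rel (map S w) = {(u, u \<circ> adjacent_perm w) | u. True}"
proof (induction w)
  case (Cons i w)
  then show ?case by (auto simp: comp_assoc intro!: relcompI)
qed auto

lemma adjacent_perm_coxeter:
  "adjacent_perm [i, i] = id"
  "adjacent_perm [i, Suc i, i, Suc i, i, Suc i] = id"
  "Suc i < j \<Longrightarrow> adjacent_perm [i, j, i, j] = id"
proof -
  show "adjacent_perm [i, i] = id" by (simp add: fun_eq_iff)
  show "adjacent_perm [i, Suc i, i, Suc i, i, Suc i] = id"
  proof
    fix k
    consider "k = i" | "k = Suc i" | "k = Suc (Suc i)" | "k \<notin> {i, Suc i, Suc (Suc i)}" by blast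
    then show "adjacent_perm [i, Suc i, i, Suc i, i, Suc i] k = id k"
      by cases (simp_all add: transpose_apply_other)
  qed
  assume ij: "Suc i < j"
  show "adjacent_perm [i, j, i, j] = id"
  proof
    fix k
    consider "k = i" | "k = Suc i" | "k = j" | "k = Suc j" | "k \<notin> {i, Suc i, j, Suc j}" by blast
    then show "adjacent_perm [i, j, i, j] k = id k"
      using ij by cases (simp_all add: transpose_apply_other)
  qed
qed

text \<open>As a block bijection, \<open>l_word i\<close> joins upper 1 and 2 to lower 1, upper k +
  1 to lower k for 2 \<le> k < i, and upper i + 1 to lower i and i + 1. The suffix \<open>w\<close>
  is carried along for the induction.\<close>

lemma in_word_rel_l_word:
  assumes "2 \<le> i"
  shows "(u, v) \<in> word_rel (l_word i @ w) \<longleftrightarrow>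
    u 1 = u 2 \<and> ((\<lambda>k. if 2 \<le> k \<and> k \<le> i then u (Suc k) else u k), v) \<in> word_rel w"
  using assms
proof (induction i arbitrary: u w rule: nat_induct_at_least)
  case base
  have l2: "l_word 2 = [X, S 2, S 1]"
    using l_word.simps(2)[of 1] by simp
  have "(\<lambda>k. if 2 \<le> k \<and> k \<le> 2 then u (Suc k) else u k) = u(2 := u 3)"
    by (auto simp: fun_eq_iff)
  moreover have "u(1 := u 3, 2 := u 3, 3 := u 1, 2 := u 1, 3 := u 3, 1 := u 1, 2 := u 3) = u(2 := u 3)"
    by (auto simp: fun_eq_iff)
  ultimately show ?case
    by (simp add: l2 in_word_rel del: word_rel_simps)
next
  case (Suc i)
  have l: "l_word (Suc i) = S (Suc i) # l_word i @ [S (Suc i), S i]"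
    using Suc.hyps by simp
  define u' where "u' = u(Suc i := u (Suc (Suc i)), Suc (Suc i) := u (Suc i))"
  define m where "m = (\<lambda>k. if 2 \<le> k \<and> k \<le> i then u' (Suc k) else u' k)"
  define m' where "m' = m(Suc i := m (Suc (Suc i)), Suc (Suc i) := m (Suc i))"
  have "u' 1 = u 1" "u' 2 = u 2" using Suc.hyps by (auto simp: u'_def)
  moreover have "m'(i := m' (Suc i), Suc i := m' i) = (\<lambda>k. if 2 \<le> k \<and> k \<le> Suc i then u (Suc k) else u k)"
    using Suc.hyps by (auto simp: fun_eq_iff m'_def m_def u'_def)
  ultimately show ?case
    unfolding l append_Cons append_assoc in_word_rel_S u'_def[symmetric] Suc.IH m_def[symmetric]
    by (simp add: in_word_rel_S m'_def[symmetric] del: word_rel_simps)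
qed

text \<open>\<open>y_word i\<close> generalizes \<open>X\<close>: it exchanges the block
  \<open>{1..i - 1}\<close> with the single point \<open>i\<close>.\<close>

lemma in_word_rel_y_word:
  assumes "3 \<le> i"
  shows "(u, v) \<in> word_rel (y_word i @ w) \<longleftrightarrow> (\<forall>k\<in>{1..<i}. u k = u 1) \<and>
    ((\<lambda>k. if 1 \<le> k \<and> k < i then u i else if k = i then u 1 else u k), v) \<in> word_rel w"
  using assms
proof (induction i arbitrary: u w rule: nat_induct_at_least)
  case base
  have y3: "y_word 3 = [X]"
    using y_word.simps(2)[of 2] by simp
  have "(\<forall>k\<in>{1..<3}. u k = u 1) \<longleftrightarrow> u 1 = u 2"
  proof -
    have "{1..<3} = {1, 2::nat}" by auto
    then show ?thesis by auto
  qed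
  moreover have "(\<lambda>k. if 1 \<le> k \<and> k < 3 then u 3 else if k = 3 then u 1 else u k) =
      u(1 := u 3, 2 := u 3, 3 := u 1)"
    by (auto simp: fun_eq_iff)
  ultimately show ?case
    by (simp add: y3 in_word_rel del: word_rel_simps)
next
  case (Suc i)
  have y: "y_word (Suc i) = l_word i @ y_word i @ [S i]"
    using Suc.hyps by simp
  define u' where "u' = (\<lambda>k. if 2 \<le> k \<and> k \<le> i then u (Suc k) else u k)"
  define m where "m = (\<lambda>k. if 1 \<le> k \<and> k < i then u' i else if k = i then u' 1 else u' k)"
  have i2: "2 \<le> i" using Suc.hyps by simp
  have cond: "(u 1 = u 2 \<and> (\<forall>k\<in>{1..<i}. u' k = u' 1)) \<longleftrightarrow> (\<forall>k\<in>{1..<Suc i}. u k = u 1)"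
  proof (intro iffI conjI ballI)
    fix k assume a: "u 1 = u 2 \<and> (\<forall>k\<in>{1..<i}. u' k = u' 1)" and k: "k \<in> {1..<Suc i}"
    consider "k = 1" | "k = 2" | "3 \<le> k" using k by fastforce
    then show "u k = u 1"
    proof cases
      case 3
      have "k - 1 \<in> {1..<i}" using 3 k by auto
      then have "u' (k - 1) = u' 1" using a by blast
      moreover have "u' (k - 1) = u k" "u' 1 = u 1" using 3 k by (auto simp: u'_def)
      ultimately show ?thesis by simp
    qed (use conjunct1[OF a] in auto)
  next
    assume a: "\<forall>k\<in>{1..<Suc i}. u k = u 1"
    show "u 1 = u 2" using bspec[OF a, of 2] Suc.hyps by simp
    fix k assume k: "k \<in> {1..<i}"
    have "u (Suc k) = u 1" "u k = u 1" using bspec[OF a, of "Suc k"] bspec[OF a, of k] k by simp_all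
    then show "u' k = u' 1" by (simp add: u'_def)
  qed
  have "m(i := m (Suc i), Suc i := m i) =
      (\<lambda>k. if 1 \<le> k \<and> k < Suc i then u (Suc i) else if k = Suc i then u 1 else u k)"
    using Suc.hyps by (auto simp: fun_eq_iff m_def u'_def)
  then show ?case
    unfolding y append_assoc in_word_rel_l_word[OF i2] u'_def[symmetric] Suc.IH m_def[symmetric] cond[symmetric]
    by (simp add: in_word_rel_S del: word_rel_simps)
qed

text \<open>Both sides exchange the block \<open>{1..i - 1}\<close> with the point
  \<open>i + 1\<close> and fix \<open>i\<close>.\<close>

lemma word_rel_y_braid:
  assumes "3 \<le> i"
  shows "(a, b) \<in> word_rel (y_word i @ [S i] @ y_word i) \<longleftrightarrow> (a, b) \<in> word_rel ([S i] @ y_word i @ [S i])"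
proof -
  define A where "A = (\<forall>k\<in>{1..<i}. a k = a 1)"
  define m where "m = (\<lambda>k. if 1 \<le> k \<and> k < i then a i else if k = i then a 1 else a k)"
  define m' where "m' = m(i := m (Suc i), Suc i := m i)"
  define a' where "a' = a(i := a (Suc i), Suc i := a i)"
  define q where "q = (\<lambda>k. if 1 \<le> k \<and> k < i then a' i else if k = i then a' 1 else a' k)"
  define r where "r = (\<lambda>k. if 1 \<le> k \<and> k < i then m' i else if k = i then m' 1 else m' k)"
  note y = in_word_rel_y_word[OF assms]
  have L: "(a, b) \<in> word_rel (y_word i @ S i # y_word i @ []) \<longleftrightarrow>
    A \<and> (\<forall>k\<in>{1..<i}. m' k = m' 1) \<and> (r, b) \<in> word_rel []"
    unfolding y in_word_rel_S A_def r_def m'_def m_def by (rule refl)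
  have R: "(a, b) \<in> word_rel (S i # y_word i @ [S i]) \<longleftrightarrow>
    (\<forall>k\<in>{1..<i}. a' k = a' 1) \<and> (q(i := q (Suc i), Suc i := q i), b) \<in> word_rel []"
    unfolding y in_word_rel_S q_def a'_def by (rule refl)
  have c1: "\<forall>k\<in>{1..<i}. m' k = m' 1" using assms by (auto simp: m'_def m_def)
  have c2: "(\<forall>k\<in>{1..<i}. a' k = a' 1) = A" unfolding A_def
    by (rule ball_cong) (use assms in \<open>auto simp: a'_def\<close>)
  have c3: "r = q(i := q (Suc i), Suc i := q i)"
    using assms by (auto simp: fun_eq_iff r_def m'_def m_def q_def a'_def)
  show ?thesis
    using L R c1 unfolding c2 c3 append_Cons append_Nil append_Nil2 by blast
qed

lemma word_rel_relation:
  assumes "(v, w) \<in> relations n"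
  shows "word_rel v = word_rel w"
  using assms
proof cases
  case (coxeter i j)
  have id: "word_rel (map S k) = word_rel []" if "adjacent_perm k = id" for k
    by (auto simp: word_rel_map_S that)
  consider "j = i" | "j = Suc i" | "Suc i < j" using coxeter by linarith
  then show ?thesis
  proof cases
    case 1
    then show ?thesis
      using coxeter id[OF adjacent_perm_coxeter(1)[of i]] by (simp add: coxeter_exponent_def One_nat_def)
  next
    case 2
    then show ?thesis
      using coxeter id[OF adjacent_perm_coxeter(2)[of i]] by (simp add: coxeter_exponent_def numeral_3_eq_3)
  next
    case 3
    then show ?thesis
      using coxeter id[OF adjacent_perm_coxeter(3)[OF 3]] by (simp add: coxeter_exponent_def numeral_2_eq_2)
  qed
next
  case (y_braid i)
  then show ?thesis using word_rel_y_braid[of i] by auto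
next
  case (x_commute i)
  have "(a, b) \<in> word_rel [X, S i] \<longleftrightarrow> (a, b) \<in> word_rel [S i, X]" for a b
    using x_commute(3) by (simp add: in_word_rel fun_upd_twist del: word_rel_simps(2))
  then show ?thesis unfolding x_commute(1,2) by (auto simp del: word_rel_simps)
\<comment> \<open>The remaining relations involve only the points 1 to 4, so evaluation with
  \<open>upd4\<close> settles them.\<close>
qed (simp_all only:, (rule word_rel_eqI4; simp only: sigma_word_def append.simps in_word_rel_upd4; auto)+)

section \<open>Block bijections as relations on functions\<close>

text \<open>Every block of a block bijection has points in both rows, so these links determine
  it.\<close>

definition linked :: "(nat + nat) set set \<Rightarrow> nat \<Rightarrow> nat \<Rightarrow> bool" where
  "linked P i j \<longleftrightarrow> (\<exists>B\<in>P. Inl i \<in> B \<and> Inr j \<in> B)"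

text \<open>Agreement outside \<open>{1..n}\<close> matches \<open>generator_rel\<close>, which
  leaves those points alone, and makes the identity correspond to \<open>Id\<close>.\<close>

definition blocks_rel :: "nat \<Rightarrow> (nat + nat) set set \<Rightarrow> ((nat \<Rightarrow> nat) \<times> (nat \<Rightarrow> nat)) set" where
  "blocks_rel n P = {(u, l). (\<forall>i j. linked P i j \<longrightarrow> u i = l j) \<and> (\<forall>k. k \<notin> {1..n} \<longrightarrow> u k = l k)}"

lemma block_simps [simp]: "Inl i \<in> block A B \<longleftrightarrow> i \<in> A" "Inr j \<in> block A B \<longleftrightarrow> j \<in> B"
  by (auto simp: block_def)

lemma linked_range:
  assumes "P \<in> block_bijections n" "linked P i j"
  shows "i \<in> {1..n}" "j \<in> {1..n}"
proof -
  have "\<Union>P = block {1..n} {1..n}"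
    using assms(1) by (auto simp: block_bijections_def partition_on_def)
  then have "Inl i \<in> block {1..n} {1..n}" "Inr j \<in> block {1..n} {1..n}"
    using assms(2) unfolding linked_def by blast+
  then show "i \<in> {1..n}" "j \<in> {1..n}" by simp_all
qed

lemma block_bijection_blocks_unique:
  assumes "P \<in> block_bijections n" "B \<in> P" "B' \<in> P" "p \<in> B" "p \<in> B'"
  shows "B = B'"
  using assms by (auto simp: block_bijections_def partition_on_def disjoint_def)

lemma block_bijection_cover:
  assumes "P \<in> block_bijections n"
  shows "i \<in> {1..n} \<Longrightarrow> \<exists>B\<in>P. Inl i \<in> B" "i \<in> {1..n} \<Longrightarrow> \<exists>B\<in>P. Inr i \<in> B"
proof -
  have "\<Union>P = block {1..n} {1..n}"
    using assms(1) by (auto simp: block_bijections_def partition_on_def)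
  moreover have "i \<in> {1..n} \<Longrightarrow> Inl i \<in> block {1..n} {1..n}" "i \<in> {1..n} \<Longrightarrow> Inr i \<in> block {1..n} {1..n}"
    by simp_all
  ultimately show "i \<in> {1..n} \<Longrightarrow> \<exists>B\<in>P. Inl i \<in> B" "i \<in> {1..n} \<Longrightarrow> \<exists>B\<in>P. Inr i \<in> B"
    by blast+
qed

lemma ex_linked:
  assumes "P \<in> block_bijections n" "i \<in> {1..n}"
  shows "\<exists>j. linked P i j" "\<exists>j. linked P j i"
proof -
  have "\<forall>B\<in>P. (\<exists>i. Inl i \<in> B) \<and> (\<exists>j. Inr j \<in> B)"
    using assms(1) by (simp add: block_bijections_def)
  then show "\<exists>j. linked P i j" "\<exists>j. linked P j i"
    using block_bijection_cover[OF assms(1,2)] unfolding linked_def by blast+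
qed

lemma linked_trans:
  assumes "P \<in> block_bijections n" "linked P i j" "linked P i' j" "linked P i j'"
  shows "linked P i' j'"
  using assms(2-4) block_bijection_blocks_unique[OF assms(1)] unfolding linked_def by metis

lemma linked_eq_imp_subset:
  assumes "P \<in> block_bijections n" "Q \<in> block_bijections n" "\<And>i j. linked P i j \<longleftrightarrow> linked Q i j"
  shows "P \<subseteq> Q"
proof
  fix B assume B: "B \<in> P"
  then obtain i j where ij: "Inl i \<in> B" "Inr j \<in> B"
    using assms(1) by (auto simp: block_bijections_def)
  then have "linked P i j" using B by (auto simp: linked_def)
  then obtain B' where B': "B' \<in> Q" "Inl i \<in> B'" "Inr j \<in> B'"
    using assms(3) by (auto simp: linked_def)
  have mem: "(Inl k \<in> C \<longleftrightarrow> linked R k j) \<and> (Inr k \<in> C \<longleftrightarrow> linked R i k)"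
    if "R \<in> block_bijections n" "C \<in> R" "Inl i \<in> C" "Inr j \<in> C" for R C k
    using that block_bijection_blocks_unique[OF that(1)] unfolding linked_def by metis
  have "B = B'"
  proof (rule Set.set_eqI)
    fix p
    show "p \<in> B \<longleftrightarrow> p \<in> B'"
      using mem[OF assms(1) B ij] mem[OF assms(2) B'] assms(3) by (cases p) simp_all
  qed
  then show "B \<in> Q" using B' by simp
qed

lemma linked_iff_blocks_rel:
  assumes "P \<in> block_bijections n" "i \<in> {1..n}" "j \<in> {1..n}"
  shows "linked P i j \<longleftrightarrow> (\<forall>(u, l)\<in>blocks_rel n P. u i = l j)"
proof
  assume "linked P i j"
  then show "\<forall>(u, l)\<in>blocks_rel n P. u i = l j" by (auto simp: blocks_rel_def)
next
  assume a: "\<forall>(u, l)\<in>blocks_rel n P. u i = l j"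
  obtain B where B: "B \<in> P" "Inl i \<in> B" using block_bijection_cover assms by blast
  have BU: "p \<in> B \<Longrightarrow> p \<in> block {1..n} {1..n}" for p
    using assms(1) B by (auto simp: block_bijections_def partition_on_def)
  \<comment> \<open>Indicator functions of the block of \<open>i\<close>: they are constant on all
    blocks and detect whether lower \<open>j\<close> belongs to it.\<close>
  define u l where "u = (\<lambda>k. if Inl k \<in> B then 1 else 0::nat)" and "l = (\<lambda>k. if Inr k \<in> B then 1 else 0::nat)"
  have "u i' = l j'" if "linked P i' j'" for i' j'
    using that B block_bijection_blocks_unique[OF assms(1)] unfolding linked_def u_def l_def by metis
  moreover have "u k = l k" if "k \<notin> {1..n}" for k
    using that BU[of "Inl k"] BU[of "Inr k"] by (auto simp: u_def l_def)
  ultimately have "(u, l) \<in> blocks_rel n P" by (simp add: blocks_rel_def)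
  then have "u i = l j" using a by blast
  then have "Inr j \<in> B" using B by (simp add: u_def l_def split: if_splits)
  then show "linked P i j" using B by (auto simp: linked_def)
qed

lemma blocks_rel_inj:
  assumes "P \<in> block_bijections n" "Q \<in> block_bijections n" "blocks_rel n P = blocks_rel n Q"
  shows "P = Q"
proof -
  have "linked P i j \<longleftrightarrow> linked Q i j" for i j
    using linked_iff_blocks_rel[OF assms(1)] linked_iff_blocks_rel[OF assms(2)] assms(3)
      linked_range[OF assms(1)] linked_range[OF assms(2)] by metis
  then show ?thesis
    using linked_eq_imp_subset[OF assms(1,2)] linked_eq_imp_subset[OF assms(2,1)] by blast
qed

subsection \<open>Products\<close>

lemma stacked_sym: "sym (stacked P Q)"
  by (auto simp: stacked_def same_block_def sym_def)

lemma stacked_three_rows: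
  assumes "P \<in> block_bijections n" "Q \<in> block_bijections n"
  shows "stacked P Q \<subseteq> three_rows n \<times> three_rows n"
proof -
  have "B \<subseteq> block {1..n} {1..n}" if "B \<in> P \<or> B \<in> Q" for B
    using assms that by (auto simp: block_bijections_def partition_on_def)
  then have "case_sum Upper Middle p \<in> three_rows n" if "B \<in> P" "p \<in> B" for B p
    using that by (cases p) (fastforce simp: three_rows_def block_def)+
  moreover have "case_sum Middle Lower p \<in> three_rows n" if "B \<in> Q" "p \<in> B" for B p
    using that \<open>\<And>B. B \<in> P \<or> B \<in> Q \<Longrightarrow> B \<subseteq> block {1..n} {1..n}\<close>
    by (cases p) (fastforce simp: three_rows_def block_def)+
  ultimately show ?thesis
    by (auto simp: stacked_def same_block_def)
qed

lemma stackedI: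
  "linked P i k \<Longrightarrow> (Upper i, Middle k) \<in> stacked P Q"
  "linked Q k j \<Longrightarrow> (Middle k, Lower j) \<in> stacked P Q"
proof -
  assume "linked P i k"
  then obtain B where B: "B \<in> P" "Inl i \<in> B" "Inr k \<in> B" by (auto simp: linked_def)
  then have "(case_sum Upper Middle (Inl i), case_sum Upper Middle (Inr k)) \<in>
    same_block ((`) (case_sum Upper Middle) ` P)"
    unfolding same_block_def by blast
  then show "(Upper i, Middle k) \<in> stacked P Q" by (simp add: stacked_def)
next
  assume "linked Q k j"
  then obtain B where B: "B \<in> Q" "Inl k \<in> B" "Inr j \<in> B" by (auto simp: linked_def)
  then have "(case_sum Middle Lower (Inl k), case_sum Middle Lower (Inr j)) \<in>
    same_block ((`) (case_sum Middle Lower) ` Q)"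
    unfolding same_block_def by blast
  then show "(Middle k, Lower j) \<in> stacked P Q" by (simp add: stacked_def)
qed

lemma stacked_trancl_sym: "(p, q) \<in> (stacked P Q)\<^sup>+ \<Longrightarrow> (q, p) \<in> (stacked P Q)\<^sup>+"
  using sym_trancl[OF stacked_sym] by (auto dest: symD)

lemma component_points:
  assumes "P \<in> block_bijections n" "Q \<in> block_bijections n" "p \<in> three_rows n"
  shows "\<exists>i\<in>{1..n}. (p, Upper i) \<in> (stacked P Q)\<^sup>+" "\<exists>j\<in>{1..n}. (p, Lower j) \<in> (stacked P Q)\<^sup>+"
proof -
  let ?s = "(stacked P Q)\<^sup>+"
  have mid: "\<exists>k\<in>{1..n}. (p, Middle k) \<in> ?s"
    using assms(3) unfolding three_rows_def
  proof (elim UnE imageE)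
    fix i assume i: "p = Upper i" "i \<in> {1..n}"
    then obtain k where k: "linked P i k" using ex_linked[OF assms(1)] by blast
    show ?thesis using i linked_range[OF assms(1) k] r_into_trancl[OF stackedI(1)[OF k, of Q]] by blast
  next
    fix k assume k: "p = Middle k" "k \<in> {1..n}"
    then obtain i where i: "linked P i k" using ex_linked[OF assms(1)] by blast
    have "(Upper i, Middle k) \<in> ?s" using r_into_trancl[OF stackedI(1)[OF i, of Q]] .
    then show ?thesis using k stacked_trancl_sym trancl_trans by metis
  next
    fix j assume j: "p = Lower j" "j \<in> {1..n}"
    then obtain k where k: "linked Q k j" using ex_linked[OF assms(2)] by blast
    have "(Middle k, Lower j) \<in> ?s" using r_into_trancl[OF stackedI(2)[OF k, of P]] .
    then show ?thesis using j linked_range[OF assms(2) k] stacked_trancl_sym by metis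
  qed
  then obtain k where k: "k \<in> {1..n}" "(p, Middle k) \<in> ?s" by blast
  obtain i j where ij: "linked P i k" "linked Q k j" using ex_linked assms(1,2) k(1) by metis
  have "(Middle k, Upper i) \<in> ?s" "(Middle k, Lower j) \<in> ?s"
    using r_into_trancl[OF stackedI(1)[OF ij(1), of Q]] r_into_trancl[OF stackedI(2)[OF ij(2), of P]]
      stacked_trancl_sym by metis+
  then show "\<exists>i\<in>{1..n}. (p, Upper i) \<in> ?s" "\<exists>j\<in>{1..n}. (p, Lower j) \<in> ?s"
    using k(2) linked_range[OF assms(1) ij(1)] linked_range[OF assms(2) ij(2)] trancl_trans by metis+
qed

lemma stacked_equiv:
  assumes "P \<in> block_bijections n" "Q \<in> block_bijections n"
  shows "equiv (three_rows n) ((stacked P Q)\<^sup>+)"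
proof (rule equivI)
  show "(stacked P Q)\<^sup>+ \<subseteq> three_rows n \<times> three_rows n"
    by (rule trancl_subset_Sigma[OF stacked_three_rows[OF assms]])
  show "refl_on (three_rows n) ((stacked P Q)\<^sup>+)"
    by (rule refl_onI) (meson component_points(1)[OF assms] stacked_trancl_sym trancl_trans)
  show "sym ((stacked P Q)\<^sup>+)" by (rule sym_trancl[OF stacked_sym])
  show "trans ((stacked P Q)\<^sup>+)" by (rule trans_trancl)
qed

lemma block_product_closed:
  assumes "P \<in> block_bijections n" "Q \<in> block_bijections n"
  shows "block_product n P Q \<in> block_bijections n"
proof -
  let ?s = "(stacked P Q)\<^sup>+" and ?f = "case_sum Upper Lower"
  let ?K = "three_rows n // ?s"
  note eq = stacked_equiv[OF assms]
  have union: "\<Union>?K = three_rows n" by (rule Union_quotient[OF eq])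
  have both: "(\<exists>i. Inl i \<in> ?f -` C) \<and> (\<exists>j. Inr j \<in> ?f -` C)" if C: "C \<in> ?K" for C
  proof -
    obtain p where p: "p \<in> three_rows n" "C = ?s `` {p}" using C by (rule quotientE)
    then show ?thesis using component_points[OF assms p(1)] by auto
  qed
  have "partition_on (block {1..n} {1..n}) (block_product n P Q)"
  proof (rule partition_onI)
    have mem: "?f p \<in> three_rows n \<longleftrightarrow> p \<in> block {1..n} {1..n}" for p
      by (cases p) (auto simp: three_rows_def)
    have "\<Union>(block_product n P Q) = ?f -` (\<Union>?K)"
      unfolding block_product_def by blast
    then show "\<Union>(block_product n P Q) = block {1..n} {1..n}"
      unfolding union using mem by auto
    show "{} \<notin> block_product n P Q"
      unfolding block_product_def using both by blast
    fix B B' assume "B \<in> block_product n P Q" "B' \<in> block_product n P Q" "B \<noteq> B'"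
    then obtain C C' where "C \<in> ?K" "C' \<in> ?K" "B = ?f -` C" "B' = ?f -` C'" "C \<noteq> C'"
      unfolding block_product_def by blast
    then show "disjnt B B'"
      using quotient_disj[OF eq, of C C'] unfolding disjnt_def by blast
  qed
  then show ?thesis
    using both unfolding block_bijections_def block_product_def by blast
qed

lemma linked_block_product:
  assumes "P \<in> block_bijections n" "Q \<in> block_bijections n" "i \<in> {1..n}"
  shows "linked (block_product n P Q) i j \<longleftrightarrow> (Upper i, Lower j) \<in> (stacked P Q)\<^sup>+"
proof
  assume "linked (block_product n P Q) i j"
  then obtain C where "C \<in> three_rows n // (stacked P Q)\<^sup>+" "Upper i \<in> C" "Lower j \<in> C"
    by (auto simp: linked_def block_product_def)
  then show "(Upper i, Lower j) \<in> (stacked P Q)\<^sup>+"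
    using quotient_eq_iff[OF stacked_equiv[OF assms(1,2)], of C C] by blast
next
  let ?C = "(stacked P Q)\<^sup>+ `` {Upper i}"
  assume "(Upper i, Lower j) \<in> (stacked P Q)\<^sup>+"
  moreover have "Upper i \<in> three_rows n" using assms by (simp add: three_rows_def)
  ultimately have "?C \<in> three_rows n // (stacked P Q)\<^sup>+" "Upper i \<in> ?C" "Lower j \<in> ?C"
    using equiv_class_self[OF stacked_equiv[OF assms(1,2)]] by (auto intro: quotientI)
  then show "linked (block_product n P Q) i j"
    unfolding linked_def block_product_def by (intro bexI[of _ "case_sum Upper Lower -` ?C"]) auto
qed

lemma blocks_rel_const:
  assumes "P \<in> block_bijections n" "(u, l) \<in> blocks_rel n P" "B \<in> P" "p \<in> B" "q \<in> B"
  shows "case_sum u l p = case_sum u l q"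
proof -
  obtain i j where ij: "Inl i \<in> B" "Inr j \<in> B"
    using assms(1,3) by (auto simp: block_bijections_def)
  have c: "u i' = l j'" if "Inl i' \<in> B" "Inr j' \<in> B" for i' j'
    using assms(2,3) that by (auto simp: blocks_rel_def linked_def)
  have "case_sum u l p = u i" if "p \<in> B" for p
    using that c[OF ij] c[OF ij(1)] c[OF _ ij(2)] by (cases p) auto
  then show ?thesis using assms(4,5) by simp
qed

text \<open>Labellings of the outer rows extend over the middle row exactly when they are constant
  on the components of the stacked diagram.\<close>

lemma blocks_rel_product:
  assumes "P \<in> block_bijections n" "Q \<in> block_bijections n"
  shows "blocks_rel n (block_product n P Q) = blocks_rel n P O blocks_rel n Q"
proof (intro equalityI subsetI; clarify)
  fix u l assume ul: "(u, l) \<in> blocks_rel n (block_product n P Q)"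
  let ?s = "(stacked P Q)\<^sup>+"
  have up_low: "u i = l j" if "(Upper i, Lower j) \<in> ?s" "i \<in> {1..n}" for i j
    using ul that linked_block_product[OF assms that(2)] by (auto simp: blocks_rel_def)
  \<comment> \<open>A middle point takes the value of any upper point linked to it; all of these
    reach one common lower point, so they carry the same value.\<close>
  define m where "m k = (if k \<in> {1..n} then u (SOME i. linked P i k) else u k)" for k
  have um: "u i = m k" if "linked P i k" for i k
  proof -
    define i' where "i' = (SOME i. linked P i k)"
    have i': "linked P i' k" unfolding i'_def using that by (rule someI)
    note rng = linked_range[OF assms(1) that] linked_range[OF assms(1) i']
    obtain j where j: "linked Q k j" using ex_linked[OF assms(2)] rng by blast
    have "(Upper a, Lower j) \<in> ?s" if "linked P a k" for a
      using stackedI(1)[OF that, of Q] stackedI(2)[OF j, of P] by (meson r_into_trancl trancl_trans)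
    then have "u i = l j" "u i' = l j" using up_low that i' rng by blast+
    then show ?thesis using rng by (simp add: m_def i'_def)
  qed
  have "m k = l j" if Q: "linked Q k j" for k j
  proof -
    obtain i where i: "linked P i k" using ex_linked[OF assms(1)] linked_range(1)[OF assms(2) Q] by blast
    have "(Upper i, Lower j) \<in> ?s"
      using stackedI(1)[OF i, of Q] stackedI(2)[OF Q, of P] by (meson r_into_trancl trancl_trans)
    then show ?thesis using up_low linked_range[OF assms(1) i] um[OF i] by simp
  qed
  moreover have "u k = m k" "m k = l k" if "k \<notin> {1..n}" for k
    using that ul by (auto simp: m_def blocks_rel_def)
  ultimately have "(u, m) \<in> blocks_rel n P" "(m, l) \<in> blocks_rel n Q"
    using um by (auto simp: blocks_rel_def)
  then show "(u, l) \<in> blocks_rel n P O blocks_rel n Q" by blast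
next
  fix u l m assume um: "(u, m) \<in> blocks_rel n P" and ml: "(m, l) \<in> blocks_rel n Q"
  \<comment> \<open>The three labellings combined are constant along every edge of the diagram,
    hence on its components.\<close>
  define F where "F = (\<lambda>p. case p of Upper i \<Rightarrow> u i | Middle k \<Rightarrow> m k | Lower j \<Rightarrow> l j)"
  have F: "F (case_sum Upper Middle p) = case_sum u m p" "F (case_sum Middle Lower p) = case_sum m l p" for p
    by (cases p; simp add: F_def)+
  have step: "F p = F q" if "(p, q) \<in> stacked P Q" for p q
  proof -
    from that consider B p' q' where "B \<in> P" "p' \<in> B" "q' \<in> B" "p = case_sum Upper Middle p'" "q = case_sum Upper Middle q'"
      | B p' q' where "B \<in> Q" "p' \<in> B" "q' \<in> B" "p = case_sum Middle Lower p'" "q = case_sum Middle Lower q'"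
      unfolding stacked_def same_block_def by blast
    then show ?thesis
    proof cases
      case 1
      then show ?thesis using blocks_rel_const[OF assms(1) um 1(1-3)] F(1)[of p'] F(1)[of q'] by simp
    next
      case 2
      then show ?thesis using blocks_rel_const[OF assms(2) ml 2(1-3)] F(2)[of p'] F(2)[of q'] by simp
    qed
  qed
  have F_const: "F p = F q" if "(p, q) \<in> (stacked P Q)\<^sup>+" for p q
    using that by (induction rule: trancl_induct) (use step in auto)
  have "u i = l j" if "linked (block_product n P Q) i j" for i j
    using F_const[of "Upper i" "Lower j"] linked_block_product[OF assms] that
      linked_range[OF block_product_closed[OF assms] that] by (auto simp: F_def)
  moreover have "u k = l k" if "k \<notin> {1..n}" for k
    using um ml that by (auto simp: blocks_rel_def)
  ultimately show "(u, l) \<in> blocks_rel n (block_product n P Q)" by (simp add: blocks_rel_def)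
qed

subsection \<open>Generators\<close>

lemma one_block_bijection: "(\<lambda>i. block {i} {i}) ` {1..n} \<in> block_bijections n"
  unfolding block_bijections_def
  by (auto simp: partition_on_def disjoint_def block_def)

lemma blocks_rel_one: "blocks_rel n ((\<lambda>i. block {i} {i}) ` {1..n}) = Id"
  by (auto simp: blocks_rel_def linked_def fun_eq_iff)

lemma Phi_block_bijection:
  assumes "3 \<le> n" "g \<in> generators n"
  shows "\<Phi> n g \<in> block_bijections n"
proof (cases g)
  case X
  have "\<Union>(\<Phi> n X) = block {1..n} {1..n}"
    using assms(1) by (auto simp: block_def)
  moreover have "disjoint (\<Phi> n X)" "{} \<notin> \<Phi> n X"
    by (auto simp: disjoint_def block_def)
  ultimately show ?thesis
    unfolding X block_bijections_def partition_on_def by (auto simp: block_def)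
next
  case (S i)
  then have i: "1 \<le> i" "i < n" using assms by (auto simp: generators_def)
  have "\<Union>(\<Phi> n (S i)) = block {1..n} {1..n}"
    using i by (auto simp: block_def)
  moreover have "disjoint (\<Phi> n (S i))" "{} \<notin> \<Phi> n (S i)"
    by (auto simp: disjoint_def block_def)
  ultimately show ?thesis
    unfolding S block_bijections_def partition_on_def by (auto simp: block_def)
qed

lemma blocks_rel_Phi:
  assumes "3 \<le> n" "g \<in> generators n"
  shows "blocks_rel n (\<Phi> n g) = generator_rel g"
proof (cases g)
  case X
  have l: "linked (\<Phi> n X) i j \<longleftrightarrow> i \<in> {1, 2} \<and> j = 3 \<or> i = 3 \<and> j \<in> {1, 2} \<or> i = j \<and> j \<in> {4..n}" for i j
    by (auto simp: linked_def)
  have "(u, v) \<in> blocks_rel n (\<Phi> n X) \<longleftrightarrow> u 1 = u 2 \<and> v = u(1 := u 3, 2 := u 3, 3 := u 1)" for u v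
  proof
    assume "(u, v) \<in> blocks_rel n (\<Phi> n X)"
    then have a: "linked (\<Phi> n X) i j \<Longrightarrow> u i = v j" "k \<notin> {1..n} \<Longrightarrow> u k = v k" for i j k
      by (auto simp: blocks_rel_def)
    have e: "u 1 = v 3" "u 2 = v 3" "u 3 = v 1" "u 3 = v 2" using a(1) by (simp_all add: l del: \<Phi>.simps)
    have "v k = u k" if "k \<notin> {1, 2, 3}" for k
      using a(1)[of k k] a(2)[of k] that by (cases "k \<in> {1..n}") (auto simp: l simp del: \<Phi>.simps)
    then have "v = u(1 := u 3, 2 := u 3, 3 := u 1)"
      using e by (auto simp: fun_eq_iff)
    then show "u 1 = u 2 \<and> v = u(1 := u 3, 2 := u 3, 3 := u 1)" using e by simp
  next
    assume "u 1 = u 2 \<and> v = u(1 := u 3, 2 := u 3, 3 := u 1)"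
    then show "(u, v) \<in> blocks_rel n (\<Phi> n X)"
      using assms(1) unfolding blocks_rel_def mem_Collect_eq case_prod_conv l by auto
  qed
  then show ?thesis unfolding X by auto
next
  case (S i)
  then have i: "1 \<le> i" "i < n" using assms by (auto simp: generators_def)
  have l: "linked (\<Phi> n (S i)) a b \<longleftrightarrow> a = i \<and> b = Suc i \<or> a = Suc i \<and> b = i \<or> a = b \<and> b \<in> {1..n} - {i, Suc i}" for a b
    by (auto simp: linked_def)
  have "(u, v) \<in> blocks_rel n (\<Phi> n (S i)) \<longleftrightarrow> v = u(i := u (Suc i), Suc i := u i)" for u v
  proof
    assume "(u, v) \<in> blocks_rel n (\<Phi> n (S i))"
    then have a: "linked (\<Phi> n (S i)) a b \<Longrightarrow> u a = v b" "k \<notin> {1..n} \<Longrightarrow> u k = v k" for a b k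
      by (auto simp: blocks_rel_def)
    have e: "u i = v (Suc i)" "u (Suc i) = v i" using a(1) by (simp_all add: l del: \<Phi>.simps)
    have "v k = u k" if "k \<notin> {i, Suc i}" for k
      using a(1)[of k k] a(2)[of k] that by (cases "k \<in> {1..n}") (auto simp: l simp del: \<Phi>.simps)
    then show "v = u(i := u (Suc i), Suc i := u i)"
      using e by (auto simp: fun_eq_iff)
  next
    assume "v = u(i := u (Suc i), Suc i := u i)"
    then show "(u, v) \<in> blocks_rel n (\<Phi> n (S i))"
      using i unfolding blocks_rel_def mem_Collect_eq case_prod_conv l by auto
  qed
  then show ?thesis unfolding S by (auto simp: comp_transpose)
qed

lemma free_extension_word:
  assumes "3 \<le> n" "w \<in> lists (generators n)"
  defines "h \<equiv> free_extension (dual_symmetric_inverse_monoid n) (\<Phi> n)"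
  shows "h w \<in> block_bijections n \<and> blocks_rel n (h w) = word_rel w"
  using assms(2)
proof (induction w)
  case Nil
  show ?case
    using one_block_bijection blocks_rel_one
    by (simp add: h_def free_extension_def dual_symmetric_inverse_monoid_def)
next
  case (Cons a w)
  then have IH: "h w \<in> block_bijections n" "blocks_rel n (h w) = word_rel w" by auto
  have a: "\<Phi> n a \<in> block_bijections n" "blocks_rel n (\<Phi> n a) = generator_rel a"
    using Phi_block_bijection blocks_rel_Phi assms(1) Cons.hyps by auto
  have "h (a # w) = block_product n (\<Phi> n a) (h w)"
    by (simp add: h_def free_extension_def dual_symmetric_inverse_monoid_def)
  then show ?case
    using block_product_closed[OF a(1) IH(1)] blocks_rel_product[OF a(1) IH(1)] a IH by simp
qed

section \<open>Every block bijection is a product of generators\<close>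

text \<open>Surjectivity is proved for pairs of label functions, where multiplying by generators
  amounts to merging labels, changing one label or permuting points.\<close>

definition realizable :: "nat \<Rightarrow> (nat \<Rightarrow> nat) \<Rightarrow> (nat \<Rightarrow> nat) \<Rightarrow> bool" where
  "realizable n f f' \<longleftrightarrow> (\<exists>w\<in>lists (generators n). word_rel w = pair_rel f f')"

lemma realizable_perm:
  assumes "realizable n f f'" "p permutes {1..n}"
  shows "realizable n f (f' \<circ> p)"
proof -
  obtain w where w: "w \<in> lists (generators n)" "word_rel w = pair_rel f f'"
    using assms(1) by (auto simp: realizable_def)
  obtain v where v: "set v \<subseteq> {1..<n}" "adjacent_perm v = p"
    using ex_adjacent_word assms(2) by blast
  have "word_rel (w @ map S v) = pair_rel f (f' \<circ> p)"
    by (auto simp: word_rel_append w word_rel_map_S v pair_rel_def comp_assoc intro!: relcompI)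
  moreover have "set (map S v) \<subseteq> generators n"
  proof -
    have "{1..<n} \<subseteq> {1..n - 1}" by auto
    then show ?thesis using v(1) unfolding generators_def set_map by blast
  qed
  then have "w @ map S v \<in> lists (generators n)"
    using w(1) by auto
  ultimately show ?thesis unfolding realizable_def by blast
qed

lemma realizable_pair_rel_X:
  assumes "realizable n f f'" "pair_rel f f' O generator_rel X = pair_rel g g'"
  shows "realizable n g g'"
proof -
  obtain w where w: "w \<in> lists (generators n)" "word_rel w = pair_rel f f'"
    using assms(1) by (auto simp: realizable_def)
  have "word_rel (w @ [X]) = pair_rel g g'"
    unfolding word_rel_append w word_rel_simps R_O_Id by (rule assms(2))
  moreover have "w @ [X] \<in> lists (generators n)"
    using w(1) by (auto simp: generators_def)
  ultimately show ?thesis unfolding realizable_def by blast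
qed

lemma realizable_X:
  assumes "realizable n f f'" "f' 1 = f' 2"
  shows "realizable n f (f'(1 := f' 3, 2 := f' 3, 3 := f' 1))"
  using realizable_pair_rel_X[OF assms(1) pair_rel_X[OF assms(2)]] .

lemma ex_perm_start:
  assumes "3 \<le> n" "distinct [a, b, c]" "{a, b, c} \<subseteq> {1..n::nat}"
  obtains p where "p permutes {1..n}" "p 1 = a" "p 2 = b" "p 3 = c"
proof -
  define g where "g = (\<lambda>i::nat. if i = 1 then a else if i = 2 then b else c)"
  have "\<exists>p. p permutes {1..n} \<and> (\<forall>i\<in>{1, 2, 3}. p i = g i)"
    by (rule ex_permutes_extending) (use assms in \<open>auto simp: g_def inj_on_def\<close>)
  then show ?thesis using that by (auto simp: g_def)
qed

text \<open>With \<open>a\<close> and \<open>b\<close> brought to the positions 1 and 2, the first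
  \<open>X\<close> merges their labels and exchanges them with the third; the second
  \<open>X\<close> undoes the exchange.\<close>

lemma realizable_join:
  assumes "3 \<le> n" "realizable n f f'" "a \<in> {1..n}" "b \<in> {1..n}" "a \<noteq> b"
  shows "realizable n (id(f' b := f' a) \<circ> f) (id(f' b := f' a) \<circ> f')"
proof -
  have "\<not> {1, 2, 3} \<subseteq> {a, b}"
    using card_mono[of "{a, b}" "{1, 2, 3::nat}"] assms(5) by auto
  then obtain c where c: "c \<in> {1, 2, 3}" "c \<notin> {a, b}" by blast
  have "distinct [a, b, c]" "{a, b, c} \<subseteq> {1..n}" using c assms by auto
  then obtain p where p: "p permutes {1..n}" "p 1 = a" "p 2 = b" "p 3 = c"
    using ex_perm_start[OF assms(1)] by blast
  define q where "q = id(f' b := f' a)"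
  define g where "g = q \<circ> (f' \<circ> p)"
  have g12: "g 1 = g 2" by (simp add: g_def q_def p)
  have "realizable n (q \<circ> f) (g(1 := g 3, 2 := g 3, 3 := g 1))"
    using realizable_pair_rel_X[OF realizable_perm[OF assms(2) p(1)]] pair_rel_X_merge[of f "f' \<circ> p"]
      pair_rel_X[of g "q \<circ> f"] g12 p unfolding g_def q_def comp_apply by simp
  from realizable_X[OF this] have "realizable n (q \<circ> f) (g(1 := g 3, 2 := g 3, 3 := g 1, 1 := g 1, 2 := g 1, 3 := g 3))"
    by simp
  moreover have "g(1 := g 3, 2 := g 3, 3 := g 1, 1 := g 1, 2 := g 1, 3 := g 3) = g"
    using g12 by (auto simp: fun_eq_iff)
  ultimately have "realizable n (q \<circ> f) (g \<circ> inv_into UNIV p)"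
    using realizable_perm permutes_inv[OF p(1)] by metis
  moreover have "g \<circ> inv_into UNIV p = q \<circ> f'"
    using p(1) by (simp add: g_def comp_assoc permutes_inv_o)
  ultimately show ?thesis unfolding q_def by simp
qed

text \<open>With \<open>a\<close>, \<open>b\<close>, \<open>c\<close> at the positions 1, 2, 3, an
  \<open>X\<close> followed by the exchange of 1 and 3 alters only the label at 2, which becomes
  that at 3.\<close>

lemma realizable_move:
  assumes "3 \<le> n" "realizable n f f'" "distinct [a, b, c]" "{a, b, c} \<subseteq> {1..n}" "f' a = f' b"
  shows "realizable n f (f'(b := f' c))"
proof -
  obtain p where p: "p permutes {1..n}" "p 1 = a" "p 2 = b" "p 3 = c"
    using ex_perm_start[OF assms(1,3,4)] .
  define g where "g = f' \<circ> p"
  define h where "h = g(1 := g 3, 2 := g 3, 3 := g 1)"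
  have "g 1 = g 2" by (simp add: g_def p assms)
  then have "realizable n f h"
    unfolding h_def using realizable_X realizable_perm[OF assms(2) p(1)] g_def by blast
  moreover have "transpose 1 3 permutes {1..n}" using assms(1) by (intro permutes_swap_id) auto
  ultimately have "realizable n f (h \<circ> transpose 1 3 \<circ> inv_into UNIV p)"
    using realizable_perm permutes_inv[OF p(1)] by blast
  moreover have "h \<circ> transpose 1 3 \<circ> inv_into UNIV p = f'(b := f' c)"
  proof
    fix k
    define i where "i = inv_into UNIV p k"
    have k: "k = p i" unfolding i_def using p(1) by (simp add: permutes_inverses)
    have pb: "p i = b \<longleftrightarrow> i = 2" using inj_eq[OF permutes_inj[OF p(1)], of i 2] p by simp
    have h: "h 1 = f' c" "h 2 = f' c" "h 3 = f' a" and ab: "a \<noteq> b" "c \<noteq> b"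
      using assms(3) p by (auto simp: h_def g_def)
    consider "i = 1" | "i = 2" | "i = 3" | "i \<noteq> 1" "i \<noteq> 2" "i \<noteq> 3" by blast
    then have "h (transpose 1 3 i) = (f'(b := f' c)) (p i)"
    proof cases
      case 1
      then show ?thesis using h ab p by simp
    next
      case 2
      have "transpose 1 3 (2::nat) = 2" by (rule transpose_apply_other) simp_all
      then show ?thesis using 2 h p by simp
    next
      case 3
      then show ?thesis using h ab p by simp
    next
      case 4
      then have "transpose 1 3 i = i" "h i = f' (p i)"
        by (simp_all add: h_def g_def transpose_apply_other)
      then show ?thesis using pb 4 by simp
    qed
    then show "(h \<circ> transpose 1 3 \<circ> inv_into UNIV p) k = (f'(b := f' c)) k"
      by (simp add: i_def[symmetric] k[symmetric])
  qed
  ultimately show ?thesis by simp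
qed

lemma realizable_diagonal:
  assumes "3 \<le> n" "retraction n J f"
  shows "realizable n f f"
proof -
  have "finite J" using assms(2) by (auto simp: retraction_def intro: finite_subset)
  then show ?thesis using assms(2)
  proof (induction J arbitrary: f rule: finite_induct)
    case empty
    then have "f = id" by (auto simp: retraction_def)
    moreover have "word_rel [] = pair_rel id id" by (simp add: pair_rel_id)
    ultimately show ?case unfolding realizable_def by (metis lists.Nil)
  next
    case (insert j J)
    define g where "g = f(j := j)"
    have fj: "f j \<in> {1..n}" "f j \<noteq> j" "f j \<notin> J" "j \<in> {1..n}" "\<And>i. i \<in> J \<Longrightarrow> f i \<in> {1..n} - insert j J"
      "\<And>i. i \<notin> insert j J \<Longrightarrow> f i = i"
      using insert.prems by (auto simp: retraction_def)
    have "retraction n J g"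
      using insert.prems insert.hyps by (auto simp: retraction_def g_def)
    then have g: "realizable n g g" by (rule insert.IH)
    have "g (f j) = f j" "g j = j" using fj by (auto simp: g_def)
    then have "realizable n (id(j := f j) \<circ> g) (id(j := f j) \<circ> g)"
      using realizable_join[OF assms(1) g, of "f j" j] fj(1,2,4) by simp
    moreover have "id(j := f j) \<circ> g = f"
    proof
      fix i
      show "(id(j := f j) \<circ> g) i = f i"
        using fj(5,6)[of i] by (cases "i \<in> J") (auto simp: g_def)
    qed
    ultimately show ?case by simp
  qed
qed

text \<open>Starting from the diagonal pair, the lower label of one non-representative is changed at
  a time; \<open>f b\<close> and \<open>f' b\<close> are fixed by every intermediate function, so a
  move applies.\<close>

lemma realizable_retractions:
  assumes "3 \<le> n" "retraction n J f" "retraction n J f'"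
  shows "realizable n f f'"
proof -
  have fin: "finite J" using assms(2) by (auto simp: retraction_def intro: finite_subset)
  have "K \<subseteq> J \<Longrightarrow> realizable n f (\<lambda>j. if j \<in> K then f' j else f j)" if "finite K" for K
    using that
  proof (induction K rule: finite_induct)
    case empty
    then show ?case using realizable_diagonal[OF assms(1,2)] by simp
  next
    case (insert b K)
    define g where "g = (\<lambda>j. if j \<in> K then f' j else f j)"
    have g: "realizable n f g" using insert unfolding g_def by blast
    have b: "b \<in> J" "b \<notin> K" "K \<subseteq> J" using insert by auto
    have fb: "f b \<in> {1..n} - J" "f' b \<in> {1..n} - J" "b \<in> {1..n}" using assms(2,3) b by (auto simp: retraction_def)
    have eq: "(\<lambda>j. if j \<in> insert b K then f' j else f j) = g(b := f' b)"
      by (auto simp: g_def fun_eq_iff)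
    show ?case
    proof (cases "f b = f' b")
      case True
      then have "g(b := f' b) = g" using b by (auto simp: g_def fun_eq_iff)
      then show ?thesis using g eq by simp
    next
      case False
      have "g (f b) = f b" "g b = f b" "g (f' b) = f' b"
        using fb b assms(2,3) by (auto simp: g_def retraction_def)
      moreover have "distinct [f b, b, f' b]" "{f b, b, f' b} \<subseteq> {1..n}"
        using fb b False by auto
      ultimately show ?thesis
        using realizable_move[OF assms(1) g, of "f b" b "f' b"] eq by simp
    qed
  qed
  from this[OF fin] have "realizable n f (\<lambda>j. if j \<in> J then f' j else f j)" by simp
  moreover have "(\<lambda>j. if j \<in> J then f' j else f j) = f'"
    using assms(2,3) by (auto simp: fun_eq_iff retraction_def)
  ultimately show ?thesis by simp
qed

text \<open>Labelling each block by its least upper point makes \<open>f\<close> a retraction.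
  \<open>f'\<close> becomes one with the same \<open>J\<close> after a permutation that places a
  lower point of its block at each representative.\<close>

lemma block_bijection_realizable:
  assumes "3 \<le> n" "P \<in> block_bijections n"
  shows "\<exists>w\<in>lists (generators n). word_rel w = blocks_rel n P"
proof -
  define f' where "f' j = (if j \<in> {1..n} then LEAST i. linked P i j else j)" for j
  define f where "f i = (if i \<in> {1..n} then f' (SOME j. linked P i j) else i)" for i
  note rng = linked_range[OF assms(2)]
  have f'_linked: "linked P (f' j) j" if "j \<in> {1..n}" for j
    using LeastI_ex[OF ex_linked(2)[OF assms(2) that]] that by (simp add: f'_def)
  have f'_eq: "f' j = f' j'" if "linked P i j" "linked P i j'" for i j j'
  proof -
    have "linked P i' j \<longleftrightarrow> linked P i' j'" for i'
      using linked_trans[OF assms(2)] that by metis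
    then show ?thesis using rng that by (simp add: f'_def)
  qed
  have f_eq: "f i = f' j" if "linked P i j" for i j
  proof -
    have "linked P i (SOME j. linked P i j)" using that by (rule someI)
    then have "f' (SOME j. linked P i j) = f' j" using that by (rule f'_eq)
    then show ?thesis using rng that by (simp add: f_def)
  qed
  have rel: "blocks_rel n P = pair_rel f f'"
  proof (intro equalityI subsetI; clarify)
    fix u l assume ul: "(u, l) \<in> blocks_rel n P"
    then have ul': "linked P i j \<Longrightarrow> u i = l j" "k \<notin> {1..n} \<Longrightarrow> u k = l k" for i j k
      by (auto simp: blocks_rel_def)
    have l: "l j = u (f' j)" for j
      using ul'(1)[OF f'_linked] ul'(2) by (cases "j \<in> {1..n}") (auto simp: f'_def)
    have "u i = u (f i)" for i
    proof (cases "i \<in> {1..n}")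
      case True
      then obtain j where j: "linked P i j" using ex_linked[OF assms(2)] by blast
      then show ?thesis using ul'(1)[OF j] l f_eq[OF j] by simp
    qed (auto simp: f_def)
    then have "u = u \<circ> f" "l = u \<circ> f'" using l by (auto simp: fun_eq_iff)
    then show "(u, l) \<in> pair_rel f f'" unfolding pair_rel_def by blast
  next
    fix u l assume "(u, l) \<in> pair_rel f f'"
    then obtain \<phi> where "u = \<phi> \<circ> f" "l = \<phi> \<circ> f'" by (auto simp: pair_rel_def)
    then show "(u, l) \<in> blocks_rel n P"
      using f_eq by (auto simp: blocks_rel_def) (auto simp: f_def f'_def)
  qed
  define J where "J = {i \<in> {1..n}. f i \<noteq> i}"
  have f'_rng: "f' j \<in> {1..n}" "f (f' j) = f' j" if "j \<in> {1..n}" for j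
    using f'_linked[OF that] rng f_eq by blast+
  have f_rng: "f i \<in> {1..n}" "f (f i) = f i" if "i \<in> {1..n}" for i
    using ex_linked(1)[OF assms(2) that] f_eq f'_rng rng by metis+
  have f: "retraction n J f"
    unfolding retraction_def
  proof (intro conjI ballI allI impI)
    show "J \<subseteq> {1..n}" by (auto simp: J_def)
    show "f j \<in> {1..n} - J" if "j \<in> J" for j using that f_rng[of j] by (simp add: J_def)
    show "f j = j" if "j \<notin> J" for j using that by (cases "j \<in> {1..n}") (auto simp: J_def f_def)
  qed
  define k where "k r = (SOME j. linked P r j)" for r
  have k: "linked P r (k r)" if "r \<in> {1..n}" for r
    unfolding k_def using ex_linked(1)[OF assms(2) that] by (rule someI_ex)
  have f'k: "f' (k r) = r" if "r \<in> {1..n} - J" for r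
    using f_eq[OF k] that by (auto simp: J_def)
  \<comment> \<open>\<open>k\<close> is injective on the representatives because \<open>f'\<close>
    recovers \<open>r\<close> from \<open>k r\<close>; hence it extends to a permutation.\<close>
  have "\<exists>\<pi>. \<pi> permutes {1..n} \<and> (\<forall>r\<in>{1..n} - J. \<pi> r = k r)"
  proof (rule ex_permutes_extending)
    show "inj_on k ({1..n} - J)" by (rule inj_onI) (metis f'k)
    show "k ` ({1..n} - J) \<subseteq> {1..n}" using k rng by blast
  qed auto
  then obtain \<pi> where \<pi>: "\<pi> permutes {1..n}" "\<And>r. r \<in> {1..n} - J \<Longrightarrow> \<pi> r = k r" by blast
  have "retraction n J (f' \<circ> \<pi>)"
    unfolding retraction_def
  proof (intro conjI ballI allI impI)
    show "J \<subseteq> {1..n}" by (auto simp: J_def)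
    show "(f' \<circ> \<pi>) j \<in> {1..n} - J" if "j \<in> J" for j
      using f'_rng[of "\<pi> j"] permutes_in_image[OF \<pi>(1), of j] that by (simp add: J_def)
    show "(f' \<circ> \<pi>) j = j" if "j \<notin> J" for j
    proof (cases "j \<in> {1..n}")
      case True
      then show ?thesis using \<pi>(2)[of j] f'k[of j] that by simp
    next
      case False
      then show ?thesis using permutes_not_in[OF \<pi>(1), of j] by (auto simp: f'_def)
    qed
  qed
  then have "realizable n f (f' \<circ> \<pi>)" by (rule realizable_retractions[OF assms(1) f])
  then have "realizable n f (f' \<circ> \<pi> \<circ> inv_into UNIV \<pi>)"
    using permutes_inv[OF \<pi>(1)] by (rule realizable_perm)
  then have "realizable n f f'"
    using \<pi>(1) by (simp add: comp_assoc permutes_inv_o)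
  then show ?thesis unfolding realizable_def rel .
qed

section \<open>The presentation\<close>

lemma set_l_word: "2 \<le> i \<Longrightarrow> set (l_word i) \<subseteq> insert X {S k | k. 1 \<le> k \<and> k \<le> i}"
proof (induction i rule: nat_induct_at_least)
  case base
  show ?case using l_word.simps(2)[of 1] by (auto simp: numeral_2_eq_2 One_nat_def)
next
  case (Suc i)
  then show ?case by fastforce
qed

lemma set_y_word: "3 \<le> i \<Longrightarrow> set (y_word i) \<subseteq> insert X {S k | k. 1 \<le> k \<and> k \<le> i}"
proof (induction i rule: nat_induct_at_least)
  case base
  show ?case using y_word.simps(2)[of 2] by simp
next
  case (Suc i)
  then show ?case using set_l_word[of i] by fastforce
qed

lemma relations_generators:
  assumes "3 \<le> n" "(u, v) \<in> relations n"
  shows "u \<in> lists (generators n)" "v \<in> lists (generators n)"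
proof -
  have S: "S i \<in> generators n \<longleftrightarrow> 1 \<le> i \<and> i \<le> n - 1" and X: "X \<in> generators n" for i
    by (auto simp: generators_def)
  have y: "set (y_word i) \<subseteq> generators n" if "3 \<le> i" "i \<le> n - 1" for i
    using set_y_word[of i] that by (fastforce simp: generators_def)
  have "set u \<subseteq> generators n \<and> set v \<subseteq> generators n"
    using assms(2)
  proof cases
    case (coxeter i j)
    have "set (concat (replicate k [S i, S j])) \<subseteq> {S i, S j}" for k by (induction k) auto
    then show ?thesis using coxeter S[of i] S[of j] by (auto simp: subset_iff)
  next
    case (y_braid i)
    then show ?thesis using y S[of i] by auto
  qed (use assms(1) in \<open>auto simp: S X sigma_word_def\<close>)
  then show "u \<in> lists (generators n)" "v \<in> lists (generators n)" by (auto simp: lists_eq_set)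
qed

text \<open>
  The quotient by \<open>r\<close> acts faithfully on the classes, and all other sets are fixed so that the defining
  relations hold as equations between functions; this embeds it in the type of all endofunctions, as
  needed for a locale over the type class of monoids.
\<close>

definition left_action :: "'a set \<Rightarrow> ('a list \<times> 'a list) set \<Rightarrow> 'a \<Rightarrow> 'a list set endo" where
  "left_action A r a =
    Endo (\<lambda>K. if K \<in> lists A // r then \<Union>w\<in>K. r `` {a # w} else K)"

lemma left_action_class:
  assumes "monoid_congruence (free_monoid A) r" "u \<in> lists A" "w \<in> lists A"
  shows "apply_endo (prod_list (map (left_action A r) u)) (r `` {w}) = r `` {u @ w}"
  using assms(2)
proof (induction u)
  case (Cons a u)
  have r: "equiv (lists A) r"
    and left: "\<And>a b c. (a, b) \<in> r \<Longrightarrow> c \<in> lists A \<Longrightarrow> (c @ a, c @ b) \<in> r"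
    using assms(1) by (auto simp: monoid_congruence_def free_monoid_def)
  have uw: "u @ w \<in> lists A" "a # u @ w \<in> lists A" using Cons assms(3) by auto
  have "(\<Union>v\<in>r `` {u @ w}. r `` {a # v}) = r `` {a # u @ w}"
  proof -
    have "r `` {a # v} = r `` {a # u @ w}" if "v \<in> r `` {u @ w}" for v
      using that left[of "u @ w" v "[a]"] Cons.hyps equiv_class_eq[OF r] by auto
    moreover have "u @ w \<in> r `` {u @ w}" using equiv_class_self[OF r uw(1)] .
    ultimately show ?thesis by blast
  qed
  moreover have "r `` {u @ w} \<in> lists A // r" using uw(1) by (rule quotientI)
  ultimately show ?case
    using Cons by (simp add: left_action_def)
qed simp

lemma left_action_outside:
  "K \<notin> lists A // r \<Longrightarrow> apply_endo (prod_list (map (left_action A r) u)) K = K"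
  by (induction u) (simp_all add: left_action_def)

text \<open>The two sides of a relation send the class of \<open>w\<close> to the same class because
  \<open>r\<close> is compatible with right multiplication by \<open>w\<close>.\<close>

lemma presented_left_action:
  assumes "3 \<le> n" "monoid_congruence (free_monoid (generators n)) r" "relations n \<subseteq> r"
  shows "presented n (left_action (generators n) r)"
proof
  let ?A = "generators n"
  let ?ev = "\<lambda>u. prod_list (map (left_action ?A r) u)"
  show "3 \<le> n" by (rule assms(1))
  fix u v assume uv: "(u, v) \<in> relations n"
  have r: "equiv (lists ?A) r"
    and right: "\<And>a b c. (a, b) \<in> r \<Longrightarrow> c \<in> lists ?A \<Longrightarrow> (a @ c, b @ c) \<in> r"
    using assms(2) by (auto simp: monoid_congruence_def free_monoid_def)
  have "apply_endo (?ev u) K = apply_endo (?ev v) K" for K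
  proof (cases "K \<in> lists ?A // r")
    case True
    then obtain w where w: "w \<in> lists ?A" "K = r `` {w}" by (rule quotientE)
    have "(u @ w, v @ w) \<in> r" using right assms(3) uv w(1) by blast
    then have "r `` {u @ w} = r `` {v @ w}" by (rule equiv_class_eq[OF r])
    then show ?thesis
      unfolding w(2) using left_action_class[OF assms(2) _ w(1)] relations_generators[OF assms(1) uv] by simp
  next
    case False
    show ?thesis unfolding left_action_outside[OF False] by (rule refl)
  qed
  then show "?ev u = ?ev v" by (intro endo.expand) auto
qed

theorem theorem14:
  fixes n :: nat
  assumes "3 \<le> n"
  defines "F \<equiv> free_monoid (generators n)"
    and "I \<equiv> dual_symmetric_inverse_monoid n"
    and "h \<equiv> free_extension (dual_symmetric_inverse_monoid n) (\<Phi> n)"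
    and "C \<equiv> congruence_generated (free_monoid (generators n)) (relations n)"
  shows "h \<in> hom F I \<and> h \<one>\<^bsub>F\<^esub> = \<one>\<^bsub>I\<^esub> \<and> (\<forall>g \<in> generators n. h [g] = \<Phi> n g) \<and>
    h ` carrier F = carrier I \<and>
    kernel_congruence F h = C \<and>
    (\<lambda>K. the_elem (h ` K)) \<in> iso (quotient_monoid F C) I"
proof -
  let ?W = "lists (generators n)"
  have F: "carrier F = ?W" "\<one>\<^bsub>F\<^esub> = []" "u \<otimes>\<^bsub>F\<^esub> v = u @ v" for u v
    by (simp_all add: F_def free_monoid_def)
  have I: "carrier I = block_bijections n" "P \<otimes>\<^bsub>I\<^esub> Q = block_product n P Q"
    "\<one>\<^bsub>I\<^esub> = (\<lambda>i. block {i} {i}) ` {1..n}" for P Q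
    by (simp_all add: I_def dual_symmetric_inverse_monoid_def)
  have h: "h w \<in> block_bijections n" "blocks_rel n (h w) = word_rel w" if "w \<in> ?W" for w
    using free_extension_word[OF assms(1) that] by (simp_all add: h_def)
  have h_append: "h (u @ v) = block_product n (h u) (h v)" if "u \<in> ?W" "v \<in> ?W" for u v
  proof (rule blocks_rel_inj[OF h(1) block_product_closed[OF h(1) h(1)]])
    show "blocks_rel n (h (u @ v)) = blocks_rel n (block_product n (h u) (h v))"
      using that by (simp only: h append_in_lists_conv blocks_rel_product word_rel_append)
  qed (use that in auto)
  have h_eq_iff: "h u = h v \<longleftrightarrow> word_rel u = word_rel v" if "u \<in> ?W" "v \<in> ?W" for u v
    using h that blocks_rel_inj by metis
  have h_one: "h [] = \<one>\<^bsub>I\<^esub>"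
    by (simp add: h_def I_def free_extension_def)
  have h_gen: "h [g] = \<Phi> n g" if "g \<in> generators n" for g
  proof (rule blocks_rel_inj[OF h(1) Phi_block_bijection[OF assms(1) that]])
    show "blocks_rel n (h [g]) = blocks_rel n (\<Phi> n g)"
      using that by (simp add: h blocks_rel_Phi[OF assms(1)])
  qed (use that in simp)
  have hom: "h \<in> hom F I"
    by (rule homI) (simp_all add: F I h h_append)
  have surj: "h ` carrier F = carrier I"
  proof
    show "h ` carrier F \<subseteq> carrier I" using h by (auto simp: F I)
    show "carrier I \<subseteq> h ` carrier F"
    proof
      fix P assume "P \<in> carrier I"
      then have P: "P \<in> block_bijections n" by (simp add: I)
      then obtain w where "w \<in> ?W" "word_rel w = blocks_rel n P"
        using block_bijection_realizable[OF assms(1)] by blast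
      then have "P = h w" "w \<in> ?W" using blocks_rel_inj[OF P] h by metis+
      then show "P \<in> h ` carrier F" by (simp add: F)
    qed
  qed
  let ?K = "kernel_congruence F h"
  have K: "(u, v) \<in> ?K \<longleftrightarrow> u \<in> ?W \<and> v \<in> ?W \<and> h u = h v" for u v
    by (auto simp: kernel_congruence_def F)
  have equivK: "equiv ?W ?K"
    by (rule equivI) (auto simp: K refl_on_def sym_def trans_def)
  have congK: "monoid_congruence F ?K"
  proof -
    have "(c @ a, c @ b) \<in> ?K \<and> (a @ c, b @ c) \<in> ?K" if "(a, b) \<in> ?K" "c \<in> ?W" for a b c
      using that by (simp only: K h_append append_in_lists_conv)
    then show ?thesis using equivK by (auto simp: monoid_congruence_def F)
  qed
  have "relations n \<subseteq> ?K"
    using relations_generators[OF assms(1)] word_rel_relation h_eq_iff by (auto simp: K)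
  then have "C \<subseteq> ?K"
    unfolding C_def congruence_generated_def F_def[symmetric] by (rule hull_minimal) (rule congK)
  \<comment> \<open>The generated congruence is an intersection, so the kernel has to lie in each
    congruence \<open>r\<close> that contains the relations; for this the word problem is solved in
    the monoid of left actions on the classes of \<open>r\<close>.\<close>
  moreover have "?K \<subseteq> C"
    unfolding C_def congruence_generated_def F_def[symmetric] hull_def
  proof (rule Inter_greatest)
    fix r assume "r \<in> {t. monoid_congruence F t \<and> relations n \<subseteq> t}"
    then have r: "monoid_congruence (free_monoid (generators n)) r" "relations n \<subseteq> r"
      by (simp_all add: F_def)
    then have eq: "equiv ?W r" by (simp add: monoid_congruence_def free_monoid_def)
    interpret presented n "left_action (generators n) r"
      by (rule presented_left_action[OF assms(1) r])
    show "?K \<subseteq> r"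
    proof (rule subrelI)
      fix u v assume "(u, v) \<in> ?K"
      then have uv: "u \<in> ?W" "v \<in> ?W" "word_rel u = word_rel v"
        using K h_eq_iff by blast+
      \<comment> \<open>Acting on the class of the empty word recovers the class of the acting
        word.\<close>
      have "r `` {u @ []} = r `` {v @ []}"
        using word_problem[OF uv] left_action_class[OF r(1) uv(1), of "[]"] left_action_class[OF r(1) uv(2), of "[]"]
        by simp
      then show "(u, v) \<in> r" using eq_equiv_class[OF _ eq uv(2)] by simp
    qed
  qed
  ultimately have KC: "?K = C" by blast
  \<comment> \<open>The classes of \<open>C\<close> are those of the kernel, so \<open>h\<close>
    maps each of them to a singleton.\<close>
  have the: "the_elem (h ` (C `` {w})) = h w" if "w \<in> ?W" for w
  proof -
    have "h ` (C `` {w}) = {h w}"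
      using that equiv_class_self[OF equivK that] by (auto simp: KC[symmetric] K)
    then show ?thesis by simp
  qed
  have Q: "carrier (quotient_monoid F C) = ?W // C" by (simp add: quotient_monoid_def F)
  have mult: "C `` {u} \<otimes>\<^bsub>quotient_monoid F C\<^esub> C `` {v} = C `` {u @ v}" if "u \<in> ?W" "v \<in> ?W" for u v
  proof -
    have class_eq: "C `` {a @ b} = C `` {u @ v}" if "a \<in> C `` {u}" "b \<in> C `` {v}" for a b
    proof -
      have "(a @ b, u @ v) \<in> C"
        using that by (auto simp: KC[symmetric] K h_append)
      then show ?thesis using equiv_class_eq[OF equivK] KC by blast
    qed
    have self: "u \<in> C `` {u}" "v \<in> C `` {v}"
      using equiv_class_self[OF equivK] that KC by auto
    have "C `` {u} \<otimes>\<^bsub>quotient_monoid F C\<^esub> C `` {v} = (\<Union>a\<in>C `` {u}. \<Union>b\<in>C `` {v}. C `` {a @ b})"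
      by (simp add: quotient_monoid_def F)
    also have "\<dots> = C `` {u @ v}"
      using class_eq self by blast
    finally show ?thesis .
  qed
  have "(\<lambda>K. the_elem (h ` K)) \<in> iso (quotient_monoid F C) I"
  proof (rule isoI)
    show "(\<lambda>K. the_elem (h ` K)) \<in> hom (quotient_monoid F C) I"
    proof (rule homI)
      fix A B assume "A \<in> carrier (quotient_monoid F C)" "B \<in> carrier (quotient_monoid F C)"
      then obtain u v where "u \<in> ?W" "A = C `` {u}" "v \<in> ?W" "B = C `` {v}"
        unfolding Q by (metis quotientE)
      then show "the_elem (h ` (A \<otimes>\<^bsub>quotient_monoid F C\<^esub> B)) = the_elem (h ` A) \<otimes>\<^bsub>I\<^esub> the_elem (h ` B)"
        by (simp add: mult the I h_append)
    next
      fix A assume "A \<in> carrier (quotient_monoid F C)"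
      then obtain u where "u \<in> ?W" "A = C `` {u}" unfolding Q by (metis quotientE)
      then show "the_elem (h ` A) \<in> carrier I" by (simp add: the I h)
    qed
    show "bij_betw (\<lambda>K. the_elem (h ` K)) (carrier (quotient_monoid F C)) (carrier I)"
      unfolding bij_betw_def
    proof
      show "inj_on (\<lambda>K. the_elem (h ` K)) (carrier (quotient_monoid F C))"
      proof (rule inj_onI)
        fix A B assume "A \<in> carrier (quotient_monoid F C)" "B \<in> carrier (quotient_monoid F C)"
          and eq: "the_elem (h ` A) = the_elem (h ` B)"
        then obtain u v where uv: "u \<in> ?W" "A = C `` {u}" "v \<in> ?W" "B = C `` {v}"
          unfolding Q by (metis quotientE)
        then have "h u = h v" using eq by (simp add: the)
        then have "(u, v) \<in> C" using uv K KC by blast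
        then show "A = B" using equiv_class_eq[OF equivK] KC uv by simp
      qed
      show "(\<lambda>K. the_elem (h ` K)) ` carrier (quotient_monoid F C) = carrier I"
      proof -
        have "?W // C = (\<lambda>w. C `` {w}) ` ?W" by (auto simp: quotient_def)
        then show ?thesis
          unfolding Q surj[symmetric] F by (simp only: image_image) (rule image_cong[OF refl the])
      qed
    qed
  qed
  then show ?thesis
    using hom h_one h_gen surj KC by (simp add: F)
qed

end
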